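(* Let $m,n\in\mathbb{N}$ and let $$T:\mathrm{Herm}_m[x_1,\dots,x_n]\to\mathrm{Herm}_m[x_1,\dots,x_n],\qquad T=\sum_{\alpha\in\mathbb{N}_0^n}\frac{1}{\alpha!}\,(Q_\alpha\times\partial^\alpha)$$ be linear, with linear maps $Q_\alpha:\mathrm{Herm}_m\to\mathrm{Herm}_m[x_1,\dots,x_n]$ for all $\alpha\in\mathbb{N}_0^n$. Then the following are equivalent: (i) $T\,\mathrm{Pos}(\mathbb{R}^n)\subseteq\mathrm{Pos}(\mathbb{R}^n)$. (ii) For all $y\in\mathbb{R}^n$, $T_y\,\mathrm{Pos}(\mathbb{R}^n)\subseteq\mathrm{Pos}(\mathbb{R}^n)$. (iii) For all $y\in\mathbb{R}^n$ and $M\in\mathrm{Herm}_{m,+}$, $T_{y,M}\,\mathrm{Pos}(\mathbb{R}^n)\subseteq\{f\in\mathbb{R}[x_1,\dots,x_n]\mid f\ge 0\text{ on }\mathbb{R}^n\}$. (iv) For all $y\in\mathbb{R}^n$ and $M\in\mathrm{Herm}_m$ there exist matrix-valued measures $\mu_{y,M}$ on $\mathbb{R}^n$ such that (a) if $M\in\mathrm{Herm}_{m,+}$, then $\mu_{y,M}$ is positive, and (b) for all $p\in\mathrm{Herm}_m[x_1,\dots,x_n]$ and all $x\in\mathbb{R}^n$, $$(T_{y,M}p)(x)=\int_{\mathbb{R}^n}\langle p(x+t),\mathrm{d}\mu_{y,M}(t)\rangle .$$ Moreover, in this case (i.e., for measures $\mu_{y,M}$ as in (iv)), for all $\beta\in\mathbb{N}_0^n$,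 $y\in\mathbb{R}^n$, and $M\in\mathrm{Herm}_m$, $$Q_\beta(M)(y)=\int_{\mathbb{R}^n} t^\beta\,\mathrm{d}\widetilde\mu_{y,M}(t)\qquad\text{with}\qquad \widetilde\mu_{y,M}:=\sum_{i,j=1}^m H_{i,j}\cdot\langle\mu_{y,H_{i,j}},M\rangle .$$
   Context: $\mathrm{Herm}_m\subseteq\mathbb{C}^{m\times m}$ is the real vector space of Hermitian $m\times m$ matrices, with inner product $\langle A,B\rangle:=\mathrm{tr}(AB)\in\mathbb{R}$; $\mathrm{Herm}_{m,+}$ is the subset of positive semi-definite matrices. $\mathrm{Herm}_m[x_1,\dots,x_n]$ is the set of polynomials in $x_1,\dots,x_n$ with coefficients in $\mathrm{Herm}_m$, a real vector space. $\mathrm{Pos}(\mathbb{R}^n):=\{P\in\mathrm{Herm}_m[x_1,\dots,x_n]\mid P(x)\succeq 0\text{ for all }x\in\mathbb{R}^n\}$, and linear means $\mathbb{R}$-linear. $\mathbb{N}_0=\{0,1,2,\dots\}$. Orthonormal basis of $\mathrm{Herm}_m$: with $E_{k,l}$ the matrix units, $H_{k,l}:=\frac{1}{\sqrt2}(E_{k,l}+E_{l,k})$ for $k<l$, $H_{k,k}:=E_{k,k}$, and $H_{k,l}:=\frac{i}{\sqrt2}(E_{k,l}-E_{l,k})$ (with $i$ the imaginary unit) for $k>l$, where $k,l=1,\dots,m$. For linear $Q_\alpha:\mathrm{Herm}_m\to\mathrm{Herm}_m[x_1,\dots,x_n]$, the operator $Q_\alpha\times\partial^\alpha$ on $\mathrm{Herm}_m[x_1,\dots,x_n]$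 is the linear map determined by $(Q_\alpha\times\partial^\alpha)(M x^\beta):=Q_\alpha(M)\cdot\partial^\alpha x^\beta$ for $M\in\mathrm{Herm}_m$, $\beta\in\mathbb{N}_0^n$. (The infinite sum defining $T$ is finite on each polynomial. Every linear $T$ has a unique representation of this form.) For $y\in\mathbb{R}^n$, $T_y:=\sum_{\alpha\in\mathbb{N}_0^n}\frac1{\alpha!}(Q_\alpha(\cdot)(y)\times\partial^\alpha)$, i.e., $T_y:\mathrm{Herm}_m[x_1,\dots,x_n]\to\mathrm{Herm}_m[x_1,\dots,x_n]$ is the linear map with $T_y(Mx^\beta)=\sum_{\alpha}\frac1{\alpha!}Q_\alpha(M)(y)\cdot\partial^\alpha x^\beta$, where $Q_\alpha(M)(y)\in\mathrm{Herm}_m$ is the value of the polynomial $Q_\alpha(M)$ at $y$. For $M\in\mathrm{Herm}_m$, $T_{y,M}:\mathrm{Herm}_m[x_1,\dots,x_n]\to\mathbb{R}[x_1,\dots,x_n]$, $T_{y,M}p:=\langle T_yp,M\rangle$. A matrix-valued measure on $\mathbb{R}^n$ (with the Borel $\sigma$-algebra) is $\mu=(\mu_{i,j})_{i,j=1}^m$ with finite complex measures $\mu_{i,j}$ such that $\mu(S)\in\mathrm{Herm}_m$ for all Borel $S$; it is positive if $\mu(S)\in\mathrm{Herm}_{m,+}$ for all Borel $S$. For $M\in\mathrm{Herm}_m$, $\langle\mu,M\rangle$ is the finite signed measure $S\mapsto\langle\mu(S),M\rangle$. For $p\in\mathrm{Herm}_m[x_1,\dots,x_n]$, $$\int\langle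 p(x),\mathrm{d}\mu(x)\rangle:=\sum_{i,j=1}^m\int\langle p(x),H_{i,j}\rangle\,\mathrm{d}\langle\mu,H_{i,j}\rangle(x),$$ and for a scalar function $f$ the integral $\int f\,\mathrm{d}\mu\in\mathrm{Herm}_m$ is taken entrywise. An asserted equality involving such an integral includes the assertion that all the scalar integrals exist (the integrands are absolutely integrable). *)

theory Defs
  imports "HOL-Analysis.Analysis" "HOL-Library.Poly_Mapping"
begin

section \<open>Hermitian matrices\<close>

typedef (overloaded) 'm herm = "{A :: complex^'m^'m. \<forall>i j. A $ i $ j = cnj (A $ j $ i)}"
  morphisms hmat Abs_herm
  by (rule exI[of _ 0]) simp

setup_lifting type_definition_herm

lemma hmat_cnj: "hmat A $ i $ j = cnj (hmat A $ j $ i)"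
  using hmat[of A] by blast

lemma herm_eq_iff: "A = B \<longleftrightarrow> (\<forall>i j. hmat A $ i $ j = hmat B $ i $ j)"
  by (simp add: hmat_inject[symmetric] vec_eq_iff)

instantiation herm :: (finite) real_vector
begin

lift_definition zero_herm :: "'a herm" is 0 by simp
lift_definition plus_herm :: "'a herm \<Rightarrow> 'a herm \<Rightarrow> 'a herm" is "(+)" 
  by (metis complex_cnj_add vector_add_component)
lift_definition minus_herm :: "'a herm \<Rightarrow> 'a herm \<Rightarrow> 'a herm" is "(-)"
  by (metis complex_cnj_diff vector_minus_component)
lift_definition uminus_herm :: "'a herm \<Rightarrow> 'a herm" is uminus
  by (metis complex_cnj_minus vector_uminus_component)
lift_definition scaleR_herm :: "real \<Rightarrow> 'a herm \<Rightarrow> 'a herm" is "(*\<^sub>R)"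
  by (metis complex_cnj_scaleR vector_scaleR_component)

instance
  by standard (simp_all add: herm_eq_iff zero_herm.rep_eq plus_herm.rep_eq minus_herm.rep_eq
      uminus_herm.rep_eq scaleR_herm.rep_eq algebra_simps)

end

definition herm_inner :: "'m::finite herm \<Rightarrow> 'm herm \<Rightarrow> real"
  where "herm_inner A B = Re (trace (hmat A ** hmat B))"

lemma of_real_herm_inner: "complex_of_real (herm_inner A B) = trace (hmat A ** hmat B)"
proof -
  have "cnj (trace (hmat A ** hmat B)) = (\<Sum>i\<in>UNIV. \<Sum>k\<in>UNIV. hmat A $ k $ i * hmat B $ i $ k)"
    by (simp add: trace_def matrix_matrix_mult_def hmat_cnj[symmetric])
  also have "\<dots> = trace (hmat A ** hmat B)"
    by (subst sum.swap) (simp add: trace_def matrix_matrix_mult_def)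
  finally show ?thesis
    by (simp add: herm_inner_def complex_eq_iff)
qed

lemma linear_herm_inner_left: "linear (\<lambda>A. herm_inner A B)"
  by (intro linearI)
     (simp_all add: herm_inner_def trace_def matrix_matrix_mult_def plus_herm.rep_eq
       scaleR_herm.rep_eq sum.distrib algebra_simps sum_distrib_left)

lemma herm_inner_zero_left [simp]: "herm_inner 0 B = 0"
  by (rule linear_0[OF linear_herm_inner_left])

definition herm_psd :: "'m::finite herm set"
  where "herm_psd = {A. \<forall>v :: complex^'m. 0 \<le> Re (\<Sum>i\<in>UNIV. \<Sum>j\<in>UNIV. cnj (v $ i) * hmat A $ i $ j * v $ j)}"

text \<open>The quadratic form of a Hermitian matrix is real, so taking its real part loses nothing.\<close>

lemma herm_form_real:
  "(\<Sum>i\<in>UNIV. \<Sum>j\<in>UNIV. cnj (v $ i) * hmat A $ i $ j * v $ j) \<in> \<real>"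
proof -
  have "cnj (\<Sum>i\<in>UNIV. \<Sum>j\<in>UNIV. cnj (v $ i) * hmat A $ i $ j * v $ j)
      = (\<Sum>i\<in>UNIV. \<Sum>j\<in>UNIV. cnj (v $ j) * hmat A $ j $ i * v $ i)"
    by (simp add: hmat_cnj[symmetric] mult_ac)
  also have "\<dots> = (\<Sum>i\<in>UNIV. \<Sum>j\<in>UNIV. cnj (v $ i) * hmat A $ i $ j * v $ j)"
    by (rule sum.swap)
  finally show ?thesis by (simp add: Reals_cnj_iff)
qed

definition matrix_unit :: "'m::finite \<Rightarrow> 'm \<Rightarrow> complex^'m^'m"
  where "matrix_unit k l = (\<chi> i j. if i = k \<and> j = l then 1 else 0)"

text \<open>The linear order on the index type serves only to tell \<open>k < l\<close> from \<open>k > l\<close>.\<close>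

lift_definition herm_basis :: "'m::{finite,linorder} \<Rightarrow> 'm \<Rightarrow> 'm herm" is
  "\<lambda>k l. if k < l then (1 / sqrt 2) *\<^sub>R (matrix_unit k l + matrix_unit l k)
        else if k = l then matrix_unit k k
        else (\<chi> i j. \<i> / sqrt 2 * (matrix_unit k l - matrix_unit l k) $ i $ j)"
  subgoal for k l
  proof -
    have U: "cnj (matrix_unit a b $ i $ j) = matrix_unit b a $ j $ i" for a b i j :: 'm
      by (simp add: matrix_unit_def conj_commute)
    show ?thesis
      by (cases "k < l"; cases "k = l") (simp_all add: U algebra_simps)
  qed
  done


section \<open>Polynomials in several variables\<close>

text \<open>
  A polynomial in variables indexed by \<open>'n\<close> with coefficients in \<open>'a\<close> is a finitely supported
  function on the exponents \<open>\<beta> :: 'n \<Rightarrow>\<^sub>0 nat\<close>; the term \<open>M x\<^sup>\<beta>\<close> is \<open>Poly_Mapping.single \<beta> M\<close>.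
\<close>

type_synonym ('n, 'a) mvpoly = "('n \<Rightarrow>\<^sub>0 nat) \<Rightarrow>\<^sub>0 'a"

instantiation poly_mapping :: (type, real_vector) real_vector
begin

lift_definition scaleR_poly_mapping :: "real \<Rightarrow> ('a \<Rightarrow>\<^sub>0 'b) \<Rightarrow> ('a \<Rightarrow>\<^sub>0 'b)"
  is "\<lambda>r f k. r *\<^sub>R f k"
  by (rule finite_subset[rotated]) auto

instance
  by standard (simp_all add: poly_mapping_eq_iff fun_eq_iff scaleR_poly_mapping.rep_eq lookup_add
      scaleR_add_left scaleR_add_right)

end

definition mpow :: "real^'n::finite \<Rightarrow> ('n \<Rightarrow>\<^sub>0 nat) \<Rightarrow> real"
  where "mpow x \<beta> = (\<Prod>i\<in>UNIV. x $ i ^ Poly_Mapping.lookup \<beta> i)"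

definition mfact :: "('n::finite \<Rightarrow>\<^sub>0 nat) \<Rightarrow> real"
  where "mfact \<alpha> = (\<Prod>i\<in>UNIV. fact (Poly_Mapping.lookup \<alpha> i))"

definition mveval :: "('n::finite, 'a::real_vector) mvpoly \<Rightarrow> real^'n \<Rightarrow> 'a"
  where "mveval p x = (\<Sum>\<beta>\<in>Poly_Mapping.keys p. mpow x \<beta> *\<^sub>R Poly_Mapping.lookup p \<beta>)"

text \<open>
  The coefficient of \<open>x\<^sup>\<gamma>\<close> in \<open>\<partial>\<^sup>\<alpha> f\<close> is \<open>(\<gamma> + \<alpha>)! / \<gamma>!\<close> times that of \<open>x\<^sup>\<gamma>\<^sup>+\<^sup>\<alpha>\<close> in \<open>f\<close>.  Lemmas
  \<open>mvdiff_0\<close>, \<open>mvdiff_add\<close> and \<open>has_derivative_mvdiff\<close> show that this is the iterated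
  partial derivative.
\<close>

lift_definition mvdiff :: "('n::finite \<Rightarrow>\<^sub>0 nat) \<Rightarrow> ('n, real) mvpoly \<Rightarrow> ('n, real) mvpoly"
  is "\<lambda>\<alpha> f \<gamma>. mfact (\<gamma> + \<alpha>) / mfact \<gamma> * f (\<gamma> + \<alpha>)"
proof -
  fix \<alpha> :: "'n \<Rightarrow>\<^sub>0 nat" and f :: "('n \<Rightarrow>\<^sub>0 nat) \<Rightarrow> real"
  assume "finite {k. f k \<noteq> 0}"
  then have "finite ((\<lambda>\<gamma>. \<gamma> + \<alpha>) -` {k. f k \<noteq> 0})"
    by (rule finite_vimageI) (simp add: inj_def)
  then show "finite {\<gamma>. mfact (\<gamma> + \<alpha>) / mfact \<gamma> * f (\<gamma> + \<alpha>) \<noteq> 0}"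
    by (rule finite_subset[rotated]) auto
qed

definition mvscale :: "('n, 'a::real_vector) mvpoly \<Rightarrow> ('n, real) mvpoly \<Rightarrow> ('n, 'a) mvpoly"
  where "mvscale P f = (\<Sum>\<gamma>\<in>Poly_Mapping.keys P. \<Sum>\<delta>\<in>Poly_Mapping.keys f.
    Poly_Mapping.single (\<gamma> + \<delta>) (Poly_Mapping.lookup f \<delta> *\<^sub>R Poly_Mapping.lookup P \<gamma>))"

lemma finite_le_exponent:
  "finite {\<alpha> :: 'n::finite \<Rightarrow>\<^sub>0 nat. \<forall>i. Poly_Mapping.lookup \<alpha> i \<le> Poly_Mapping.lookup \<beta> i}"
proof (rule finite_imageD)
  have "Poly_Mapping.lookup ` {\<alpha>. \<forall>i. Poly_Mapping.lookup \<alpha> i \<le> Poly_Mapping.lookup \<beta> i}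
      \<subseteq> (\<Pi>\<^sub>E i\<in>UNIV. {..Poly_Mapping.lookup \<beta> i})"
    by auto
  moreover have "finite (\<Pi>\<^sub>E i\<in>UNIV. {..Poly_Mapping.lookup \<beta> i})"
    by (intro finite_PiE) auto
  ultimately show "finite (Poly_Mapping.lookup ` {\<alpha>. \<forall>i. Poly_Mapping.lookup \<alpha> i \<le> Poly_Mapping.lookup \<beta> i})"
    by (rule finite_subset)
  show "inj_on Poly_Mapping.lookup {\<alpha>. \<forall>i. Poly_Mapping.lookup \<alpha> i \<le> Poly_Mapping.lookup \<beta> i}"
    by (simp add: inj_on_def)
qed

lemma mfact_pos: "mfact \<alpha> > 0"
  by (simp add: mfact_def prod_pos)

lemma mpow_add: "mpow x (\<alpha> + \<beta>) = mpow x \<alpha> * mpow x \<beta>"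
  by (simp add: mpow_def lookup_add power_add prod.distrib)

lemma sum_monomials:
  "(\<Sum>\<beta>\<in>Poly_Mapping.keys p. Poly_Mapping.single \<beta> (Poly_Mapping.lookup p \<beta>)) = p"
  by (rule poly_mapping_eqI)
     (simp add: lookup_sum lookup_single when_def in_keys_iff)

lemma mveval_superset:
  assumes "finite S" "Poly_Mapping.keys p \<subseteq> S"
  shows "mveval p x = (\<Sum>\<beta>\<in>S. mpow x \<beta> *\<^sub>R Poly_Mapping.lookup p \<beta>)"
  unfolding mveval_def using assms
  by (intro sum.mono_neutral_left) (auto simp: in_keys_iff)

lemma mveval_zero [simp]: "mveval 0 x = 0"
  by (simp add: mveval_def)

lemma mveval_add: "mveval (p + q) x = mveval p x + mveval q x"
proof -
  let ?S = "Poly_Mapping.keys p \<union> Poly_Mapping.keys q"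
  have E: "mveval r x = (\<Sum>\<beta>\<in>?S. mpow x \<beta> *\<^sub>R Poly_Mapping.lookup r \<beta>)" if "Poly_Mapping.keys r \<subseteq> ?S" for r
    using that by (intro mveval_superset) auto
  have "Poly_Mapping.keys (p + q) \<subseteq> ?S" by (rule Poly_Mapping.keys_add)
  then show ?thesis
    by (simp add: E lookup_add scaleR_add_right sum.distrib)
qed

lemma mveval_sum: "mveval (\<Sum>a\<in>A. p a) x = (\<Sum>a\<in>A. mveval (p a) x)"
  by (induction A rule: infinite_finite_induct) (auto simp: mveval_add)

lemma mveval_single: "mveval (Poly_Mapping.single \<beta> c) x = mpow x \<beta> *\<^sub>R c"
  by (cases "c = 0") (auto simp: mveval_def)

lemma mveval_mvscale: "mveval (mvscale P f) x = mveval f x *\<^sub>R mveval P x"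
  by (simp add: mvscale_def mveval_sum mveval_single mpow_add)
     (simp add: mveval_def scaleR_sum_left scaleR_sum_right sum_distrib_left mult_ac)

lemma mvdiff_0: "mvdiff 0 f = f"
  by (rule poly_mapping_eqI) (simp add: mvdiff.rep_eq less_imp_neq[OF mfact_pos, symmetric])

lemma mvdiff_add: "mvdiff (\<alpha> + \<beta>) f = mvdiff \<alpha> (mvdiff \<beta> f)"
proof (rule poly_mapping_eqI)
  fix \<gamma>
  have "mfact (\<gamma> + \<alpha>) \<noteq> 0" using mfact_pos[of "\<gamma> + \<alpha>"] by simp
  then show "Poly_Mapping.lookup (mvdiff (\<alpha> + \<beta>) f) \<gamma> = Poly_Mapping.lookup (mvdiff \<alpha> (mvdiff \<beta> f)) \<gamma>"
    by (simp add: mvdiff.rep_eq add.assoc)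
qed

lemma linear_mvdiff: "linear (mvdiff \<alpha>)"
  by (intro linearI poly_mapping_eqI)
     (simp_all add: mvdiff.rep_eq lookup_add scaleR_poly_mapping.rep_eq algebra_simps)

lemma mvdiff_single:
  "mvdiff \<alpha> (Poly_Mapping.single \<beta> c) =
    (if \<forall>i. Poly_Mapping.lookup \<alpha> i \<le> Poly_Mapping.lookup \<beta> i
     then Poly_Mapping.single (\<beta> - \<alpha>) (mfact \<beta> / mfact (\<beta> - \<alpha>) * c) else 0)"
proof (cases "\<forall>i. Poly_Mapping.lookup \<alpha> i \<le> Poly_Mapping.lookup \<beta> i")
  case True
  then have "\<beta> - \<alpha> + \<alpha> = \<beta>"
    by (intro poly_mapping_eqI) (simp add: lookup_add lookup_minus)
  moreover have "\<beta> = \<gamma> + \<alpha> \<longleftrightarrow> \<beta> - \<alpha> = \<gamma>" for \<gamma>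
    using calculation by auto
  ultimately show ?thesis using True
    by (intro poly_mapping_eqI) (auto simp: mvdiff.rep_eq lookup_single when_def)
next
  case False
  then have "\<beta> \<noteq> \<gamma> + \<alpha>" for \<gamma> by (auto simp: lookup_add)
  with False show ?thesis
    by (intro poly_mapping_eqI) (auto simp: mvdiff.rep_eq lookup_single when_def)
qed

lemma has_derivative_mvdiff:
  fixes x :: "real^'n"
  shows "((\<lambda>h. mveval f (x + h *\<^sub>R axis i 1)) has_real_derivative mveval (mvdiff (Poly_Mapping.single i 1) f) x) (at 0)"
proof -
  let ?d = "\<lambda>\<beta>. real (Poly_Mapping.lookup \<beta> i) * mpow x (\<beta> - Poly_Mapping.single i 1)"
  have split: "mpow y \<beta> = y $ i ^ Poly_Mapping.lookup \<beta> i * (\<Prod>j\<in>UNIV - {i}. y $ j ^ Poly_Mapping.lookup \<beta> j)" for y :: "real^'n" and \<beta>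
    by (simp add: mpow_def prod.remove[of UNIV i])
  have mono: "((\<lambda>h. mpow (x + h *\<^sub>R axis i 1) \<beta>) has_real_derivative ?d \<beta>) (at 0)" for \<beta>
  proof -
    have "(\<Prod>j\<in>UNIV - {i}. (x + h *\<^sub>R axis i 1) $ j ^ Poly_Mapping.lookup \<beta> j) = (\<Prod>j\<in>UNIV - {i}. x $ j ^ Poly_Mapping.lookup \<beta> j)" for h
      by (intro prod.cong) (auto simp: axis_def)
    moreover have "(\<Prod>j\<in>UNIV - {i}. x $ j ^ Poly_Mapping.lookup (\<beta> - Poly_Mapping.single i 1) j) = (\<Prod>j\<in>UNIV - {i}. x $ j ^ Poly_Mapping.lookup \<beta> j)"
      by (intro prod.cong) (auto simp: lookup_minus lookup_single when_def)
    ultimately show ?thesis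
      unfolding split
      by (auto intro!: derivative_eq_intros simp: axis_def lookup_minus lookup_single)
  qed
  have der: "mveval (mvdiff (Poly_Mapping.single i 1) (Poly_Mapping.single \<beta> c)) x = ?d \<beta> * c" for \<beta> and c :: real
  proof (cases "Poly_Mapping.lookup \<beta> i")
    case 0
    then show ?thesis by (auto simp: mvdiff_single lookup_single dest!: spec[of _ i])
  next
    case (Suc k)
    let ?\<beta>' = "\<beta> - Poly_Mapping.single i 1"
    have "mfact \<beta> = fact (Suc k) * (\<Prod>j\<in>UNIV - {i}. fact (Poly_Mapping.lookup \<beta> j))"
      using Suc by (simp add: mfact_def prod.remove[of UNIV i])
    moreover have "mfact ?\<beta>' = fact k * (\<Prod>j\<in>UNIV - {i}. fact (Poly_Mapping.lookup ?\<beta>' j))"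
      using Suc by (simp add: mfact_def prod.remove[of UNIV i] lookup_minus)
    moreover have "(\<Prod>j\<in>UNIV - {i}. fact (Poly_Mapping.lookup ?\<beta>' j)) = (\<Prod>j\<in>UNIV - {i}. fact (Poly_Mapping.lookup \<beta> j) :: real)"
      by (intro prod.cong) (auto simp: lookup_minus lookup_single when_def)
    ultimately have "mfact \<beta> = real (Suc k) * mfact ?\<beta>'" by (simp add: algebra_simps)
    moreover have "mfact ?\<beta>' \<noteq> 0" using mfact_pos[of ?\<beta>'] by simp
    moreover have "\<forall>j. Poly_Mapping.lookup (Poly_Mapping.single i 1) j \<le> Poly_Mapping.lookup \<beta> j"
      using Suc by (auto simp: lookup_single when_def)
    ultimately show ?thesis using Suc by (simp add: mvdiff_single mveval_single)
  qed
  have "mvdiff (Poly_Mapping.single i 1) f =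
      (\<Sum>\<beta>\<in>Poly_Mapping.keys f. mvdiff (Poly_Mapping.single i 1) (Poly_Mapping.single \<beta> (Poly_Mapping.lookup f \<beta>)))"
    using linear_sum[OF linear_mvdiff, of "Poly_Mapping.single i 1"
        "\<lambda>\<beta>. Poly_Mapping.single \<beta> (Poly_Mapping.lookup f \<beta>)" "Poly_Mapping.keys f"]
    by (simp add: sum_monomials)
  then have "mveval (mvdiff (Poly_Mapping.single i 1) f) x = (\<Sum>\<beta>\<in>Poly_Mapping.keys f. ?d \<beta> * Poly_Mapping.lookup f \<beta>)"
    by (simp only: mveval_sum der)
  then show ?thesis
    unfolding mveval_def[of f]
    by (auto intro!: derivative_eq_intros mono simp: mult.commute)
qed

definition diff_term ::
  "('a::real_vector \<Rightarrow> ('n::finite, 'b::real_vector) mvpoly) \<Rightarrow> ('n \<Rightarrow>\<^sub>0 nat) \<Rightarrow> ('n, 'a) mvpoly \<Rightarrow> ('n, 'b) mvpoly"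
  where "diff_term Q \<alpha> p = (\<Sum>\<beta>\<in>Poly_Mapping.keys p.
    mvscale (Q (Poly_Mapping.lookup p \<beta>)) (mvdiff \<alpha> (Poly_Mapping.single \<beta> 1)))"

text \<open>\<^const>\<open>Sum_any\<close> sums over the support, which is finite by \<open>finite_diff_op_support\<close> below.\<close>

definition diff_op ::
  "(('n::finite \<Rightarrow>\<^sub>0 nat) \<Rightarrow> 'a::real_vector \<Rightarrow> ('n, 'b::real_vector) mvpoly) \<Rightarrow> ('n, 'a) mvpoly \<Rightarrow> ('n, 'b) mvpoly"
  where "diff_op Q p = Sum_any (\<lambda>\<alpha>. (1 / mfact \<alpha>) *\<^sub>R diff_term (Q \<alpha>) \<alpha> p)"

definition diff_op_at ::
  "(('n::finite \<Rightarrow>\<^sub>0 nat) \<Rightarrow> 'm::finite herm \<Rightarrow> ('n, 'm herm) mvpoly) \<Rightarrow> real^'n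
    \<Rightarrow> ('n, 'm herm) mvpoly \<Rightarrow> ('n, 'm herm) mvpoly"
  where "diff_op_at Q y = diff_op (\<lambda>\<alpha> M. Poly_Mapping.single 0 (mveval (Q \<alpha> M) y))"

definition diff_op_at_inner ::
  "(('n::finite \<Rightarrow>\<^sub>0 nat) \<Rightarrow> 'm::finite herm \<Rightarrow> ('n, 'm herm) mvpoly) \<Rightarrow> real^'n \<Rightarrow> 'm herm
    \<Rightarrow> ('n, 'm herm) mvpoly \<Rightarrow> ('n, real) mvpoly"
  where "diff_op_at_inner Q y M p = Poly_Mapping.map (\<lambda>A. herm_inner A M) (diff_op_at Q y p)"

definition pos_herm_polys :: "('n::finite, 'm::finite herm) mvpoly set"
  where "pos_herm_polys = {P. \<forall>x. mveval P x \<in> herm_psd}"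

definition nonneg_polys :: "('n::finite, real) mvpoly set"
  where "nonneg_polys = {f. \<forall>x. 0 \<le> mveval f x}"

lemma finite_diff_op_support:
  "finite {\<alpha>. (1 / mfact \<alpha>) *\<^sub>R diff_term (Q \<alpha>) \<alpha> p \<noteq> 0}"
proof (rule finite_subset)
  let ?S = "\<Union>\<beta>\<in>Poly_Mapping.keys p. {\<alpha>. \<forall>i. Poly_Mapping.lookup \<alpha> i \<le> Poly_Mapping.lookup \<beta> i}"
  show "finite ?S" by (intro finite_UN_I finite_le_exponent) simp
  have nz: "diff_term (Q \<alpha>) \<alpha> p = 0" if "\<alpha> \<notin> ?S" for \<alpha>
    using that unfolding diff_term_def
    by (intro sum.neutral) (auto simp: mvdiff_single mvscale_def)
  show "{\<alpha>. (1 / mfact \<alpha>) *\<^sub>R diff_term (Q \<alpha>) \<alpha> p \<noteq> 0} \<subseteq> ?S"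
  proof
    fix \<alpha> assume "\<alpha> \<in> {\<alpha>. (1 / mfact \<alpha>) *\<^sub>R diff_term (Q \<alpha>) \<alpha> p \<noteq> 0}"
    then have "diff_term (Q \<alpha>) \<alpha> p \<noteq> 0" by auto
    then show "\<alpha> \<in> ?S" using nz by blast
  qed
qed

lemma mvscale_superset:
  assumes "finite S" "Poly_Mapping.keys P \<subseteq> S"
  shows "mvscale P f = (\<Sum>\<gamma>\<in>S. \<Sum>\<delta>\<in>Poly_Mapping.keys f.
    Poly_Mapping.single (\<gamma> + \<delta>) (Poly_Mapping.lookup f \<delta> *\<^sub>R Poly_Mapping.lookup P \<gamma>))"
  unfolding mvscale_def using assms
  by (intro sum.mono_neutral_left) (auto simp: in_keys_iff)

lemma linear_mvscale_left: "linear (\<lambda>P. mvscale P f)"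
proof (rule linearI)
  fix P R :: "('a, 'b) mvpoly" and r :: real
  let ?S = "Poly_Mapping.keys P \<union> Poly_Mapping.keys R"
  have fin: "finite ?S" by simp
  have "mvscale (P + R) f = (\<Sum>\<gamma>\<in>?S. \<Sum>\<delta>\<in>Poly_Mapping.keys f.
      Poly_Mapping.single (\<gamma> + \<delta>) (Poly_Mapping.lookup f \<delta> *\<^sub>R Poly_Mapping.lookup (P + R) \<gamma>))"
    by (intro mvscale_superset fin Poly_Mapping.keys_add)
  then show "mvscale (P + R) f = mvscale P f + mvscale R f"
    by (simp add: mvscale_superset[OF fin, of P] mvscale_superset[OF fin, of R]
        lookup_add scaleR_add_right single_add sum.distrib)
  have "Poly_Mapping.keys (r *\<^sub>R P) \<subseteq> Poly_Mapping.keys P"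
    by (auto simp: in_keys_iff scaleR_poly_mapping.rep_eq)
  then have "mvscale (r *\<^sub>R P) f = (\<Sum>\<gamma>\<in>Poly_Mapping.keys P. \<Sum>\<delta>\<in>Poly_Mapping.keys f.
      Poly_Mapping.single (\<gamma> + \<delta>) (Poly_Mapping.lookup f \<delta> *\<^sub>R Poly_Mapping.lookup (r *\<^sub>R P) \<gamma>))"
    by (intro mvscale_superset) auto
  moreover have "Poly_Mapping.single b (r *\<^sub>R c) = r *\<^sub>R Poly_Mapping.single b c" for b :: "'a \<Rightarrow>\<^sub>0 nat" and c :: 'b
    by (rule poly_mapping_eqI) (simp add: scaleR_poly_mapping.rep_eq lookup_single when_def)
  ultimately show "mvscale (r *\<^sub>R P) f = r *\<^sub>R mvscale P f"
    by (simp add: mvscale_def scaleR_poly_mapping.rep_eq scaleR_sum_right)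
       (simp add: mult.commute flip: scaleR_scaleR)
qed

lemma diff_term_single:
  assumes "linear Q"
  shows "diff_term Q \<alpha> (Poly_Mapping.single \<beta> M) = mvscale (Q M) (mvdiff \<alpha> (Poly_Mapping.single \<beta> 1))"
  by (cases "M = 0") (auto simp: diff_term_def linear_0[OF assms] mvscale_def)

lemma linear_diff_term:
  fixes Q :: "'a::real_vector \<Rightarrow> ('n::finite, 'b::real_vector) mvpoly"
  assumes "linear Q"
  shows "linear (diff_term Q \<alpha>)"
proof (rule linearI)
  let ?F = "\<lambda>\<beta> M. mvscale (Q M) (mvdiff \<alpha> (Poly_Mapping.single \<beta> 1))"
  have lin: "linear (?F \<beta>)" for \<beta>
    using linear_compose[OF assms linear_mvscale_left] by (simp add: o_def)
  have sup: "diff_term Q \<alpha> p = (\<Sum>\<beta>\<in>S. ?F \<beta> (Poly_Mapping.lookup p \<beta>))"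
    if "finite S" "Poly_Mapping.keys p \<subseteq> S" for p :: "('n, 'a) mvpoly" and S
    unfolding diff_term_def using that
    by (intro sum.mono_neutral_left) (auto simp: in_keys_iff linear_0[OF assms] mvscale_def)
  fix p q :: "('n, 'a) mvpoly" and r :: real
  let ?S = "Poly_Mapping.keys p \<union> Poly_Mapping.keys q"
  show "diff_term Q \<alpha> (p + q) = diff_term Q \<alpha> p + diff_term Q \<alpha> q"
    by (simp add: sup[of ?S] keys_add lookup_add linear_add[OF lin] sum.distrib)
  have "Poly_Mapping.keys (r *\<^sub>R p) \<subseteq> Poly_Mapping.keys p"
    by (auto simp: in_keys_iff scaleR_poly_mapping.rep_eq)
  then show "diff_term Q \<alpha> (r *\<^sub>R p) = r *\<^sub>R diff_term Q \<alpha> p"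
    by (simp add: sup[of "Poly_Mapping.keys p"] scaleR_poly_mapping.rep_eq linear_scale[OF lin] scaleR_sum_right)
qed


section \<open>Signed, complex and matrix-valued measures\<close>

text \<open>Finite signed and complex measures: countably additive set functions on the \<open>\<sigma>\<close>-algebra of \<open>M\<close>.\<close>

definition vector_measure :: "'a measure \<Rightarrow> ('a set \<Rightarrow> 'b::real_normed_vector) \<Rightarrow> bool"
  where "vector_measure M \<nu> \<longleftrightarrow>
    (\<forall>A :: nat \<Rightarrow> 'a set. range A \<subseteq> sets M \<longrightarrow> disjoint_family A \<longrightarrow> (\<lambda>i. \<nu> (A i)) sums \<nu> (\<Union>i. A i))"

text \<open>
  The positive part of the Jordan decomposition, \<open>\<nu>\<^sup>+(S) = sup {\<nu>(B) | B \<subseteq> S measurable}\<close>;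
  \<^const>\<open>ennreal\<close> maps negative values to \<open>0 = \<nu>({})\<close>.  The negative part is the positive part of \<open>-\<nu>\<close>.
\<close>

definition jordan_pos :: "'a measure \<Rightarrow> ('a set \<Rightarrow> real) \<Rightarrow> 'a measure"
  where "jordan_pos M \<nu> = measure_of (space M) (sets M) (\<lambda>S. SUP B\<in>{B\<in>sets M. B \<subseteq> S}. ennreal (\<nu> B))"

definition jordan_neg :: "'a measure \<Rightarrow> ('a set \<Rightarrow> real) \<Rightarrow> 'a measure"
  where "jordan_neg M \<nu> = jordan_pos M (\<lambda>S. - \<nu> S)"

definition signed_integrable :: "'a measure \<Rightarrow> ('a set \<Rightarrow> real) \<Rightarrow> ('a \<Rightarrow> real) \<Rightarrow> bool"
  where "signed_integrable M \<nu> f \<longleftrightarrow> integrable (jordan_pos M \<nu>) f \<and> integrable (jordan_neg M \<nu>) f"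

definition signed_integral :: "'a measure \<Rightarrow> ('a set \<Rightarrow> real) \<Rightarrow> ('a \<Rightarrow> real) \<Rightarrow> real"
  where "signed_integral M \<nu> f = integral\<^sup>L (jordan_pos M \<nu>) f - integral\<^sup>L (jordan_neg M \<nu>) f"

definition complex_integrable :: "'a measure \<Rightarrow> ('a set \<Rightarrow> complex) \<Rightarrow> ('a \<Rightarrow> real) \<Rightarrow> bool"
  where "complex_integrable M \<nu> f \<longleftrightarrow>
    signed_integrable M (\<lambda>S. Re (\<nu> S)) f \<and> signed_integrable M (\<lambda>S. Im (\<nu> S)) f"

definition complex_integral :: "'a measure \<Rightarrow> ('a set \<Rightarrow> complex) \<Rightarrow> ('a \<Rightarrow> real) \<Rightarrow> complex"
  where "complex_integral M \<nu> f =
    Complex (signed_integral M (\<lambda>S. Re (\<nu> S)) f) (signed_integral M (\<lambda>S. Im (\<nu> S)) f)"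

lemma vector_measure_empty:
  assumes "vector_measure M \<nu>"
  shows "\<nu> {} = 0"
proof -
  have "(\<lambda>i. \<nu> {}) sums \<nu> {}"
    using assms unfolding vector_measure_def
    by (elim allE[of _ "\<lambda>_. {}"]) (simp add: disjoint_family_on_def)
  then have "(\<lambda>i::nat. \<nu> {}) \<longlonglongrightarrow> 0" by (intro summable_LIMSEQ_zero) (rule sums_summable)
  then show ?thesis by (simp add: LIMSEQ_const_iff)
qed

lemma emeasure_jordan_pos:
  assumes \<nu>: "vector_measure M \<nu>" and S: "S \<in> sets M"
  shows "emeasure (jordan_pos M \<nu>) S = (SUP B\<in>{B\<in>sets M. B \<subseteq> S}. ennreal (\<nu> B))"
proof -
  define P where "P = (\<lambda>S. SUP B\<in>{B\<in>sets M. B \<subseteq> S}. ennreal (\<nu> B))"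
  have e: "\<nu> {} = 0" using \<nu> by (rule vector_measure_empty)
  have add: "(\<lambda>i. \<nu> (A i)) sums \<nu> (\<Union>i. A i)"
    if "range A \<subseteq> sets M" "disjoint_family A" for A :: "nat \<Rightarrow> _"
    using \<nu> that unfolding vector_measure_def by blast
  have add2: "\<nu> (B \<union> C) = \<nu> B + \<nu> C" if "B \<in> sets M" "C \<in> sets M" "B \<inter> C = {}" for B C
  proof -
    have "range (binaryset B C) \<subseteq> sets M" using that by (auto simp: binaryset_def)
    moreover have "disjoint_family (binaryset B C)"
      using that by (auto simp: disjoint_family_on_def binaryset_def)
    ultimately have "(\<lambda>i. \<nu> (binaryset B C i)) sums \<nu> (\<Union>i. binaryset B C i)" by (rule add)
    moreover have "(\<lambda>i. \<nu> (binaryset B C i)) sums (\<nu> B + \<nu> C)"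
      using sums_finite[of "{0, 1}" "\<lambda>i. \<nu> (binaryset B C i)"] e by (auto simp: binaryset_def)
    ultimately show ?thesis using sums_unique2 by (fastforce simp: UN_binaryset_eq)
  qed
  have upper: "ennreal (\<nu> B) \<le> P S" if "B \<in> sets M" "B \<subseteq> S" for B S
    unfolding P_def using that by (intro SUP_upper) auto
  have ca: "countably_additive (sets M) P"
    unfolding countably_additive_def
  proof (intro allI impI)
    fix A :: "nat \<Rightarrow> _"
    assume A: "range A \<subseteq> sets M" "disjoint_family A" "(\<Union>i. A i) \<in> sets M"
    have A': "A i \<in> sets M" for i using A by auto
    have fin: "(\<Sum>i<n. P (A i)) \<le> P (\<Union>i<n. A i)" for n
    proof (induction n)
      case 0
      then show ?case by simp
    next
      case (Suc n)
      have "P (\<Union>i<n. A i) + P (A n) \<le> P (\<Union>i<Suc n. A i)"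
      proof -
        have ne: "{B\<in>sets M. B \<subseteq> X} \<noteq> {}" for X by auto
        have one: "ennreal (\<nu> B) + ennreal (\<nu> C) \<le> P (\<Union>i<Suc n. A i)"
          if B: "B \<in> sets M" "B \<subseteq> (\<Union>i<n. A i)" and C: "C \<in> sets M" "C \<subseteq> A n" for B C
        proof -
          have disj: "B \<inter> C = {}"
          proof -
            have "A i \<inter> A n = {}" if "i < n" for i
              using A(2) that by (auto simp: disjoint_family_on_def)
            then show ?thesis using B C by blast
          qed
          have sub: "B \<subseteq> (\<Union>i<Suc n. A i)" "C \<subseteq> (\<Union>i<Suc n. A i)"
            using B C unfolding lessThan_Suc by blast+
          show ?thesis
          proof (cases "0 \<le> \<nu> B"; cases "0 \<le> \<nu> C")
            assume "0 \<le> \<nu> B" "0 \<le> \<nu> C"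
            then have "ennreal (\<nu> B) + ennreal (\<nu> C) = ennreal (\<nu> (B \<union> C))"
              using add2[OF B(1) C(1) disj] by (simp add: ennreal_plus)
            also have "\<dots> \<le> P (\<Union>i<Suc n. A i)"
              using B C sub by (intro upper) auto
            finally show ?thesis .
          qed (use B C sub upper[of B] upper[of C] in \<open>auto simp: ennreal_neg\<close>)
        qed
        have "P (\<Union>i<n. A i) + P (A n)
            = (SUP B\<in>{B\<in>sets M. B \<subseteq> (\<Union>i<n. A i)}. ennreal (\<nu> B) + P (A n))"
          unfolding P_def by (rule ennreal_SUP_add_left[OF ne, symmetric])
        also have "\<dots> = (SUP B\<in>{B\<in>sets M. B \<subseteq> (\<Union>i<n. A i)}. SUP C\<in>{C\<in>sets M. C \<subseteq> A n}. ennreal (\<nu> B) + ennreal (\<nu> C))"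
          unfolding P_def by (intro SUP_cong refl ennreal_SUP_add_right[OF ne])
        also have "\<dots> \<le> P (\<Union>i<Suc n. A i)"
          by (intro SUP_least) (auto intro: one)
        finally show ?thesis .
      qed
      then show ?case using Suc by (simp add: order_trans[OF add_right_mono])
    qed
    show "suminf (\<lambda>i. P (A i)) = P (\<Union>i. A i)"
    proof (rule antisym)
      have "P (\<Union>i<n. A i) \<le> P (\<Union>i. A i)" for n
        unfolding P_def by (intro SUP_subset_mono) auto
      then have "(\<Sum>i<n. P (A i)) \<le> P (\<Union>i. A i)" for n
        using fin order_trans by blast
      then show "suminf (\<lambda>i. P (A i)) \<le> P (\<Union>i. A i)" by (rule suminf_le_const[OF summableI])
      show "P (\<Union>i. A i) \<le> suminf (\<lambda>i. P (A i))"
        unfolding fun_cong[OF P_def, of "\<Union>i. A i"]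
      proof (rule SUP_least)
        fix B assume "B \<in> {B\<in>sets M. B \<subseteq> (\<Union>i. A i)}"
        then have B: "B \<in> sets M" "B = (\<Union>i. B \<inter> A i)" by auto
        have "(\<lambda>i. \<nu> (B \<inter> A i)) sums \<nu> (\<Union>i. B \<inter> A i)"
          using A A' B(1) by (intro add) (auto simp: disjoint_family_on_def)
        then have s: "(\<lambda>i. \<nu> (B \<inter> A i)) sums \<nu> B" using B(2) by simp
        have bd: "ennreal (\<Sum>i<n. \<nu> (B \<inter> A i)) \<le> suminf (\<lambda>i. P (A i))" for n
        proof -
          have "ennreal (\<Sum>i<n. \<nu> (B \<inter> A i)) \<le> ennreal (\<Sum>i<n. max 0 (\<nu> (B \<inter> A i)))"
            by (intro ennreal_leI sum_mono) auto
          also have "\<dots> = (\<Sum>i<n. ennreal (max 0 (\<nu> (B \<inter> A i))))"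
            by (rule sum_ennreal[symmetric]) simp
          also have "\<dots> = (\<Sum>i<n. ennreal (\<nu> (B \<inter> A i)))"
            by (intro sum.cong refl) (simp add: max_def ennreal_neg)
          also have "\<dots> \<le> (\<Sum>i<n. P (A i))"
            using A' B(1) by (intro sum_mono upper) auto
          also have "\<dots> \<le> suminf (\<lambda>i. P (A i))" by (rule sum_le_suminf) auto
          finally show ?thesis .
        qed
        have "(\<lambda>n. ennreal (\<Sum>i<n. \<nu> (B \<inter> A i))) \<longlonglongrightarrow> ennreal (\<nu> B)"
          using s unfolding sums_def by (rule tendsto_ennrealI)
        then show "ennreal (\<nu> B) \<le> suminf (\<lambda>i. P (A i))"
          by (rule LIMSEQ_le_const2) (use bd in blast)
      qed
    qed
  qed
  have "P {} = 0" by (simp add: P_def e cong: conj_cong)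
  then have "positive (sets M) P" by (simp add: positive_def)
  then have "emeasure (jordan_pos M \<nu>) S = P S"
    using ca S unfolding jordan_pos_def P_def[symmetric]
    by (intro emeasure_measure_of_sigma) (auto intro: sets.sigma_algebra_axioms)
  then show ?thesis by (simp add: P_def)
qed

lemma sets_jordan_pos [simp]: "sets (jordan_pos M \<nu>) = sets M"
  by (simp add: jordan_pos_def)

lemma sets_jordan_neg [simp]: "sets (jordan_neg M \<nu>) = sets M"
  by (simp add: jordan_neg_def)

lemma signed_integral_uminus: "signed_integral M (\<lambda>S. - \<nu> S) f = - signed_integral M \<nu> f"
  by (simp add: signed_integral_def jordan_neg_def)

lemma vector_measure_measure:
  assumes "finite_measure N"
  shows "vector_measure N (measure N)"
  using finite_measure.finite_measure_UNION[OF assms] by (simp add: vector_measure_def)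

lemma
  assumes N: "finite_measure N"
  shows signed_integrable_measure: "signed_integrable N (measure N) f \<longleftrightarrow> integrable N f"
    and signed_integral_measure: "signed_integral N (measure N) f = integral\<^sup>L N f"
proof -
  interpret finite_measure N by (rule N)
  have vm: "vector_measure N (measure N)" by (rule vector_measure_measure[OF N])
  have vm': "vector_measure N (\<lambda>S. - measure N S)"
    using vm by (simp add: vector_measure_def sums_minus)
  have pos: "jordan_pos N (measure N) = N"
  proof (rule measure_eqI)
    fix S assume "S \<in> sets (jordan_pos N (measure N))"
    then have S: "S \<in> sets N" by simp
    have "(SUP B\<in>{B\<in>sets N. B \<subseteq> S}. ennreal (measure N B)) = ennreal (measure N S)"
      using S by (intro antisym SUP_least SUP_upper) (auto intro!: ennreal_leI finite_measure_mono)
    then show "emeasure (jordan_pos N (measure N)) S = emeasure N S"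
      using S by (simp add: emeasure_jordan_pos[OF vm] emeasure_eq_measure)
  qed simp
  have neg: "jordan_neg N (measure N) = null_measure N"
  proof (rule measure_eqI)
    fix S assume "S \<in> sets (jordan_neg N (measure N))"
    then have S: "S \<in> sets N" by simp
    have "(SUP B\<in>{B\<in>sets N. B \<subseteq> S}. ennreal (- measure N B)) = 0"
      by (intro antisym SUP_least) (auto simp: ennreal_neg)
    then show "emeasure (jordan_neg N (measure N)) S = emeasure (null_measure N) S"
      using S by (simp add: jordan_neg_def emeasure_jordan_pos[OF vm'])
  qed simp
  show "signed_integral N (measure N) f = integral\<^sup>L N f"
    by (simp add: signed_integral_def pos neg integral_null_measure)
  have "integrable (null_measure N) f" if "f \<in> borel_measurable N"
    using that by (auto simp: integrable_iff_bounded nn_integral_null_measure)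
  then show "signed_integrable N (measure N) f \<longleftrightarrow> integrable N f"
    by (auto simp: signed_integrable_def pos neg)
qed

text \<open>
  The type \<open>'m herm\<close> makes every value of \<open>\<mu>\<close> Hermitian; values on non-Borel sets are irrelevant.
\<close>

definition matrix_measure :: "((real^'n::finite) set \<Rightarrow> 'm::finite herm) \<Rightarrow> bool"
  where "matrix_measure \<mu> \<longleftrightarrow> (\<forall>k l. vector_measure borel (\<lambda>S. hmat (\<mu> S) $ k $ l))"

definition positive_matrix_measure :: "((real^'n::finite) set \<Rightarrow> 'm::finite herm) \<Rightarrow> bool"
  where "positive_matrix_measure \<mu> \<longleftrightarrow> matrix_measure \<mu> \<and> (\<forall>S\<in>sets borel. \<mu> S \<in> herm_psd)"

definition pairing_integrable ::
  "((real^'n::finite) set \<Rightarrow> 'm::{finite,linorder} herm) \<Rightarrow> (real^'n \<Rightarrow> 'm herm) \<Rightarrow> bool"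
  where "pairing_integrable \<mu> g \<longleftrightarrow> (\<forall>i j.
    signed_integrable borel (\<lambda>S. herm_inner (\<mu> S) (herm_basis i j)) (\<lambda>t. herm_inner (g t) (herm_basis i j)))"

definition pairing_integral ::
  "((real^'n::finite) set \<Rightarrow> 'm::{finite,linorder} herm) \<Rightarrow> (real^'n \<Rightarrow> 'm herm) \<Rightarrow> real"
  where "pairing_integral \<mu> g = (\<Sum>i\<in>UNIV. \<Sum>j\<in>UNIV.
    signed_integral borel (\<lambda>S. herm_inner (\<mu> S) (herm_basis i j)) (\<lambda>t. herm_inner (g t) (herm_basis i j)))"

definition herm_integrable :: "((real^'n::finite) set \<Rightarrow> 'm::finite herm) \<Rightarrow> (real^'n \<Rightarrow> real) \<Rightarrow> bool"
  where "herm_integrable \<mu> f \<longleftrightarrow> (\<forall>k l. complex_integrable borel (\<lambda>S. hmat (\<mu> S) $ k $ l) f)"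

lift_definition herm_integral :: "((real^'n::finite) set \<Rightarrow> 'm::finite herm) \<Rightarrow> (real^'n \<Rightarrow> real) \<Rightarrow> 'm herm"
  is "\<lambda>\<mu> f. \<chi> k l. complex_integral borel (\<lambda>S. hmat (\<mu> S) $ k $ l) f"
proof -
  fix \<mu> :: "(real^'n) set \<Rightarrow> 'm herm" and f and i j :: 'm
  have "(\<lambda>S. Re (hmat (\<mu> S) $ i $ j)) = (\<lambda>S. Re (hmat (\<mu> S) $ j $ i))"
    "(\<lambda>S. Im (hmat (\<mu> S) $ i $ j)) = (\<lambda>S. - Im (hmat (\<mu> S) $ j $ i))"
    by (subst hmat_cnj, simp)+
  then show "(\<chi> k l. complex_integral borel (\<lambda>S. hmat (\<mu> S) $ k $ l) f) $ i $ j =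
      cnj ((\<chi> k l. complex_integral borel (\<lambda>S. hmat (\<mu> S) $ k $ l) f) $ j $ i)"
    by (simp add: complex_integral_def signed_integral_uminus complex_eq_iff)
qed

definition is_representing_measure ::
  "(('n::finite \<Rightarrow>\<^sub>0 nat) \<Rightarrow> 'm::{finite,linorder} herm \<Rightarrow> ('n, 'm herm) mvpoly) \<Rightarrow> real^'n \<Rightarrow> 'm herm
    \<Rightarrow> ((real^'n) set \<Rightarrow> 'm herm) \<Rightarrow> bool"
  where "is_representing_measure Q y M \<mu> \<longleftrightarrow>
    matrix_measure \<mu> \<and>
    (M \<in> herm_psd \<longrightarrow> positive_matrix_measure \<mu>) \<and>
    (\<forall>p x. pairing_integrable \<mu> (\<lambda>t. mveval p (x + t)) \<and>
           mveval (diff_op_at_inner Q y M p) x = pairing_integral \<mu> (\<lambda>t. mveval p (x + t)))"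

definition tilde_measure ::
  "('m::{finite,linorder} herm \<Rightarrow> (real^'n::finite) set \<Rightarrow> 'm herm) \<Rightarrow> 'm herm \<Rightarrow> (real^'n) set \<Rightarrow> 'm herm"
  where "tilde_measure \<mu> M S =
    (\<Sum>i\<in>UNIV. \<Sum>j\<in>UNIV. herm_inner (\<mu> (herm_basis i j) S) M *\<^sub>R herm_basis i j)"

lemma vector_measure_sum:
  "(\<And>i. i \<in> I \<Longrightarrow> vector_measure M (\<nu> i)) \<Longrightarrow> vector_measure M (\<lambda>S. \<Sum>i\<in>I. \<nu> i S)"
  unfolding vector_measure_def by (auto intro!: sums_sum)

lemma vector_measure_bounded_linear:
  "vector_measure M \<nu> \<Longrightarrow> bounded_linear h \<Longrightarrow> vector_measure M (\<lambda>S. h (\<nu> S))"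
  unfolding vector_measure_def by (auto intro: bounded_linear.sums)

lemma vector_measure_herm_inner:
  assumes "matrix_measure \<mu>"
  shows "vector_measure borel (\<lambda>S. herm_inner (\<mu> S) M)"
proof -
  have "bounded_linear (\<lambda>z. Re (z * hmat M $ k $ i))" for k i
    by (rule bounded_linear_compose[OF bounded_linear_Re bounded_linear_mult_left])
  then have "vector_measure borel (\<lambda>S. \<Sum>i\<in>UNIV. \<Sum>k\<in>UNIV. Re (hmat (\<mu> S) $ i $ k * hmat M $ k $ i))"
    using assms unfolding matrix_measure_def
    by (intro vector_measure_sum vector_measure_bounded_linear[where h = "\<lambda>z. Re (z * hmat M $ _ $ _)"]) auto
  then show ?thesis
    by (simp add: herm_inner_def trace_def matrix_matrix_mult_def)
qed

lemma hmat_sum: "hmat (\<Sum>a\<in>I. f a) $ k $ l = (\<Sum>a\<in>I. hmat (f a) $ k $ l)"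
  by (induction I rule: infinite_finite_induct) (simp_all add: zero_herm.rep_eq plus_herm.rep_eq)

lemma matrix_measure_tilde_measure:
  assumes "\<And>i j. matrix_measure (\<mu> (herm_basis i j))"
  shows "matrix_measure (tilde_measure \<mu> M)"
  unfolding matrix_measure_def
proof (intro allI)
  fix k l
  have "vector_measure borel (\<lambda>S. \<Sum>i\<in>UNIV. \<Sum>j\<in>UNIV.
      herm_inner (\<mu> (herm_basis i j) S) M *\<^sub>R hmat (herm_basis i j) $ k $ l)"
    by (intro vector_measure_sum vector_measure_bounded_linear[OF _ bounded_linear_scaleR_left]
        vector_measure_herm_inner assms)
  then show "vector_measure borel (\<lambda>S. hmat (tilde_measure \<mu> M S) $ k $ l)"
    by (simp add: tilde_measure_def hmat_sum scaleR_herm.rep_eq)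
qed

end

(*
  Write (T_y p)(x) and (T p)(y) through the single functional
  Lambda_y q = sum over alpha of Q_alpha(q_alpha)(y), applied to the translate p(x + _)
  (respectively p(y + _)).  As translation preserves positivity, each of (i)-(iii) says that
  Lambda_y maps Pos to psd matrices.

  For (iv) one solves the matrix moment problem for L = <Lambda_y(.), M> with M psd.  A polynomial
  is in Pos iff all forms v* p(x) v are nonnegative, so a least-squares argument shows that L is a
  pointwise limit of finite sums of such forms.  The atoms (x, v) are lifted to the real line along
  a continuous surjection of the line onto R^n x C^m; Helly's theorem then gives a limit
  distribution, second moments giving tightness and convergence of all moments.  Its image under x
  with density v v* is the representing measure.  The converse integrates step functions with psd
  values.
*)

theory Submission
  imports Defs "HOL-Probability.Helly_Selection"
begin

section \<open>Hermitian matrices and positive semidefiniteness\<close>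

text \<open>Helly's selection theorem concerns distributions on the real line, while the atoms live
  in a space of higher dimension; hence the curve. Its continuity keeps the integrands continuous,
  and the possibility of choosing preimages whose size is at most linear in the point keeps second
  moments bounded after the lift. The vectors v remain part of the atoms, so that positivity of the
  limit is visible in its density. They are normalised to norm at most 1 because the square of a
  form is then bounded by the form of another polynomial; this is the uniform integrability that
  carries every moment to the limit. A second obstacle lies in the integrals: they are defined
  through Jordan parts, which are not additive in the measure. Therefore every expression of a
  signed measure as a finite linear combination of finite measures is shown to compute its
  integrals; differences of measures, images with a signed density and the recombination of
  coordinates are instances of this. A Hermitian M that is not psd is treated as a difference of two
  psd matrices.\<close>

lemma herm_inner_commute: "herm_inner A B = herm_inner B A"
  unfolding herm_inner_def by (rule arg_cong[OF trace_mul_sym])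

lemma linear_herm_inner_right: "linear (herm_inner A)"
proof -
  have "herm_inner A = (\<lambda>B. herm_inner B A)" by (rule ext) (rule herm_inner_commute)
  then show ?thesis by (simp add: linear_herm_inner_left)
qed

lemmas herm_inner_add_left = linear_add[OF linear_herm_inner_left]
lemmas herm_inner_diff_left = linear_diff[OF linear_herm_inner_left]
lemmas herm_inner_scale_left = linear_scale[OF linear_herm_inner_left]
lemmas herm_inner_sum_left = linear_sum[OF linear_herm_inner_left]
lemmas herm_inner_add_right = linear_add[OF linear_herm_inner_right]
lemmas herm_inner_diff_right = linear_diff[OF linear_herm_inner_right]
lemmas herm_inner_scale_right = linear_scale[OF linear_herm_inner_right]

section \<open>Coordinates in the basis \<open>herm_basis\<close> and Parseval's identity\<close>

lemma herm_inner_entries: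
  "herm_inner A B = (\<Sum>i\<in>UNIV. \<Sum>j\<in>UNIV.
     Re (hmat A $ i $ j) * Re (hmat B $ i $ j) + Im (hmat A $ i $ j) * Im (hmat B $ i $ j))"
proof -
  have "herm_inner A B = Re (\<Sum>i\<in>UNIV. \<Sum>j\<in>UNIV. hmat A $ i $ j * cnj (hmat B $ i $ j))"
    unfolding herm_inner_def trace_def matrix_matrix_mult_def
    by (intro arg_cong[of _ _ Re] sum.cong refl) (simp add: hmat_cnj[symmetric])
  then show ?thesis by simp
qed

lemma herm_inner_self_eq_0: "herm_inner A A = 0 \<longleftrightarrow> A = 0"
proof
  assume "herm_inner A A = 0"
  then have "(\<Sum>i\<in>UNIV. \<Sum>j\<in>UNIV. (cmod (hmat A $ i $ j))\<^sup>2) = 0"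
    unfolding herm_inner_entries cmod_power2 by (simp only: power2_eq_square)
  then have "\<forall>i\<in>UNIV. (\<Sum>j\<in>UNIV. (cmod (hmat A $ i $ j))\<^sup>2) = 0"
    by (subst (asm) sum_nonneg_eq_0_iff) (auto intro: sum_nonneg)
  then have "\<forall>i j. (cmod (hmat A $ i $ j))\<^sup>2 = 0"
    by (subst (asm) sum_nonneg_eq_0_iff) auto
  then show "A = 0"
    by (simp add: herm_eq_iff zero_herm.rep_eq)
qed simp

text \<open>The trace against a matrix unit picks out one entry, so only the entries (k, l) and (l,
  k) contribute. They are conjugate: their sum is twice a real part, their difference a multiple of
  an imaginary part, and 2 / sqrt 2 is sqrt 2.\<close>

lemma herm_inner_basis:
  "herm_inner A (herm_basis k l) =
    (if k < l then sqrt 2 * Re (hmat A $ k $ l)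
     else if k = l then Re (hmat A $ k $ k) else sqrt 2 * Im (hmat A $ k $ l))"
proof -
  have E: "(\<Sum>i\<in>UNIV. \<Sum>j\<in>UNIV. f i j * matrix_unit a b $ j $ i) = f b a" for f :: "'a \<Rightarrow> 'a \<Rightarrow> complex" and a b
  proof -
    have "(\<Sum>i\<in>UNIV. \<Sum>j\<in>UNIV. f i j * matrix_unit a b $ j $ i)
        = (\<Sum>i\<in>UNIV. \<Sum>j\<in>UNIV. if j = a then (if i = b then f i j else 0) else 0)"
      by (intro sum.cong refl) (auto simp: matrix_unit_def)
    also have "\<dots> = f b a" by simp
    finally show ?thesis .
  qed
  have s2: "2 / sqrt 2 = sqrt 2" by (simp add: real_div_sqrt)
  consider "k < l" | "k = l" | "l < k" by fastforce
  then show ?thesis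
  proof cases
    case 1
    have "herm_inner A (herm_basis k l) = Re ((1 / sqrt 2) *\<^sub>R (hmat A $ l $ k + hmat A $ k $ l))"
      using 1 E[of "\<lambda>i j. hmat A $ i $ j" k l] E[of "\<lambda>i j. hmat A $ i $ j" l k]
      by (simp add: herm_inner_def trace_def matrix_matrix_mult_def herm_basis.rep_eq
          algebra_simps sum.distrib flip: scaleR_sum_right scaleR_add_right sum_distrib_left)
    then have "sqrt 2 * herm_inner A (herm_basis k l) = sqrt 2 * (sqrt 2 * Re (hmat A $ k $ l))"
      by (subst (asm) hmat_cnj[of A l k]) (simp add: field_simps)
    then show ?thesis using 1 by simp
  next
    case 2
    then show ?thesis using E[of "\<lambda>i j. hmat A $ i $ j" k k]
      by (simp add: herm_inner_def trace_def matrix_matrix_mult_def herm_basis.rep_eq)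
  next
    case 3
    have "trace (hmat A ** hmat (herm_basis k l)) = \<i> / sqrt 2 * (hmat A $ l $ k - hmat A $ k $ l)"
      using 3 leD[OF less_imp_le[OF 3]] less_imp_neq[OF 3] E[of "\<lambda>i j. \<i> / sqrt 2 * hmat A $ i $ j" k l] E[of "\<lambda>i j. \<i> / sqrt 2 * hmat A $ i $ j" l k]
      by (simp add: trace_def matrix_matrix_mult_def herm_basis.rep_eq
          algebra_simps sum_subtractf)
    then have "trace (hmat A ** hmat (herm_basis k l)) = \<i> / sqrt 2 * (cnj (hmat A $ k $ l) - hmat A $ k $ l)"
      by (simp only: hmat_cnj[of A l k])
    also have "\<dots> = complex_of_real (2 / sqrt 2 * Im (hmat A $ k $ l))"
      by (simp add: complex_eq_iff)
    finally show ?thesis unfolding herm_inner_def using 3 s2 by (auto dest: less_not_sym)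
  qed
qed

text \<open>A term with i < j contains only real parts and one with i > j only imaginary parts, so
  the entrywise formula is not matched term by term. The terms (i, j) and (j, i) together match it
  up to a factor 2; hence twice the sum is compared, one copy with its indices swapped.\<close>

lemma herm_parseval:
  "herm_inner A B = (\<Sum>i\<in>UNIV. \<Sum>j\<in>UNIV. herm_inner A (herm_basis i j) * herm_inner B (herm_basis i j))"
proof -
  let ?g = "\<lambda>i j. herm_inner A (herm_basis i j) * herm_inner B (herm_basis i j)"
  let ?s = "\<lambda>i j. Re (hmat A $ i $ j) * Re (hmat B $ i $ j) + Im (hmat A $ i $ j) * Im (hmat B $ i $ j)"
  have sym: "?g i j + ?g j i = 2 * ?s i j" for i j
  proof -
    have "Re (hmat C $ j $ i) = Re (hmat C $ i $ j)" "Im (hmat C $ j $ i) = - Im (hmat C $ i $ j)" for C :: "'a herm"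
      by (subst hmat_cnj; simp)+
    moreover have "i = j \<Longrightarrow> Im (hmat C $ i $ j) = 0" for C :: "'a herm"
      using calculation(2)[of C] by simp
    moreover have sq: "sqrt 2 * x * (sqrt 2 * y) = 2 * (x * y)" for x y :: real
      using mult.commute[of "sqrt 2" x] by (simp add: mult.assoc)
    ultimately show ?thesis
      by (cases i j rule: linorder_cases)
         (auto simp add: herm_inner_basis sq dest: less_not_sym)
  qed
  have "2 * (\<Sum>i\<in>UNIV. \<Sum>j\<in>UNIV. ?g i j) = (\<Sum>i\<in>UNIV. \<Sum>j\<in>UNIV. ?g i j) + (\<Sum>i\<in>UNIV. \<Sum>j\<in>UNIV. ?g j i)"
    by (subst (3) sum.swap) simp
  also have "\<dots> = (\<Sum>i\<in>UNIV. \<Sum>j\<in>UNIV. 2 * ?s i j)"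
    by (simp only: sum.distrib[symmetric] sym)
  also have "\<dots> = 2 * herm_inner A B"
    by (simp only: herm_inner_entries sum_distrib_left)
  finally show ?thesis by simp
qed

text \<open>By Parseval the difference of the two sides is orthogonal to every matrix, in particular
  to itself.\<close>

lemma herm_basis_expansion:
  "A = (\<Sum>i\<in>UNIV. \<Sum>j\<in>UNIV. herm_inner A (herm_basis i j) *\<^sub>R herm_basis i j)" (is "A = ?S")
proof -
  have "herm_inner ?S B = herm_inner A B" for B
    by (subst herm_parseval[of A B])
       (simp add: herm_inner_sum_left herm_inner_scale_left herm_inner_commute[of B])
  then have "herm_inner (A - ?S) (A - ?S) = 0"
    by (simp add: herm_inner_diff_left)
  then show ?thesis by (simp add: herm_inner_self_eq_0)
qed

section \<open>Rank-one matrices and the self-duality of the psd cone\<close>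

lift_definition outer :: "complex^'m \<Rightarrow> 'm::finite herm" is "\<lambda>v. \<chi> i j. v $ i * cnj (v $ j)"
  by simp

text \<open>The quadratic form of v becomes a pairing, linear in A, so being psd is a family of
  linear inequalities on A.\<close>

lemma herm_inner_outer:
  "herm_inner A (outer v) = Re (\<Sum>i\<in>UNIV. \<Sum>j\<in>UNIV. cnj (v $ i) * hmat A $ i $ j * v $ j)"
  by (simp add: herm_inner_def trace_def matrix_matrix_mult_def outer.rep_eq mult_ac)

lemma herm_psd_iff: "A \<in> herm_psd \<longleftrightarrow> (\<forall>v. 0 \<le> herm_inner A (outer v))"
  by (simp add: herm_psd_def herm_inner_outer)

lemma Re_mult_cnj: "Re (z * cnj z) = (cmod z)\<^sup>2"
  unfolding cmod_power2 by (simp add: power2_eq_square)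

lemma herm_inner_outer_outer:
  "herm_inner (outer v) (outer w) = (cmod (\<Sum>i\<in>UNIV. cnj (w $ i) * v $ i))\<^sup>2"
proof -
  have "(\<Sum>i\<in>UNIV. \<Sum>j\<in>UNIV. cnj (w $ i) * hmat (outer v) $ i $ j * w $ j)
      = (\<Sum>i\<in>UNIV. cnj (w $ i) * v $ i) * cnj (\<Sum>i\<in>UNIV. cnj (w $ i) * v $ i)"
    by (simp add: outer.rep_eq sum_product mult_ac)
  then show ?thesis
    unfolding herm_inner_outer by (simp only: Re_mult_cnj)
qed

lemma outer_psd: "outer v \<in> herm_psd"
  by (simp add: herm_psd_iff herm_inner_outer_outer)

text \<open>The two mixed sums are conjugate because A is Hermitian, which produces 2 Re. Suitable
  choices of z give the facts about zero and nonzero diagonal entries below.\<close>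

lemma herm_inner_outer_axis:
  "herm_inner A (outer (v + axis k z)) = herm_inner A (outer v)
    + 2 * Re (cnj z * (\<Sum>j\<in>UNIV. hmat A $ k $ j * v $ j)) + (cmod z)\<^sup>2 * Re (hmat A $ k $ k)"
proof -
  let ?S = "\<lambda>f. \<Sum>i\<in>UNIV. \<Sum>j\<in>UNIV. f i j :: complex"
  let ?w = "\<Sum>j\<in>UNIV. hmat A $ k $ j * v $ j"
  have "?S (\<lambda>i j. cnj ((v + axis k z) $ i) * hmat A $ i $ j * (v + axis k z) $ j)
    = ?S (\<lambda>i j. cnj (v $ i) * hmat A $ i $ j * v $ j)
      + ?S (\<lambda>i j. if i = k then cnj z * (hmat A $ i $ j * v $ j) else 0)
      + ?S (\<lambda>i j. if j = k then cnj (v $ i) * hmat A $ i $ j * z else 0)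
      + ?S (\<lambda>i j. if j = k then if i = k then cnj z * hmat A $ i $ j * z else 0 else 0)"
    unfolding sum.distrib[symmetric] by (intro sum.cong refl) (auto simp: axis_def algebra_simps)
  also have "?S (\<lambda>i j. if i = k then cnj z * (hmat A $ i $ j * v $ j) else 0) = cnj z * ?w"
  proof -
    have "?S (\<lambda>i j. if i = k then cnj z * (hmat A $ i $ j * v $ j) else 0)
        = (\<Sum>i\<in>UNIV. if i = k then (\<Sum>j\<in>UNIV. cnj z * (hmat A $ i $ j * v $ j)) else 0)"
      by (intro sum.cong) auto
    then show ?thesis by (simp add: sum_distrib_left)
  qed
  also have "?S (\<lambda>i j. if j = k then cnj (v $ i) * hmat A $ i $ j * z else 0) = cnj (cnj z * ?w)"
    by (simp add: sum_distrib_left hmat_cnj[of A _ k] mult_ac)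
  also have "?S (\<lambda>i j. if j = k then if i = k then cnj z * hmat A $ i $ j * z else 0 else 0)
      = complex_of_real ((cmod z)\<^sup>2) * hmat A $ k $ k"
    by (subst of_real_power, subst of_real_power[symmetric], subst complex_norm_square) (simp add: mult_ac)
  finally have "(\<Sum>i\<in>UNIV. \<Sum>j\<in>UNIV. cnj ((v + axis k z) $ i) * hmat A $ i $ j * (v + axis k z) $ j)
    = ?S (\<lambda>i j. cnj (v $ i) * hmat A $ i $ j * v $ j) + cnj z * ?w + cnj (cnj z * ?w)
      + complex_of_real ((cmod z)\<^sup>2) * hmat A $ k $ k" .
  then have "Re (\<Sum>i\<in>UNIV. \<Sum>j\<in>UNIV. cnj ((v + axis k z) $ i) * hmat A $ i $ j * (v + axis k z) $ j)
    = Re (?S (\<lambda>i j. cnj (v $ i) * hmat A $ i $ j * v $ j)) + Re (cnj z * ?w) + Re (cnj (cnj z * ?w))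
      + Re (complex_of_real ((cmod z)\<^sup>2) * hmat A $ k $ k)"
    by (simp only: plus_complex.sel)
  then show ?thesis unfolding herm_inner_outer
    by (simp only: cnj.sel(1) Re_complex_of_real times_complex.sel(1)[of "complex_of_real _"] Im_complex_of_real)
qed

lemma psd_diag_nonneg: "A \<in> herm_psd \<Longrightarrow> 0 \<le> Re (hmat A $ k $ k)"
proof -
  assume "A \<in> herm_psd"
  then have "0 \<le> herm_inner A (outer (0 + axis k 1))" by (simp add: herm_psd_iff)
  also have "\<dots> = herm_inner A (outer 0) + Re (hmat A $ k $ k)"
    unfolding herm_inner_outer_axis by simp
  also have "herm_inner A (outer 0) = 0" by (simp add: herm_inner_outer)
  finally show ?thesis by simp
qed

text \<open>With a zero diagonal entry the form is affine along the k-th axis, so it would be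
  unbounded below if its linear coefficient did not vanish.\<close>

lemma psd_diag_zero:
  assumes "A \<in> herm_psd" "hmat A $ k $ k = 0"
  shows "(\<Sum>j\<in>UNIV. hmat A $ k $ j * v $ j) = 0"
proof (rule ccontr)
  let ?w = "\<Sum>j\<in>UNIV. hmat A $ k $ j * v $ j"
  assume "?w \<noteq> 0"
  have sq: "Re (cnj (- complex_of_real t * z) * z) = - t * (cmod z)\<^sup>2" for t z
    unfolding cmod_power2 by (simp add: algebra_simps power2_eq_square)
  \<comment> \<open>\<open>t\<close> is chosen so that the shift by -t times \<open>?w\<close>
    brings the form to exactly -1.\<close>
  define t where "t = (herm_inner A (outer v) + 1) / (2 * (cmod ?w)\<^sup>2)"
  have "0 \<le> herm_inner A (outer (v + axis k (- complex_of_real t * ?w)))"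
    using assms by (simp add: herm_psd_iff)
  also have "\<dots> = herm_inner A (outer v) - 2 * t * (cmod ?w)\<^sup>2"
    unfolding herm_inner_outer_axis sq by (simp add: assms(2))
  also have "\<dots> = -1" using \<open>?w \<noteq> 0\<close> by (simp add: t_def field_simps)
  finally show False by simp
qed

text \<open>One step of the Cholesky factorisation.\<close>

lemma psd_pivot:
  assumes A: "A \<in> herm_psd" and k: "hmat A $ k $ k \<noteq> 0"
  defines "w \<equiv> \<chi> i. hmat A $ i $ k / complex_of_real (sqrt (Re (hmat A $ k $ k)))"
  shows "A - outer w \<in> herm_psd" and "hmat (A - outer w) $ k $ k = 0"
    and "\<And>i. hmat A $ i $ i = 0 \<Longrightarrow> hmat (A - outer w) $ i $ i = 0"
proof -
  define a where "a = Re (hmat A $ k $ k)"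
  have re: "hmat A $ k $ k = complex_of_real a"
    using arg_cong[OF hmat_cnj[of A k k], of Im] by (simp add: a_def complex_eq_iff)
  have "a \<ge> 0" using psd_diag_nonneg[OF A, of k] by (simp add: a_def)
  moreover have "a \<noteq> 0" using k unfolding re by simp
  ultimately have a: "a > 0" by simp
  have w: "w $ i = hmat A $ i $ k / complex_of_real (sqrt a)" for i by (simp add: w_def a_def)
  have sq: "complex_of_real (sqrt a) * complex_of_real (sqrt a) = complex_of_real a"
    using a by (simp flip: of_real_mult)
  have "w $ k = complex_of_real (sqrt a)"
    using a by (simp add: w re field_simps sq)
  then show "hmat (A - outer w) $ k $ k = 0"
    by (simp add: minus_herm.rep_eq outer.rep_eq re sq)
  show "hmat (A - outer w) $ i $ i = 0" if "hmat A $ i $ i = 0" for i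
  proof -
    have "(\<Sum>j\<in>UNIV. hmat A $ i $ j * axis k 1 $ j) = hmat A $ i $ k"
      by (simp add: axis_def if_distrib cong: if_cong)
    then have "hmat A $ i $ k = 0" using psd_diag_zero[OF A that, of "axis k 1"] by simp
    with that show ?thesis by (simp add: minus_herm.rep_eq outer.rep_eq w)
  qed
  show "A - outer w \<in> herm_psd"
    unfolding herm_psd_iff
  proof
    fix v
    let ?u = "\<Sum>j\<in>UNIV. hmat A $ k $ j * v $ j"
    have "(\<Sum>i\<in>UNIV. cnj (w $ i) * v $ i) = ?u / complex_of_real (sqrt a)"
      by (simp add: w sum_divide_distrib hmat_cnj[symmetric])
    moreover have "cmod (\<Sum>i\<in>UNIV. cnj (v $ i) * w $ i) = cmod (\<Sum>i\<in>UNIV. cnj (w $ i) * v $ i)"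
      by (subst complex_mod_cnj[symmetric]) (simp add: mult.commute)
    ultimately have o: "herm_inner (outer w) (outer v) = (cmod ?u)\<^sup>2 / a"
      using a by (simp add: herm_inner_outer_outer norm_divide power_divide)
    \<comment> \<open>The shift -u/a minimises the form in the k-th coordinate; completing the
      square subtracts exactly the contribution of \<open>outer w\<close>.\<close>
    have "0 \<le> herm_inner A (outer (v + axis k (- ?u / complex_of_real a)))"
      using A by (simp add: herm_psd_iff)
    also have "\<dots> = herm_inner A (outer v) - (cmod ?u)\<^sup>2 / a"
    proof -
      have "Re (cnj (- ?u / complex_of_real a) * ?u) = - ((cmod ?u)\<^sup>2 / a)"
        using Re_mult_cnj[of ?u] by (simp add: mult.commute Re_divide_of_real del: cnj_sum Re_sum)
      moreover have "(cmod (- ?u / complex_of_real a))\<^sup>2 * a = (cmod ?u)\<^sup>2 / a"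
        using a by (simp add: norm_divide power_divide power2_eq_square)
      ultimately show ?thesis
        unfolding herm_inner_outer_axis a_def[symmetric] by linarith
    qed
    finally show "0 \<le> herm_inner (A - outer w) (outer v)"
      by (simp add: herm_inner_diff_left o)
  qed
qed

text \<open>Each pivot step clears one nonzero diagonal entry and keeps the zero ones, so their
  number decreases. Once the diagonal is zero, \<open>psd_diag_zero\<close> at the axis vectors
  makes every entry zero.\<close>

lemma psd_sum_outer:
  "A \<in> herm_psd \<Longrightarrow> \<exists>ws. A = (\<Sum>w\<leftarrow>ws. outer w)"
proof (induction "card {k. hmat A $ k $ k \<noteq> 0}" arbitrary: A rule: less_induct)
  case less
  show ?case
  proof (cases "\<exists>k. hmat A $ k $ k \<noteq> 0")
    case True
    then obtain k where k: "hmat A $ k $ k \<noteq> 0" by blast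
    obtain w where w: "A - outer w \<in> herm_psd" "hmat (A - outer w) $ k $ k = 0"
      "\<And>i. hmat A $ i $ i = 0 \<Longrightarrow> hmat (A - outer w) $ i $ i = 0"
      using psd_pivot[OF less.prems k] by blast
    have "card {k. hmat (A - outer w) $ k $ k \<noteq> 0} < card {k. hmat A $ k $ k \<noteq> 0}"
      using w k by (intro psubset_card_mono) auto
    then obtain ws where "A - outer w = (\<Sum>w\<leftarrow>ws. outer w)"
      using less.hyps w(1) by blast
    then have "A = (\<Sum>w\<leftarrow>w # ws. outer w)" by (simp add: algebra_simps)
    then show ?thesis by blast
  next
    case False
    have "hmat A $ i $ j = 0" for i j
      using psd_diag_zero[OF less.prems, of i "axis j 1"] False
      by (simp add: axis_def if_distrib cong: if_cong)
    then have "A = 0" by (simp add: herm_eq_iff zero_herm.rep_eq)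
    then show ?thesis by (intro exI[of _ "[]"]) simp
  qed
qed

lemma psd_inner_nonneg:
  assumes "A \<in> herm_psd" "B \<in> herm_psd"
  shows "0 \<le> herm_inner A B"
proof -
  obtain ws where B: "B = (\<Sum>w\<leftarrow>ws. outer w)" using psd_sum_outer[OF assms(2)] by blast
  have "0 \<le> herm_inner A (\<Sum>w\<leftarrow>ws. outer w)"
    using assms(1)
    by (induction ws) (auto simp: herm_inner_add_right linear_0[OF linear_herm_inner_right] herm_psd_iff)
  then show ?thesis by (simp add: B)
qed

text \<open>Self-duality of the cone: rank-one matrices are psd themselves, so testing against all
  psd M includes the defining inequalities. This turns (iii) and (iv), which speak of each M
  separately, into statements about matrices.\<close>

lemma psd_iff_inner: "A \<in> herm_psd \<longleftrightarrow> (\<forall>M\<in>herm_psd. 0 \<le> herm_inner A M)"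
proof
  assume "\<forall>M\<in>herm_psd. 0 \<le> herm_inner A M"
  then show "A \<in> herm_psd" unfolding herm_psd_iff[of A] using outer_psd by blast
qed (simp add: psd_inner_nonneg)

section \<open>Domination by multiples of the identity\<close>

lift_definition herm_id :: "'m::finite herm" is "\<chi> i j. if i = j then 1 else 0"
  by auto

lemma herm_inner_id_outer: "herm_inner herm_id (outer v) = (norm v)\<^sup>2"
proof -
  have "herm_inner herm_id (outer v) = (\<Sum>i\<in>UNIV. (cmod (v $ i))\<^sup>2)"
    by (simp add: herm_inner_entries herm_id.rep_eq outer.rep_eq if_distrib[of Re] if_distrib[of Im]
        if_distrib[of "\<lambda>x. x * _"] cmod_def power2_eq_square cong: if_cong)
  then show ?thesis
    by (simp add: norm_vec_def L2_set_def sum_nonneg)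
qed

text \<open>The entrywise l1 norm, an explicit bound for the operator norm:
  \<open>herm_bound A\<close> times the identity dominates both A and -A.\<close>

definition herm_bound :: "'m::finite herm \<Rightarrow> real"
  where "herm_bound A = (\<Sum>i\<in>UNIV. \<Sum>j\<in>UNIV. cmod (hmat A $ i $ j))"

lemma herm_bound_nonneg: "0 \<le> herm_bound A"
  by (simp add: herm_bound_def sum_nonneg)

lemma abs_herm_inner_outer_le: "\<bar>herm_inner A (outer v)\<bar> \<le> herm_bound A * (norm v)\<^sup>2"
proof -
  have "\<bar>herm_inner A (outer v)\<bar> \<le> cmod (\<Sum>i\<in>UNIV. \<Sum>j\<in>UNIV. cnj (v $ i) * hmat A $ i $ j * v $ j)"
    unfolding herm_inner_outer by (rule abs_Re_le_cmod)
  also have "\<dots> \<le> (\<Sum>i\<in>UNIV. \<Sum>j\<in>UNIV. cmod (cnj (v $ i) * hmat A $ i $ j * v $ j))"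
    by (intro order_trans[OF norm_sum] sum_mono norm_sum order_refl)
  also have "\<dots> \<le> (\<Sum>i\<in>UNIV. \<Sum>j\<in>UNIV. cmod (hmat A $ i $ j) * (norm v)\<^sup>2)"
  proof (intro sum_mono)
    fix i j
    have "cmod (cnj (v $ i) * hmat A $ i $ j * v $ j) = cmod (hmat A $ i $ j) * (cmod (v $ i) * cmod (v $ j))"
      by (simp add: norm_mult)
    also have "\<dots> \<le> cmod (hmat A $ i $ j) * (norm v * norm v)"
      by (intro mult_left_mono mult_mono) (simp_all add: Finite_Cartesian_Product.norm_nth_le)
    finally show "cmod (cnj (v $ i) * hmat A $ i $ j * v $ j) \<le> cmod (hmat A $ i $ j) * (norm v)\<^sup>2"
      by (simp add: power2_eq_square)
  qed
  finally show ?thesis by (simp add: herm_bound_def sum_distrib_right)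
qed

text \<open>Adding a large multiple of the identity makes M psd. The splitting later carries
  representing measures from psd to all Hermitian matrices.\<close>

lemma herm_diff_psd: "\<exists>A\<in>herm_psd. \<exists>B\<in>herm_psd. M = A - B"
proof -
  let ?B = "herm_bound M *\<^sub>R herm_id"
  have "?B \<in> herm_psd"
    by (simp add: herm_psd_iff herm_inner_scale_left herm_inner_id_outer herm_bound_nonneg)
  moreover have "M + ?B \<in> herm_psd"
    unfolding herm_psd_iff herm_inner_add_left herm_inner_scale_left herm_inner_id_outer real_scaleR_def
  proof
    fix v
    show "0 \<le> herm_inner M (outer v) + herm_bound M * (norm v)\<^sup>2"
      using abs_herm_inner_outer_le[of M v] by linarith
  qed
  moreover have "M = (M + ?B) - ?B" by simp
  ultimately show ?thesis by blast
qed

section \<open>Taylor coefficients of polynomials\<close>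

abbreviation (input) exponents_le :: "('n \<Rightarrow>\<^sub>0 nat) \<Rightarrow> ('n \<Rightarrow>\<^sub>0 nat) set"
  where "exponents_le \<beta> \<equiv> {\<alpha>. \<forall>i. Poly_Mapping.lookup \<alpha> i \<le> Poly_Mapping.lookup \<beta> i}"

lemma mpow_0: "mpow 0 \<beta> = (if \<beta> = 0 then 1 else 0)"
  by (auto simp: mpow_def poly_mapping_eq_iff fun_eq_iff)

lemma mfact_0 [simp]: "mfact 0 = 1"
  by (simp add: mfact_def)

lemma mveval_0: "mveval p 0 = Poly_Mapping.lookup p 0"
proof -
  have "mveval p 0 = (\<Sum>\<beta>\<in>Poly_Mapping.keys p. if \<beta> = 0 then Poly_Mapping.lookup p \<beta> else 0)"
    unfolding mveval_def by (intro sum.cong refl) (simp add: mpow_0)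
  then show ?thesis by (simp add: in_keys_iff)
qed

lemma mveval_scale: "mveval (r *\<^sub>R p) x = r *\<^sub>R mveval p x"
  using mveval_superset[of "Poly_Mapping.keys p" "r *\<^sub>R p" x]
  by (auto simp: mveval_def scaleR_poly_mapping.rep_eq in_keys_iff scaleR_sum_right subset_iff mult_ac)

lemma linear_mveval: "linear (\<lambda>p. mveval p x)"
  by (intro linearI) (simp_all add: mveval_add mveval_scale)

text \<open>Induction on the order of \<alpha>: a first partial derivative of f is the ordinary
  derivative of a zero function along a coordinate line, so it vanishes everywhere as well.\<close>

lemma mveval_eq_0_imp_mvdiff:
  fixes f :: "('n::finite, real) mvpoly"
  assumes "\<And>x. mveval f x = 0"
  shows "mveval (mvdiff \<alpha> f) x = 0"
  using assms
proof (induction "\<Sum>i\<in>UNIV. Poly_Mapping.lookup \<alpha> i" arbitrary: \<alpha> f x)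
  case 0
  then have "\<alpha> = 0" by (simp add: poly_mapping_eq_iff fun_eq_iff)
  with 0 show ?case by (simp add: mvdiff_0)
next
  case (Suc n)
  then obtain i where i: "Poly_Mapping.lookup \<alpha> i > 0"
    by (metis gr0I nat.distinct(1) sum.neutral)
  let ?s = "Poly_Mapping.single i (1::nat)"
  have \<alpha>: "\<alpha> = (\<alpha> - ?s) + ?s"
    using i by (intro poly_mapping_eqI) (auto simp: lookup_add lookup_minus lookup_single when_def)
  have "(\<Sum>j\<in>UNIV. Poly_Mapping.lookup \<alpha> j) = (\<Sum>j\<in>UNIV. Poly_Mapping.lookup (\<alpha> - ?s) j) + (\<Sum>j\<in>UNIV. Poly_Mapping.lookup ?s j)"
    by (subst \<alpha>) (simp add: lookup_add sum.distrib)
  also have "(\<Sum>j\<in>UNIV. Poly_Mapping.lookup ?s j) = 1" by (simp add: lookup_single when_def)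
  finally have n: "n = (\<Sum>j\<in>UNIV. Poly_Mapping.lookup (\<alpha> - ?s) j)" using Suc.hyps by simp
  have "mveval (mvdiff ?s f) z = 0" for z
  proof (rule DERIV_unique)
    show "((\<lambda>h. mveval f (z + h *\<^sub>R axis i 1)) has_real_derivative mveval (mvdiff ?s f) z) (at 0)"
      by (rule has_derivative_mvdiff)
    show "((\<lambda>h. mveval f (z + h *\<^sub>R axis i 1)) has_real_derivative 0) (at 0)"
      by (simp add: Suc.prems)
  qed
  then have "mveval (mvdiff (\<alpha> - ?s) (mvdiff ?s f)) x = 0" by (rule Suc.hyps(1)[OF n])
  then show ?case by (subst \<alpha>) (simp only: mvdiff_add)
qed

lemma mveval_eq_0_imp_real:
  fixes f :: "('n::finite, real) mvpoly"
  assumes "\<And>x. mveval f x = 0"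
  shows "f = 0"
proof (rule poly_mapping_eqI)
  fix \<alpha>
  have "mveval (mvdiff \<alpha> f) 0 = 0" by (rule mveval_eq_0_imp_mvdiff[OF assms])
  then show "Poly_Mapping.lookup f \<alpha> = Poly_Mapping.lookup 0 \<alpha>"
    using mfact_pos[of \<alpha>] by (simp add: mveval_0 mvdiff.rep_eq)
qed

lemma mveval_map:
  assumes "linear h"
  shows "mveval (Poly_Mapping.map h p) x = h (mveval p x)"
proof -
  have "h 0 = 0" by (rule linear_0[OF assms])
  then have "Poly_Mapping.keys (Poly_Mapping.map h p) \<subseteq> Poly_Mapping.keys p"
    by (auto simp: in_keys_iff Poly_Mapping.map.rep_eq when_def split: if_splits)
  then have "mveval (Poly_Mapping.map h p) x
      = (\<Sum>\<beta>\<in>Poly_Mapping.keys p. mpow x \<beta> *\<^sub>R Poly_Mapping.lookup (Poly_Mapping.map h p) \<beta>)"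
    by (intro mveval_superset) auto
  then show ?thesis
    by (simp add: mveval_def linear_sum[OF assms] linear_scale[OF assms] Poly_Mapping.map.rep_eq in_keys_iff)
qed

text \<open>Pairing with a fixed matrix reduces to scalar polynomials. When the difference is paired
  with its own coefficient A at \<alpha>, the scalar coefficient at \<alpha> is <A, A>, which must
  then vanish.\<close>

lemma mveval_inject:
  fixes p q :: "('n::finite, 'm::finite herm) mvpoly"
  assumes "\<And>x. mveval p x = mveval q x"
  shows "p = q"
proof -
  define d where "d = p - q"
  have d: "mveval d x = 0" for x
    using assms linear_diff[OF linear_mveval, of p q x] by (simp add: d_def)
  have "Poly_Mapping.lookup d \<alpha> = 0" for \<alpha>
  proof -
    let ?A = "Poly_Mapping.lookup d \<alpha>"
    have "Poly_Mapping.map (\<lambda>A. herm_inner A ?A) d = 0"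
      by (intro mveval_eq_0_imp_real) (simp add: mveval_map linear_herm_inner_left d)
    then have "Poly_Mapping.lookup (Poly_Mapping.map (\<lambda>A. herm_inner A ?A) d) \<alpha> = 0" by simp
    then have "herm_inner ?A ?A = 0" by (simp add: Poly_Mapping.map.rep_eq when_def split: if_splits)
    then show ?thesis by (simp add: herm_inner_self_eq_0)
  qed
  then have "d = 0" by (intro poly_mapping_eqI) simp
  then show ?thesis by (simp add: d_def)
qed

section \<open>Taylor expansion and translation\<close>

lemma bij_betw_exponents_le:
  "bij_betw Poly_Mapping.lookup (exponents_le \<beta>) (PiE UNIV (\<lambda>i::'n::finite. {..Poly_Mapping.lookup \<beta> i}))"
proof (rule bij_betwI')
  fix f :: "'n \<Rightarrow> nat" assume f: "f \<in> PiE UNIV (\<lambda>i. {..Poly_Mapping.lookup \<beta> i})"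
  have "Poly_Mapping.lookup (Abs_poly_mapping f) = f" by simp
  with f show "\<exists>\<alpha>\<in>exponents_le \<beta>. f = Poly_Mapping.lookup \<alpha>"
    by (intro bexI[of _ "Abs_poly_mapping f"]) auto
qed (simp_all add: PiE_UNIV_domain)

text \<open>One binomial theorem per coordinate; multiplying out selects an exponent in each
  coordinate, that is, an \<alpha> below \<beta>. The product of the binomial coefficients, \<beta>!
  / (\<alpha>! (\<beta> - \<alpha>)!), is the factor from the \<alpha>-th derivative divided by
  \<alpha>!.\<close>

lemma mpow_add_expansion:
  "mpow (x + t) \<beta> = (\<Sum>\<alpha>\<in>exponents_le \<beta>. mveval (mvdiff \<alpha> (Poly_Mapping.single \<beta> 1)) x / mfact \<alpha> * mpow t \<alpha>)"
proof -
  let ?b = "Poly_Mapping.lookup \<beta>"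
  let ?g = "\<lambda>i a. of_nat (?b i choose a) * t $ i ^ a * x $ i ^ (?b i - a)"
  have "mpow (x + t) \<beta> = (\<Prod>i\<in>UNIV. \<Sum>a\<le>?b i. ?g i a)"
    unfolding mpow_def by (intro prod.cong refl) (subst add.commute, simp add: binomial_ring)
  also have "\<dots> = (\<Sum>f\<in>PiE UNIV (\<lambda>i. {..?b i}). \<Prod>i\<in>UNIV. ?g i (f i))"
    by (rule prod_sum_PiE) auto
  also have "\<dots> = (\<Sum>\<alpha>\<in>exponents_le \<beta>. \<Prod>i\<in>UNIV. ?g i (Poly_Mapping.lookup \<alpha> i))"
    by (rule sum.reindex_bij_betw[OF bij_betw_exponents_le, symmetric])
  also have "\<dots> = (\<Sum>\<alpha>\<in>exponents_le \<beta>. mveval (mvdiff \<alpha> (Poly_Mapping.single \<beta> 1)) x / mfact \<alpha> * mpow t \<alpha>)"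
  proof (intro sum.cong refl)
    fix \<alpha> assume \<alpha>: "\<alpha> \<in> exponents_le \<beta>"
    have "(\<Prod>i\<in>UNIV. ?g i (Poly_Mapping.lookup \<alpha> i))
        = (\<Prod>i\<in>UNIV. fact (?b i) / (fact (Poly_Mapping.lookup \<alpha> i) * fact (?b i - Poly_Mapping.lookup \<alpha> i))
            * t $ i ^ Poly_Mapping.lookup \<alpha> i * x $ i ^ (?b i - Poly_Mapping.lookup \<alpha> i))"
      using \<alpha> by (intro prod.cong refl) (simp add: binomial_fact)
    also have "\<dots> = mfact \<beta> / (mfact \<alpha> * mfact (\<beta> - \<alpha>)) * mpow t \<alpha> * mpow x (\<beta> - \<alpha>)"
      by (simp add: prod.distrib prod_dividef mfact_def mpow_def lookup_minus)
    also have "\<dots> = mveval (mvdiff \<alpha> (Poly_Mapping.single \<beta> 1)) x / mfact \<alpha> * mpow t \<alpha>"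
      using \<alpha> by (simp add: mvdiff_single mveval_single mult_ac)
    finally show "(\<Prod>i\<in>UNIV. ?g i (Poly_Mapping.lookup \<alpha> i)) = \<dots>" .
  qed
  finally show ?thesis .
qed

text \<open>The coefficient of \<open>t\<^sup>\<alpha>\<close> in \<open>p(x + t)\<close> is \<open>\<partial>\<^sup>\<alpha>p(x) / \<alpha>!\<close>.\<close>

definition mvtranslate :: "real^'n::finite \<Rightarrow> ('n, 'a::real_vector) mvpoly \<Rightarrow> ('n, 'a) mvpoly"
  where "mvtranslate x p = (\<Sum>\<beta>\<in>Poly_Mapping.keys p. \<Sum>\<alpha>\<in>exponents_le \<beta>.
    Poly_Mapping.single \<alpha> ((mveval (mvdiff \<alpha> (Poly_Mapping.single \<beta> 1)) x / mfact \<alpha>) *\<^sub>R Poly_Mapping.lookup p \<beta>))"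

text \<open>The restriction of the inner sum to \<alpha> \<le> \<beta> disappears, since the
  \<alpha>-th derivative of x^\<beta> is zero otherwise.\<close>

lemma lookup_mvtranslate:
  "Poly_Mapping.lookup (mvtranslate x p) \<alpha> = (\<Sum>\<beta>\<in>Poly_Mapping.keys p.
    (mveval (mvdiff \<alpha> (Poly_Mapping.single \<beta> 1)) x / mfact \<alpha>) *\<^sub>R Poly_Mapping.lookup p \<beta>)"
  unfolding mvtranslate_def lookup_sum
proof (intro sum.cong refl)
  fix \<beta>
  let ?c = "\<lambda>\<alpha>. (mveval (mvdiff \<alpha> (Poly_Mapping.single \<beta> 1)) x / mfact \<alpha>) *\<^sub>R Poly_Mapping.lookup p \<beta>"
  have "(\<Sum>a\<in>exponents_le \<beta>. Poly_Mapping.lookup (Poly_Mapping.single a (?c a)) \<alpha>)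
      = (if \<alpha> \<in> exponents_le \<beta> then ?c \<alpha> else 0)"
    by (simp add: lookup_single when_def finite_le_exponent)
  also have "\<dots> = ?c \<alpha>" by (auto simp: mvdiff_single)
  finally show "(\<Sum>a\<in>exponents_le \<beta>. Poly_Mapping.lookup (Poly_Mapping.single a (?c a)) \<alpha>) = ?c \<alpha>" .
qed

lemma mveval_mvtranslate: "mveval (mvtranslate x p) t = mveval p (x + t)"
  by (simp add: mvtranslate_def mveval_sum mveval_single mpow_add_expansion mveval_def[of p]
      scaleR_sum_left mult_ac)

lemma mvtranslate_0: "mvtranslate 0 p = (p :: ('n::finite, 'm::finite herm) mvpoly)"
  by (rule mveval_inject) (simp add: mveval_mvtranslate)

lemma mvtranslate_minus:
  "mvtranslate x (mvtranslate (- x) p) = (p :: ('n::finite, 'm::finite herm) mvpoly)"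
  by (rule mveval_inject) (simp add: mveval_mvtranslate)

lemma mvtranslate_pos: "p \<in> pos_herm_polys \<Longrightarrow> mvtranslate x p \<in> pos_herm_polys"
  by (simp add: pos_herm_polys_def mveval_mvtranslate)

text \<open>In the paper's notation, \<open>symbol_form Q y q = (T\<^sub>y q)(0)\<close>.\<close>

definition symbol_form ::
  "(('n::finite \<Rightarrow>\<^sub>0 nat) \<Rightarrow> 'a::real_vector \<Rightarrow> ('n, 'b::real_vector) mvpoly) \<Rightarrow> real^'n \<Rightarrow> ('n, 'a) mvpoly \<Rightarrow> 'b"
  where "symbol_form Q y q = (\<Sum>\<alpha>\<in>Poly_Mapping.keys q. mveval (Q \<alpha> (Poly_Mapping.lookup q \<alpha>)) y)"

lemma symbol_form_superset:
  assumes "\<And>\<alpha>. linear (Q \<alpha>)" "finite S" "Poly_Mapping.keys q \<subseteq> S"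
  shows "symbol_form Q y q = (\<Sum>\<alpha>\<in>S. mveval (Q \<alpha> (Poly_Mapping.lookup q \<alpha>)) y)"
  unfolding symbol_form_def using assms(2,3)
  by (intro sum.mono_neutral_left) (auto simp: in_keys_iff linear_0[OF assms(1)])

lemma linear_symbol_form:
  fixes Q :: "('n::finite \<Rightarrow>\<^sub>0 nat) \<Rightarrow> 'a::real_vector \<Rightarrow> ('n, 'b::real_vector) mvpoly"
  assumes Q: "\<And>\<alpha>. linear (Q \<alpha>)"
  shows "linear (symbol_form Q y)"
proof (rule linearI)
  fix p q :: "('n, 'a) mvpoly" and r :: real
  let ?S = "Poly_Mapping.keys p \<union> Poly_Mapping.keys q"
  show "symbol_form Q y (p + q) = symbol_form Q y p + symbol_form Q y q"
    by (simp add: symbol_form_superset[where S = ?S, OF Q] Poly_Mapping.keys_add lookup_add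
        linear_add[OF Q] mveval_add sum.distrib)
  have "Poly_Mapping.keys (r *\<^sub>R p) \<subseteq> Poly_Mapping.keys p"
    by (auto simp: in_keys_iff scaleR_poly_mapping.rep_eq)
  then show "symbol_form Q y (r *\<^sub>R p) = r *\<^sub>R symbol_form Q y p"
    by (simp add: symbol_form_superset[where S = "Poly_Mapping.keys p", OF Q] scaleR_poly_mapping.rep_eq
        linear_scale[OF Q] mveval_scale scaleR_sum_right)
qed

lemma symbol_form_single:
  "(\<And>\<alpha>. linear (Q \<alpha>)) \<Longrightarrow> symbol_form Q y (Poly_Mapping.single \<beta> M) = mveval (Q \<beta> M) y"
  by (subst symbol_form_superset[where S = "{\<beta>}"]) auto

text \<open>Inserting the Taylor coefficients gives the formula of T with separate points for its
  two factors: derivatives at x, values of Q at y. The free set \<open>S\<close> allows a match with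
  the index set of an operator.\<close>

lemma symbol_form_mvtranslate:
  assumes Q: "\<And>\<alpha>. linear (Q \<alpha>)" and S: "finite S" "Poly_Mapping.keys (mvtranslate x p) \<subseteq> S"
  shows "symbol_form Q y (mvtranslate x p) = (\<Sum>\<alpha>\<in>S. (1 / mfact \<alpha>) *\<^sub>R (\<Sum>\<beta>\<in>Poly_Mapping.keys p.
    mveval (mvdiff \<alpha> (Poly_Mapping.single \<beta> 1)) x *\<^sub>R mveval (Q \<alpha> (Poly_Mapping.lookup p \<beta>)) y))"
  unfolding symbol_form_superset[OF Q S]
  by (simp add: lookup_mvtranslate linear_sum[OF Q] linear_scale[OF Q] mveval_sum mveval_scale scaleR_sum_right)

text \<open>The index set joins the support of the operator's terms with the exponents of the
  translate, so that both finite sums can be compared over it. It is used with z equal to x, once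
  for Q itself and once for Q frozen at a point.\<close>

lemma mveval_diff_op_sum:
  obtains S where "finite S" "Poly_Mapping.keys (mvtranslate x p) \<subseteq> S"
    "mveval (diff_op Q p) z = (\<Sum>\<alpha>\<in>S. (1 / mfact \<alpha>) *\<^sub>R (\<Sum>\<beta>\<in>Poly_Mapping.keys p.
    mveval (mvdiff \<alpha> (Poly_Mapping.single \<beta> 1)) z *\<^sub>R mveval (Q \<alpha> (Poly_Mapping.lookup p \<beta>)) z))"
proof
  let ?S = "{\<alpha>. (1 / mfact \<alpha>) *\<^sub>R diff_term (Q \<alpha>) \<alpha> p \<noteq> 0} \<union> Poly_Mapping.keys (mvtranslate x p)"
  show fin: "finite ?S" using finite_diff_op_support[of Q p] by simp
  have "diff_op Q p = (\<Sum>\<alpha>\<in>?S. (1 / mfact \<alpha>) *\<^sub>R diff_term (Q \<alpha>) \<alpha> p)"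
    unfolding diff_op_def by (rule Sum_any.expand_superset[OF fin]) auto
  then show "mveval (diff_op Q p) z = (\<Sum>\<alpha>\<in>?S. (1 / mfact \<alpha>) *\<^sub>R (\<Sum>\<beta>\<in>Poly_Mapping.keys p.
    mveval (mvdiff \<alpha> (Poly_Mapping.single \<beta> 1)) z *\<^sub>R mveval (Q \<alpha> (Poly_Mapping.lookup p \<beta>)) z))"
    by (simp only: mveval_sum mveval_scale diff_term_def mveval_mvscale)
qed simp

lemma mveval_diff_op:
  assumes Q: "\<And>\<alpha>. linear (Q \<alpha>)"
  shows "mveval (diff_op Q p) y = symbol_form Q y (mvtranslate y p)"
proof -
  obtain S where S: "finite S" "Poly_Mapping.keys (mvtranslate y p) \<subseteq> S"
    "mveval (diff_op Q p) y = (\<Sum>\<alpha>\<in>S. (1 / mfact \<alpha>) *\<^sub>R (\<Sum>\<beta>\<in>Poly_Mapping.keys p.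
    mveval (mvdiff \<alpha> (Poly_Mapping.single \<beta> 1)) y *\<^sub>R mveval (Q \<alpha> (Poly_Mapping.lookup p \<beta>)) y))"
    by (rule mveval_diff_op_sum)
  then show ?thesis by (simp only: symbol_form_mvtranslate[OF Q S(1,2)])
qed

lemma mveval_diff_op_at:
  assumes Q: "\<And>\<alpha>. linear (Q \<alpha>)"
  shows "mveval (diff_op_at Q y p) x = symbol_form Q y (mvtranslate x p)"
proof -
  obtain S where S: "finite S" "Poly_Mapping.keys (mvtranslate x p) \<subseteq> S"
    "mveval (diff_op_at Q y p) x = (\<Sum>\<alpha>\<in>S. (1 / mfact \<alpha>) *\<^sub>R (\<Sum>\<beta>\<in>Poly_Mapping.keys p.
    mveval (mvdiff \<alpha> (Poly_Mapping.single \<beta> 1)) x *\<^sub>R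
      mveval (Poly_Mapping.single 0 (mveval (Q \<alpha> (Poly_Mapping.lookup p \<beta>)) y)) x))"
    unfolding diff_op_at_def by (rule mveval_diff_op_sum)
  have "mpow x 0 = 1" by (simp add: mpow_def)
  with S show ?thesis by (simp only: symbol_form_mvtranslate[OF Q S(1,2)] mveval_single scaleR_one)
qed

lemma mveval_diff_op_at_inner:
  assumes Q: "\<And>\<alpha>. linear (Q \<alpha>)"
  shows "mveval (diff_op_at_inner Q y M p) x = herm_inner (symbol_form Q y (mvtranslate x p)) M"
  unfolding diff_op_at_inner_def
  by (simp add: mveval_map[OF linear_herm_inner_left] mveval_diff_op_at[OF Q])

section \<open>Approximation by finite sums of generating functionals\<close>

text \<open>
  The squared distance from the values of \<open>L\<close> on the \<open>f i\<close> to the cone spanned by \<open>E\<close> has infimum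
  \<open>\<delta>\<close>.  At an almost minimal point with residual \<open>w\<close>, moving towards \<open>e \<in> E\<close> gains almost nothing,
  so \<open>p = \<Sum> w\<^sub>i f\<^sub>i\<close> satisfies \<open>e p \<le> s e h\<close>, whence \<open>L p \<le> s L h\<close>; moving towards the apex gains
  almost nothing either, and together this forces \<open>\<delta> = 0\<close>.
\<close>

lemma cone_approximation:
  fixes L :: "'p::real_vector \<Rightarrow> real" and E :: "('p \<Rightarrow> real) set" and f :: "'i \<Rightarrow> 'p"
  assumes L: "linear L" and E: "\<And>e. e \<in> E \<Longrightarrow> linear e"
    and scale: "\<And>e c. e \<in> E \<Longrightarrow> 0 \<le> c \<Longrightarrow> (\<lambda>p. c * e p) \<in> E"
    and pos: "\<And>p. (\<And>e. e \<in> E \<Longrightarrow> 0 \<le> e p) \<Longrightarrow> 0 \<le> L p"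
    and dom: "\<And>q. \<exists>h. \<forall>e\<in>E. \<bar>e q\<bar> \<le> e h"
    and I: "finite I" and \<epsilon>: "0 < \<epsilon>"
  shows "\<exists>es. set es \<subseteq> E \<and> (\<forall>i\<in>I. \<bar>L (f i) - (\<Sum>e\<leftarrow>es. e (f i))\<bar> < \<epsilon>)"
proof -
  define W where "W es i = L (f i) - (\<Sum>e\<leftarrow>es. e (f i))" for es i
  define D where "D es = (\<Sum>i\<in>I. (W es i)\<^sup>2)" for es
  define \<delta> where "\<delta> = Inf (D ` {es. set es \<subseteq> E})"
  have D0: "0 \<le> D es" for es by (simp add: D_def sum_nonneg)
  have bdd: "bdd_below (D ` {es. set es \<subseteq> E})" using D0 by (auto intro!: bdd_belowI[of _ 0])
  have ne: "D ` {es. set es \<subseteq> E} \<noteq> {}" by (auto intro!: exI[of _ "[]"])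
  have low: "\<delta> \<le> D es" if "set es \<subseteq> E" for es
    unfolding \<delta>_def using that by (intro cInf_lower[OF _ bdd]) auto
  have near: "\<exists>es. set es \<subseteq> E \<and> D es < \<delta> + \<eta>" if "0 < \<eta>" for \<eta>
    using cInf_lessD[OF ne, of "\<delta> + \<eta>"] that unfolding \<delta>_def by auto
  obtain h where h: "\<And>q e. e \<in> E \<Longrightarrow> \<bar>e q\<bar> \<le> e (h q)" using dom by metis
  \<comment> \<open>One element dominates all |e(f i)| at once, so e(h0) measures the size of a
    generator e.\<close>
  define h0 where "h0 = (\<Sum>i\<in>I. h (f i))"
  have h0: "(\<Sum>i\<in>I. \<bar>e (f i)\<bar>) \<le> e h0" if "e \<in> E" for e
    unfolding h0_def linear_sum[OF E[OF that]] using h[OF that] by (intro sum_mono)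
  define SL where "SL = (\<Sum>i\<in>I. (L (f i))\<^sup>2)"
  \<comment> \<open>L(h0) comes from moving towards generators, the rest from moving towards the
    apex; there F = L(f) - w bounds the sum of F^2 by 2 SL + 2 (\<delta> + 1).\<close>
  define K where "K = L h0 + (1 + 2 * SL + 2 * (\<delta> + 1)) / 2"
  have key: "\<delta> \<le> s * K" if s: "0 < s" "s < 1" for s
  proof -
    \<comment> \<open>An excess of s^2 over the infimum is still of order s after division by a step
      of order s.\<close>
    obtain es where es: "set es \<subseteq> E" "D es < \<delta> + s\<^sup>2" using near[of "s\<^sup>2"] s by auto
    define w where "w = W es"
    define F where "F i = (\<Sum>e\<leftarrow>es. e (f i))" for i
    have w: "w i = L (f i) - F i" for i by (simp add: w_def W_def F_def)
    have Dw: "D es = (\<Sum>i\<in>I. (w i)\<^sup>2)" by (simp add: D_def w_def)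
    define p where "p = (\<Sum>i\<in>I. w i *\<^sub>R f i)"
    have ep: "e p = (\<Sum>i\<in>I. w i * e (f i))" if "linear e" for e :: "'p \<Rightarrow> real"
      by (simp add: p_def linear_sum[OF that] linear_scale[OF that])
    have c1: "e p \<le> s * e h0" if e: "e \<in> E" for e
    proof (cases "e h0 = 0")
      case True
      have "(\<Sum>i\<in>I. \<bar>e (f i)\<bar>) = 0" using h0[OF e] True by (intro antisym sum_nonneg) auto
      then have "\<forall>i\<in>I. e (f i) = 0" using I by (simp add: sum_nonneg_eq_0_iff)
      then show ?thesis using True by (simp add: ep[OF E[OF e]])
    next
      case False
      have "0 \<le> e h0" using h0[OF e] by (intro order_trans[OF _ h0[OF e]] sum_nonneg) auto
      with False have eh: "0 < e h0" by simp
      \<comment> \<open>The step is scaled by the size of e, so that t e(h0) = s; the quadratic term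
        is then at most s^2, the same order as the excess.\<close>
      define t where "t = s / e h0"
      have t: "0 < t" using s eh by (simp add: t_def)
      have "\<delta> \<le> D ((\<lambda>p. t * e p) # es)"
        using es scale[OF e, of t] t by (intro low) auto
      also have "\<dots> = (\<Sum>i\<in>I. (w i - t * e (f i))\<^sup>2)"
        by (simp add: D_def W_def w_def algebra_simps)
      also have "\<dots> = (\<Sum>i\<in>I. (w i)\<^sup>2) - 2 * t * (\<Sum>i\<in>I. w i * e (f i)) + t\<^sup>2 * (\<Sum>i\<in>I. (e (f i))\<^sup>2)"
        by (simp add: power2_diff power_mult_distrib sum.distrib sum_subtractf sum_distrib_left mult_ac)
      also have "\<dots> \<le> D es - 2 * t * e p + t\<^sup>2 * (e h0)\<^sup>2"
      proof -
        have "(\<Sum>i\<in>I. (e (f i))\<^sup>2) \<le> (\<Sum>i\<in>I. \<bar>e (f i)\<bar>)\<^sup>2"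
        proof -
          have "(\<Sum>i\<in>I. (e (f i))\<^sup>2) \<le> (\<Sum>i\<in>I. \<bar>e (f i)\<bar> * (\<Sum>j\<in>I. \<bar>e (f j)\<bar>))"
          proof (intro sum_mono)
            fix i assume "i \<in> I"
            then have "\<bar>e (f i)\<bar> \<le> (\<Sum>j\<in>I. \<bar>e (f j)\<bar>)" using I by (intro member_le_sum) auto
            then have "\<bar>e (f i)\<bar> * \<bar>e (f i)\<bar> \<le> \<bar>e (f i)\<bar> * (\<Sum>j\<in>I. \<bar>e (f j)\<bar>)"
              by (intro mult_left_mono) auto
            then show "(e (f i))\<^sup>2 \<le> \<bar>e (f i)\<bar> * (\<Sum>j\<in>I. \<bar>e (f j)\<bar>)"
              by (simp add: power2_eq_square)
          qed
          then show ?thesis by (simp add: power2_eq_square sum_distrib_right)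
        qed
        also have "\<dots> \<le> (e h0)\<^sup>2" using h0[OF e] by (intro power_mono) (auto intro: sum_nonneg)
        finally show ?thesis unfolding Dw ep[OF E[OF e]] by (intro add_left_mono mult_left_mono) auto
      qed
      also have "t\<^sup>2 * (e h0)\<^sup>2 = s\<^sup>2" using eh by (simp add: t_def power_divide)
      finally have "2 * t * e p \<le> 2 * s\<^sup>2" using es(2) by simp
      then have "(s / e h0) * e p \<le> s * s" by (simp add: t_def power2_eq_square)
      then have "s * e p \<le> s * (s * e h0)" using eh by (simp add: field_simps)
      then show ?thesis using s by simp
    qed
    \<comment> \<open>Here the positivity hypothesis enters: every generator is nonnegative on s h0
      - p.\<close>
    have "0 \<le> L (s *\<^sub>R h0 - p)"
      using c1 by (intro pos) (simp add: linear_diff[OF E] linear_scale[OF E])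
    then have Lp: "L p \<le> s * L h0" by (simp add: linear_diff[OF L] linear_scale[OF L])
    \<comment> \<open>Shrinking all chosen generators by the factor 1 - s is the move towards the
      apex.\<close>
    have "\<delta> \<le> D (map (\<lambda>e p. (1 - s) * e p) es)"
      using es s scale[of _ "1 - s"] by (intro low) auto
    also have "\<dots> = (\<Sum>i\<in>I. (w i + s * F i)\<^sup>2)"
    proof -
      have "W (map (\<lambda>e p. (1 - s) * e p) es) i = w i + s * F i" for i
        by (simp add: W_def w F_def o_def sum_list_const_mult) (simp add: algebra_simps)
      then show ?thesis by (simp add: D_def)
    qed
    also have "\<dots> = (\<Sum>i\<in>I. (w i)\<^sup>2) + 2 * s * (\<Sum>i\<in>I. w i * F i) + s\<^sup>2 * (\<Sum>i\<in>I. (F i)\<^sup>2)"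
      by (simp add: power2_sum power_mult_distrib sum.distrib sum_distrib_left mult_ac)
    finally have "0 \<le> s * (s + 2 * (\<Sum>i\<in>I. w i * F i) + s * (\<Sum>i\<in>I. (F i)\<^sup>2))"
      using es(2) unfolding Dw by (simp add: power2_eq_square algebra_simps)
    then have "0 \<le> s + 2 * (\<Sum>i\<in>I. w i * F i) + s * (\<Sum>i\<in>I. (F i)\<^sup>2)"
      using s by (simp only: zero_le_mult_iff) auto
    then have wF: "- (\<Sum>i\<in>I. w i * F i) \<le> s * (1 + (\<Sum>i\<in>I. (F i)\<^sup>2)) / 2"
      by (simp add: distrib_left)
    have "(\<Sum>i\<in>I. (F i)\<^sup>2) \<le> (\<Sum>i\<in>I. 2 * (L (f i))\<^sup>2 + 2 * (w i)\<^sup>2)"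
    proof (intro sum_mono)
      fix i
      have "0 \<le> (L (f i) + w i)\<^sup>2" by simp
      then show "(F i)\<^sup>2 \<le> 2 * (L (f i))\<^sup>2 + 2 * (w i)\<^sup>2"
        unfolding w by (simp add: power2_eq_square algebra_simps)
    qed
    also have "\<dots> = 2 * SL + 2 * D es" by (simp add: SL_def Dw sum.distrib sum_distrib_left)
    also have "\<dots> \<le> 2 * SL + 2 * (\<delta> + 1)"
    proof -
      have "s\<^sup>2 \<le> 1" using s by (simp add: power_le_one)
      then show ?thesis using es(2) by simp
    qed
    finally have F: "s * (1 + (\<Sum>i\<in>I. (F i)\<^sup>2)) / 2 \<le> s * (1 + (2 * SL + 2 * (\<delta> + 1))) / 2"
      using s by (intro divide_right_mono mult_left_mono) auto
    \<comment> \<open>As w = L(f) - F, the squared residual is L(p) minus the pairing of w with F,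
      and both contributions have upper bounds of order s.\<close>
    have "\<delta> \<le> D es" by (rule low[OF es(1)])
    also have "\<dots> = L p - (\<Sum>i\<in>I. w i * F i)"
      unfolding Dw ep[OF L] sum_subtractf[symmetric]
      by (intro sum.cong refl) (simp add: w power2_eq_square algebra_simps)
    also have "\<dots> \<le> s * K"
    proof -
      have "s * K = s * L h0 + s * (1 + (2 * SL + 2 * (\<delta> + 1))) / 2"
        by (simp add: K_def distrib_left add.assoc)
      then show ?thesis using Lp order_trans[OF wF F] by linarith
    qed
    finally show ?thesis .
  qed
  have "\<delta> \<le> 0"
  proof (rule ccontr)
    assume "\<not> \<delta> \<le> 0"
    then have d: "\<delta> > 0" by simp
    have K: "K > 0" using key[of "1/2"] d by simp
    define s where "s = min (1/2) (\<delta> / (2 * K))"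
    have "s * K \<le> \<delta> / (2 * K) * K" using K by (intro mult_right_mono) (auto simp: s_def)
    also have "\<dots> = \<delta> / 2" using K by simp
    finally have "s * K \<le> \<delta> / 2" .
    moreover have "0 < s" "s < 1" using d K by (auto simp: s_def min_def)
    ultimately show False using key[of s] d by linarith
  qed
  then obtain es where es: "set es \<subseteq> E" "D es < \<epsilon>\<^sup>2" using near[of "\<epsilon>\<^sup>2"] \<epsilon> by fastforce
  have "\<bar>W es i\<bar> < \<epsilon>" if "i \<in> I" for i
  proof -
    have "(W es i)\<^sup>2 \<le> D es" unfolding D_def using I that by (intro member_le_sum) auto
    with es(2) have "\<bar>W es i\<bar>\<^sup>2 < \<epsilon>\<^sup>2" by simp
    then show ?thesis using \<epsilon> by (intro power2_less_imp_less[of _ \<epsilon>]) auto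
  qed
  with es(1) show ?thesis unfolding W_def by blast
qed

section \<open>A continuous surjection of the line onto a Euclidean space\<close>

text \<open>The coordinates of Schoenberg's space-filling curve read off interleaved ternary digits.\<close>

definition osc :: "real \<Rightarrow> real"
  where "osc t = arccos (cos (pi * t)) / pi"

text \<open>\<open>osc\<close> is the triangle wave of period 2 that is the identity on [0, 1]. The
  switch is 0 where the wave is at most 1/3 and 1 where it is at least 2/3: on numbers in [0, 1]
  with ternary digits 0 and 2 it reads the first digit.\<close>

definition digit_switch :: "real \<Rightarrow> real"
  where "digit_switch t = min 1 (max 0 (3 * osc t - 1))"

text \<open>For i < N, coordinate i takes the ternary digits at positions congruent to i modulo N as
  its binary digits, so different coordinates draw on disjoint sets of digits.\<close>

definition schoenberg :: "nat \<Rightarrow> nat \<Rightarrow> real \<Rightarrow> real"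
  where "schoenberg N i t = suminf (\<lambda>k. digit_switch (3 ^ (N * k + i) * t) / 2 ^ Suc k)"

lemma cos_periodic_int: "cos (pi * (2 * of_int k + r)) = cos (pi * r)"
proof -
  have "pi * (2 * of_int k + r) = pi * r + 2 * pi * of_int k" by (simp add: algebra_simps)
  then show ?thesis by (simp add: cos_add)
qed

lemma osc_periodic: "osc (2 * of_int k + r) = osc r"
  by (simp add: osc_def cos_periodic_int)

lemma osc_eq: "0 \<le> r \<Longrightarrow> r \<le> 1 \<Longrightarrow> osc r = r"
  by (simp add: osc_def arccos_cos mult_left_le)

lemma continuous_osc: "continuous_on UNIV osc"
  unfolding osc_def by (intro continuous_intros) auto

lemma continuous_digit_switch: "continuous_on UNIV digit_switch"
  unfolding digit_switch_def by (intro continuous_intros continuous_osc)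

lemma digit_switch_bounds: "0 \<le> digit_switch t" "digit_switch t \<le> 1"
  by (auto simp: digit_switch_def)

lemma continuous_schoenberg: "continuous_on UNIV (schoenberg N i)"
proof -
  have "uniform_limit UNIV (\<lambda>n t. \<Sum>k<n. digit_switch (3 ^ (N * k + i) * t) / 2 ^ Suc k)
      (schoenberg N i) sequentially"
    unfolding schoenberg_def
  proof (rule Weierstrass_m_test)
    show "norm (digit_switch (3 ^ (N * k + i) * t) / 2 ^ Suc k) \<le> (1/2) ^ Suc k" for k t
      using digit_switch_bounds[of "3 ^ (N * k + i) * t"] by (simp add: field_simps power_one_over)
    show "summable (\<lambda>k. (1/2 :: real) ^ Suc k)"
      by (simp add: summable_geometric)
  qed
  then show ?thesis
    by (rule uniform_limit_theorem[rotated])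
       (auto intro!: always_eventually continuous_intros continuous_on_compose2[OF continuous_digit_switch])
qed

text \<open>A power of 3 times an even integer is an even integer, so the period 2 of the wave is
  inherited. Each interval [2k, 2k + 1] thus carries a full copy of the curve.\<close>

lemma schoenberg_periodic: "schoenberg N i (2 * of_int k + r) = schoenberg N i r"
proof -
  have "digit_switch (3 ^ j * (2 * of_int k + r)) = digit_switch (3 ^ j * r)" for j :: nat
  proof -
    have "3 ^ j * (2 * of_int k + r) = 2 * of_int (3 ^ j * k) + 3 ^ j * r" by (simp add: algebra_simps)
    then show ?thesis unfolding digit_switch_def by (simp only: osc_periodic)
  qed
  then show ?thesis by (simp add: schoenberg_def)
qed

lemma binary_expansion:
  fixes u :: real
  assumes u: "0 \<le> u" "u < 1"
  obtains b :: "nat \<Rightarrow> nat" where "\<And>k. b k \<le> 1" "(\<lambda>k. of_nat (b k) / 2 ^ Suc k) sums u"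
proof
  let ?F = "\<lambda>k. \<lfloor>2 ^ k * u\<rfloor>"
  \<comment> \<open>\<open>b k\<close> is a binary digit written as a difference of floors; the
    partial sums telescope, and u < 1 makes the initial floor zero.\<close>
  define b where "b k = nat (?F (Suc k) - 2 * ?F k)" for k
  have *: "0 \<le> ?F (Suc k) - 2 * ?F k" "?F (Suc k) - 2 * ?F k \<le> 1" for k
    by (simp_all add: algebra_simps) linarith+
  show "b k \<le> 1" for k using *[of k] by (simp add: b_def)
  have "(\<lambda>k. of_int (?F k) / 2 ^ k) \<longlonglongrightarrow> u"
  proof (rule tendsto_sandwich[OF always_eventually always_eventually])
    show "\<forall>k. u - (1/2) ^ k \<le> of_int (?F k) / 2 ^ k"
    proof
      fix k :: nat
      have "2 ^ k * u - 1 \<le> of_int (?F k)" by linarith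
      then have "(2 ^ k * u - 1) / 2 ^ k \<le> of_int (?F k) / 2 ^ k" by (rule divide_right_mono) simp
      then show "u - (1/2) ^ k \<le> of_int (?F k) / 2 ^ k"
        by (simp add: diff_divide_distrib power_one_over)
    qed
    show "\<forall>k. of_int (?F k) / 2 ^ k \<le> u"
    proof
      fix k :: nat
      have "of_int (?F k) / 2 ^ k \<le> (2 ^ k * u) / 2 ^ k" by (rule divide_right_mono) auto
      then show "of_int (?F k) / 2 ^ k \<le> u" by simp
    qed
    have "(\<lambda>k. u - (1/2) ^ k) \<longlonglongrightarrow> u - 0"
      by (intro tendsto_intros LIMSEQ_realpow_zero) auto
    then show "(\<lambda>k. u - (1/2) ^ k) \<longlonglongrightarrow> u" by simp
  qed simp
  then have "(\<lambda>k. of_int (?F (Suc k)) / 2 ^ Suc k - of_int (?F k) / 2 ^ k) sums (u - of_int (?F 0) / 2 ^ 0)"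
    by (rule telescope_sums)
  moreover have "?F 0 = 0" using u by (simp add: floor_eq_iff)
  moreover have "of_nat (b k) / 2 ^ Suc k = of_int (?F (Suc k)) / 2 ^ Suc k - of_int (?F k) / (2 ^ k :: real)" for k
  proof -
    have "real (b k) = of_int (?F (Suc k)) - 2 * of_int (?F k)" using *(1)[of k] by (simp add: b_def)
    then show ?thesis by (simp add: field_simps)
  qed
  ultimately show "(\<lambda>k. of_nat (b k) / 2 ^ Suc k) sums u" by simp
qed

text \<open>Multiplication by 3^l shifts the digits. The integer split off is even, all digits being
  0 or 2, and so is invisible to the wave; the remainder r = (2 a_l + r') / 3 with r' in [0, 1] lies
  in [0, 1/3] or in [2/3, 1] according to a_l.\<close>

lemma digit_switch_ternary:
  fixes a :: "nat \<Rightarrow> nat"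
  assumes a: "\<And>j. a j \<le> 1"
  defines "s \<equiv> suminf (\<lambda>j. 2 * of_nat (a j) / 3 ^ Suc j :: real)"
  shows "0 \<le> s" "s \<le> 1" "digit_switch (3 ^ l * s) = of_nat (a l)"
proof -
  let ?g = "\<lambda>a j. 2 * of_nat (a j) / (3 ^ Suc j :: real)"
  have geo: "(\<lambda>j. 2 / (3 ^ Suc j :: real)) sums 1"
  proof -
    have "(\<lambda>j. (2/3) * (1/3 :: real) ^ j) sums ((2/3) * (1 / (1 - 1/3)))"
      by (intro sums_mult geometric_sums) auto
    then show ?thesis by (simp add: power_one_over)
  qed
  have le: "?g c j \<le> 2 / 3 ^ Suc j" if "\<And>j. c j \<le> 1" for c :: "nat \<Rightarrow> nat" and j
    using that[of j] by (simp add: field_simps)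
  have sm: "summable (?g c)" if "\<And>j. c j \<le> 1" for c :: "nat \<Rightarrow> nat"
    using le[OF that] by (intro summable_comparison_test'[OF sums_summable[OF geo], of 0]) simp
  have bd: "0 \<le> suminf (?g c)" "suminf (?g c) \<le> 1" if "\<And>j. c j \<le> 1" for c :: "nat \<Rightarrow> nat"
  proof -
    show "0 \<le> suminf (?g c)" by (intro suminf_nonneg sm that) simp
    have "suminf (?g c) \<le> suminf (\<lambda>j. 2 / 3 ^ Suc j)"
      by (intro suminf_le le sm that sums_summable[OF geo])
    then show "suminf (?g c) \<le> 1" using sums_unique[OF geo] by simp
  qed
  show "0 \<le> s" "s \<le> 1" using bd[OF a] by (simp_all add: s_def)
  define r where "r = suminf (?g (\<lambda>j. a (j + l)))"
  define r' where "r' = suminf (?g (\<lambda>j. a (j + Suc l)))"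
  have r': "0 \<le> r'" "r' \<le> 1" unfolding r'_def by (intro bd a)+
  have "r = ?g (\<lambda>j. a (j + l)) 0 + suminf (\<lambda>j. ?g (\<lambda>j. a (j + l)) (Suc j))"
    unfolding r_def by (subst suminf_split_head[OF sm[OF a]]) simp
  also have "suminf (\<lambda>j. ?g (\<lambda>j. a (j + l)) (Suc j)) = r' / 3"
    unfolding r'_def using sm[of "\<lambda>j. a (j + Suc l)"] a by (subst suminf_divide[symmetric]) auto
  finally have r: "r = 2 * of_nat (a l) / 3 + r' / 3" by simp
  have "s = suminf (\<lambda>j. ?g a (j + l)) + (\<Sum>j<l. ?g a j)"
    unfolding s_def by (rule suminf_split_initial_segment[OF sm[OF a]])
  also have "suminf (\<lambda>j. ?g a (j + l)) = r / 3 ^ l"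
    unfolding r_def using sm[of "\<lambda>j. a (j + l)"] a
    by (subst suminf_divide[symmetric]) (auto simp: power_add mult_ac)
  finally have "3 ^ l * s = r + (\<Sum>j<l. 3 ^ l * ?g a j)"
    by (simp add: algebra_simps sum_distrib_left)
  also have "(\<Sum>j<l. 3 ^ l * ?g a j) = (\<Sum>j<l. 2 * of_nat (a j * 3 ^ (l - Suc j)))"
  proof (intro sum.cong refl)
    fix j assume "j \<in> {..<l}"
    then have "(3::real) ^ l = 3 ^ Suc j * 3 ^ (l - Suc j)"
      unfolding power_add[symmetric] by simp
    then show "3 ^ l * ?g a j = 2 * of_nat (a j * 3 ^ (l - Suc j))" by simp
  qed
  also have "\<dots> = 2 * of_int (\<Sum>j<l. int (a j * 3 ^ (l - Suc j)))" by (simp add: sum_distrib_left)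
  finally have "3 ^ l * s = 2 * of_int (\<Sum>j<l. int (a j * 3 ^ (l - Suc j))) + r"
    by (simp only: add.commute)
  then have "digit_switch (3 ^ l * s) = digit_switch r"
    unfolding digit_switch_def by (simp only: osc_periodic)
  also have "\<dots> = of_nat (a l)"
  proof -
    have "a l = 0 \<or> a l = 1" using a[of l] by auto
    moreover have "0 \<le> r" "r \<le> 1" using r r' a[of l] by auto
    ultimately show ?thesis using r r' by (auto simp: digit_switch_def osc_eq)
  qed
  finally show "digit_switch (3 ^ l * s) = of_nat (a l)" .
qed

lemma schoenberg_onto:
  fixes u :: "nat \<Rightarrow> real"
  assumes u: "\<And>i. i < N \<Longrightarrow> 0 \<le> u i \<and> u i < 1"
  shows "\<exists>s. 0 \<le> s \<and> s \<le> 1 \<and> (\<forall>i<N. schoenberg N i s = u i)"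
proof -
  have "\<exists>b :: nat \<Rightarrow> nat. (\<forall>k. b k \<le> 1) \<and> (i < N \<longrightarrow> (\<lambda>k. of_nat (b k) / 2 ^ Suc k) sums u i)" for i
  proof (cases "i < N")
    case True
    then have "0 \<le> u i" "u i < 1" using u by auto
    then show ?thesis by (rule binary_expansion) blast
  qed (auto intro: exI[of _ "\<lambda>_. 0"])
  then have "\<exists>b. \<forall>i. (\<forall>k. b i k \<le> (1::nat)) \<and> (i < N \<longrightarrow> (\<lambda>k. of_nat (b i k) / 2 ^ Suc k) sums u i)"
    by (intro choice allI)
  then obtain b :: "nat \<Rightarrow> nat \<Rightarrow> nat" where b: "\<And>i k. b i k \<le> 1"
    "\<And>i. i < N \<Longrightarrow> (\<lambda>k. of_nat (b i k) / 2 ^ Suc k) sums u i" by blast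
  \<comment> \<open>Interleaving: position N k + i carries the k-th binary digit of u(i).\<close>
  define a where "a j = b (j mod N) (j div N)" for j
  define s where "s = suminf (\<lambda>j. 2 * of_nat (a j) / 3 ^ Suc j :: real)"
  have a: "a j \<le> 1" for j unfolding a_def by (rule b)
  have "schoenberg N i s = u i" if "i < N" for i
  proof -
    have "digit_switch (3 ^ (N * k + i) * s) = of_nat (b i k)" for k
      using digit_switch_ternary(3)[OF a] that by (simp add: s_def a_def)
    then show ?thesis using sums_unique[OF b(2)[OF that]] by (simp add: schoenberg_def)
  qed
  moreover have "0 \<le> s" "s \<le> 1" using digit_switch_ternary(1,2)[OF a] by (simp_all only: s_def)
  ultimately show ?thesis by blast
qed

text \<open>On [2k, 2k + 1] the factor \<open>rad\<close> equals k and the curve fills a cube of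
  half side 2k; between these intervals \<open>rad\<close> rises continuously from k to k + 1. A
  point x is reached for some k exceeding its norm by at most 2, whence the bound 2 |x| + 5.\<close>

lemma continuous_curve_onto:
  obtains g :: "real \<Rightarrow> 'a::euclidean_space"
  where "continuous_on UNIV g" "\<And>x. \<exists>s. \<bar>s\<bar> \<le> 2 * norm x + 5 \<and> g s = x"
proof -
  obtain idx :: "'a \<Rightarrow> nat" where idx: "bij_betw idx Basis {..<DIM('a)}"
    using ex_bij_betw_finite_nat[OF finite_Basis] by (auto simp: atLeast0LessThan)
  let ?N = "DIM('a)"
  define rad where "rad s = (s - osc s) / 2" for s
  define g :: "real \<Rightarrow> 'a" where
    "g s = (\<Sum>b\<in>Basis. (4 * rad s * (schoenberg ?N (idx b) s - 1/2)) *\<^sub>R b)" for s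
  have "continuous_on UNIV g"
    unfolding g_def rad_def by (intro continuous_intros continuous_osc continuous_schoenberg) auto
  moreover have "\<exists>s. \<bar>s\<bar> \<le> 2 * norm x + 5 \<and> g s = x" for x
  proof -
    define k where "k = nat \<lceil>norm x\<rceil> + 1"
    have k: "norm x \<le> k" "real k \<le> norm x + 2" "k \<ge> 1" 
      unfolding k_def by (simp_all add: of_nat_ceiling) linarith+
    have "bij_betw (inv_into Basis idx) {..<?N} Basis" by (rule bij_betw_inv_into[OF idx])
    \<comment> \<open>The coordinates of x are at most k, half of what the cube allows, so u stays
      in [1/4, 3/4], away from the excluded value 1.\<close>
    define u where "u i = (x \<bullet> inv_into Basis idx i) / (4 * k) + 1/2" for i
    have "0 \<le> u i \<and> u i < 1" if "i < ?N" for i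
    proof -
      have "inv_into Basis idx i \<in> Basis"
        using \<open>bij_betw (inv_into Basis idx) {..<?N} Basis\<close> that by (auto simp: bij_betw_def)
      then have "\<bar>x \<bullet> inv_into Basis idx i\<bar> \<le> k" using Basis_le_norm k(1) order_trans by blast
      then show ?thesis using k(3) by (auto simp: u_def field_simps abs_le_iff)
    qed
    then obtain r where r: "0 \<le> r" "r \<le> 1" "\<And>i. i < ?N \<Longrightarrow> schoenberg ?N i r = u i"
      using schoenberg_onto[of ?N u] by auto
    define s where "s = 2 * of_int (int k) + r"
    have sch: "schoenberg ?N i s = u i" if "i < ?N" for i
      unfolding s_def schoenberg_periodic by (rule r(3)[OF that])
    have rad: "rad s = k"
      unfolding rad_def s_def osc_periodic osc_eq[OF r(1,2)] by simp
    have "g s = (\<Sum>b\<in>Basis. (x \<bullet> b) *\<^sub>R b)"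
      unfolding g_def
    proof (intro sum.cong refl arg_cong2[of _ _ _ _ "(*\<^sub>R)"])
      fix b :: 'a assume b: "b \<in> Basis"
      have "idx b < ?N" "inv_into Basis idx (idx b) = b"
        using idx b by (auto simp: bij_betw_def)
      then show "4 * rad s * (schoenberg ?N (idx b) s - 1/2) = x \<bullet> b"
        using k(3) by (simp add: sch rad u_def)
    qed
    then have "g s = x" by (simp add: euclidean_representation)
    moreover have "\<bar>s\<bar> \<le> 2 * norm x + 5" using r k by (simp add: s_def)
    ultimately show ?thesis by blast
  qed
  ultimately show ?thesis by (rule that)
qed

section \<open>Integration against signed measures\<close>

lemma vector_measure_cong:
  assumes "\<And>S. S \<in> sets M \<Longrightarrow> \<nu> S = \<nu>' S"
  shows "vector_measure M \<nu> \<longleftrightarrow> vector_measure M \<nu>'"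
proof -
  have "vector_measure M \<nu>'" if "vector_measure M \<nu>" "\<And>S. S \<in> sets M \<Longrightarrow> \<nu> S = \<nu>' S" for \<nu> \<nu>' :: "'a set \<Rightarrow> 'b"
    unfolding vector_measure_def
  proof (intro allI impI)
    fix A :: "nat \<Rightarrow> 'a set" assume A: "range A \<subseteq> sets M" "disjoint_family A"
    then have "(\<lambda>i. \<nu> (A i)) sums \<nu> (\<Union>i. A i)"
      using that(1) unfolding vector_measure_def by blast
    moreover have "\<nu> (A i) = \<nu>' (A i)" for i using A by (intro that(2)) auto
    moreover have "\<nu> (\<Union>i. A i) = \<nu>' (\<Union>i. A i)" using A by (intro that(2)) auto
    ultimately show "(\<lambda>i. \<nu>' (A i)) sums \<nu>' (\<Union>i. A i)" by simp
  qed
  with assms show ?thesis by metis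
qed

section \<open>Jordan decomposition of signed measures\<close>

lemma vector_measure_Un:
  assumes \<nu>: "vector_measure M \<nu>" and S: "B \<in> sets M" "C \<in> sets M" "B \<inter> C = {}"
  shows "\<nu> (B \<union> C) = \<nu> B + \<nu> C"
proof -
  have "range (binaryset B C) \<subseteq> sets M" using S by (auto simp: binaryset_def)
  moreover have "disjoint_family (binaryset B C)"
    using S by (auto simp: disjoint_family_on_def binaryset_def)
  ultimately have "(\<lambda>i. \<nu> (binaryset B C i)) sums \<nu> (\<Union>i. binaryset B C i)"
    using \<nu> unfolding vector_measure_def by blast
  moreover have "(\<lambda>i. \<nu> (binaryset B C i)) sums (\<nu> B + \<nu> C)"
    using sums_finite[of "{0, 1}" "\<lambda>i. \<nu> (binaryset B C i)"] vector_measure_empty[OF \<nu>]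
    by (auto simp: binaryset_def)
  ultimately show ?thesis using sums_unique2 by (fastforce simp: UN_binaryset_eq)
qed

text \<open>Additivity gives -\<nu>(B) = \<nu>(S - B) - \<nu>(S), and S - B is again a subset of S,
  so the first term is at most the positive part of S.\<close>

lemma jordan_neg_le:
  assumes \<nu>: "vector_measure M \<nu>" and S: "S \<in> sets M" and fin: "emeasure (jordan_pos M \<nu>) S < \<infinity>"
  shows "emeasure (jordan_neg M \<nu>) S \<le> ennreal (measure (jordan_pos M \<nu>) S - \<nu> S)"
    and "\<nu> S \<le> measure (jordan_pos M \<nu>) S"
proof -
  have vm: "vector_measure M (\<lambda>S. - \<nu> S)"
    using \<nu> by (simp add: vector_measure_def sums_minus)
  have up: "\<nu> B \<le> measure (jordan_pos M \<nu>) S" if "B \<in> sets M" "B \<subseteq> S" for B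
  proof -
    have "ennreal (\<nu> B) \<le> emeasure (jordan_pos M \<nu>) S"
      unfolding emeasure_jordan_pos[OF \<nu> S] using that by (intro SUP_upper) auto
    also have "\<dots> = ennreal (measure (jordan_pos M \<nu>) S)"
      using fin by (intro emeasure_eq_ennreal_measure) auto
    finally show ?thesis by (simp add: ennreal_le_iff)
  qed
  from up[OF S] show "\<nu> S \<le> measure (jordan_pos M \<nu>) S" by simp
  have "- \<nu> B \<le> measure (jordan_pos M \<nu>) S - \<nu> S" if B: "B \<in> sets M" "B \<subseteq> S" for B
  proof -
    have "\<nu> S = \<nu> (B \<union> (S - B))" using B by (intro arg_cong[of _ _ \<nu>]) auto
    also have "\<dots> = \<nu> B + \<nu> (S - B)" using B S by (intro vector_measure_Un[OF \<nu>]) auto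
    finally show ?thesis using up[of "S - B"] B S by auto
  qed
  then show "emeasure (jordan_neg M \<nu>) S \<le> ennreal (measure (jordan_pos M \<nu>) S - \<nu> S)"
    unfolding jordan_neg_def emeasure_jordan_pos[OF vm S] by (intro SUP_least ennreal_leI) auto
qed

text \<open>One inequality is \<open>jordan_neg_le\<close> for \<nu>; applied to -\<nu>, with the
  parts exchanged, it gives the reverse one. Finiteness of the negative part comes from the
  first.\<close>

lemma jordan_decomposition:
  assumes \<nu>: "vector_measure M \<nu>" and S: "S \<in> sets M" and fin: "emeasure (jordan_pos M \<nu>) S < \<infinity>"
  shows "\<nu> S = measure (jordan_pos M \<nu>) S - measure (jordan_neg M \<nu>) S"
proof -
  have vm: "vector_measure M (\<lambda>S. - \<nu> S)"
    using \<nu> by (simp add: vector_measure_def sums_minus)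
  have nn: "jordan_neg M (\<lambda>S. - \<nu> S) = jordan_pos M \<nu>"
    by (simp add: jordan_neg_def)
  note le = jordan_neg_le[OF \<nu> S fin]
  have fin': "emeasure (jordan_neg M \<nu>) S < \<infinity>"
    using le(1) by (rule order.strict_trans1) simp
  then have em: "emeasure (jordan_neg M \<nu>) S = ennreal (measure (jordan_neg M \<nu>) S)"
    by (intro emeasure_eq_ennreal_measure) auto
  have "measure (jordan_neg M \<nu>) S \<le> measure (jordan_pos M \<nu>) S - \<nu> S"
    using le unfolding em by (simp add: ennreal_le_iff)
  moreover
  have le': "emeasure (jordan_pos M \<nu>) S \<le> ennreal (measure (jordan_neg M \<nu>) S + \<nu> S)"
    "- \<nu> S \<le> measure (jordan_neg M \<nu>) S"
    using jordan_neg_le[OF vm S] fin' unfolding nn by (simp_all add: jordan_neg_def)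
  have em': "emeasure (jordan_pos M \<nu>) S = ennreal (measure (jordan_pos M \<nu>) S)"
    using fin by (intro emeasure_eq_ennreal_measure) auto
  have "measure (jordan_pos M \<nu>) S \<le> measure (jordan_neg M \<nu>) S + \<nu> S"
    using le' unfolding em' by (simp add: ennreal_le_iff)
  ultimately show ?thesis by simp
qed

section \<open>Linear relations between measures and their integrals\<close>

lemma integral_simple_function_finite_measure:
  fixes s :: "'a \<Rightarrow> real"
  assumes "finite_measure N" "simple_function N s"
  shows "integral\<^sup>L N s = (\<Sum>y\<in>s ` space N. y * measure N (s -` {y} \<inter> space N))" "integrable N s"
proof -
  interpret finite_measure N by fact
  have m: "s -` {y} \<inter> space N \<in> sets N" for y by (rule simple_functionD[OF assms(2)])
  have rep: "s x = (\<Sum>y\<in>s ` space N. y * indicator (s -` {y} \<inter> space N) x)" if "x \<in> space N" for x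
    by (rule trans[OF simple_function_indicator_representation_banach[OF assms(2) that]])
       (simp add: mult.commute)
  have ind: "integrable N (\<lambda>x. y * indicator (s -` {y} \<inter> space N) x)" for y :: real
    using m[of y] by (intro integrable_mult_right integrable_real_indicator) (simp_all add: less_top[symmetric])
  have int: "integrable N (\<lambda>x. \<Sum>y\<in>s ` space N. y * indicator (s -` {y} \<inter> space N) x)"
    by (intro Bochner_Integration.integrable_sum ind)
  show "integrable N s"
    by (rule Bochner_Integration.integrable_cong[OF refl rep, THEN iffD2, OF _ int])
  have "integral\<^sup>L N s = integral\<^sup>L N (\<lambda>x. \<Sum>y\<in>s ` space N. y * indicator (s -` {y} \<inter> space N) x)"
    by (intro Bochner_Integration.integral_cong rep refl)
  also have "\<dots> = (\<Sum>y\<in>s ` space N. integral\<^sup>L N (\<lambda>x. y * indicator (s -` {y} \<inter> space N) x))"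
    by (rule Bochner_Integration.integral_sum) (rule ind)
  also have "\<dots> = (\<Sum>y\<in>s ` space N. y * measure N (s -` {y} \<inter> space N))"
    using m by (intro sum.cong refl) (simp add: Int_assoc)
  finally show "integral\<^sup>L N s = (\<Sum>y\<in>s ` space N. y * measure N (s -` {y} \<inter> space N))" .
qed

lemma finite_measure_integrable_one:
  "integrable N (\<lambda>_. 1 :: real) \<Longrightarrow> finite_measure N"
  by (intro finite_measureI) (simp add: integrable_iff_bounded)

lemma tendsto_sum_list:
  fixes f :: "'b \<Rightarrow> 'a \<Rightarrow> 'c::topological_monoid_add"
  shows "(\<And>x. x \<in> set xs \<Longrightarrow> ((\<lambda>i. f i x) \<longlongrightarrow> g x) F) \<Longrightarrow> ((\<lambda>i. \<Sum>x\<leftarrow>xs. f i x) \<longlongrightarrow> (\<Sum>x\<leftarrow>xs. g x)) F"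
  by (induction xs) (auto intro: tendsto_add)

text \<open>The relation extends from sets to simple functions by linearity. One sequence of simple
  functions bounded by 2 |f| serves all measures of the list, so dominated convergence carries the
  relation to f.\<close>

lemma integral_combination_zero:
  fixes f :: "'a \<Rightarrow> real"
  assumes ms: "\<And>c N. (c, N) \<in> set ms \<Longrightarrow> finite_measure N \<and> sets N = sets M \<and> integrable N f"
    and zero: "\<And>S. S \<in> sets M \<Longrightarrow> (\<Sum>(c, N)\<leftarrow>ms. c * measure N S) = 0"
  shows "(\<Sum>(c, N)\<leftarrow>ms. c * integral\<^sup>L N f) = 0"
proof (cases "ms = []")
  case False
  then obtain c0 N0 where N0: "(c0, N0) \<in> set ms" by (cases ms) auto
  have "f \<in> borel_measurable N0" using ms[OF N0] by auto
  moreover have "sets N0 = sets M" using ms[OF N0] by auto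
  ultimately have f: "f \<in> borel_measurable M" by (simp cong: measurable_cong_sets)
  obtain s where s: "\<And>i. simple_function M (s i)" "\<And>x. x \<in> space M \<Longrightarrow> (\<lambda>i. s i x) \<longlonglongrightarrow> f x"
    "\<And>i x. x \<in> space M \<Longrightarrow> dist (s i x) 0 \<le> 2 * dist (f x) 0"
    using borel_measurable_implies_sequence_metric[OF f, of 0] by blast
  have N: "space N = space M" "simple_function N (s i)" if "(c, N) \<in> set ms" for c N i
  proof -
    have "sets N = sets M" using ms[OF that] by simp
    then show "space N = space M" "simple_function N (s i)"
      using s(1)[of i] by (auto simp: simple_function_def dest: sets_eq_imp_space_eq)
  qed
  have lim: "(\<lambda>i. integral\<^sup>L N (s i)) \<longlonglongrightarrow> integral\<^sup>L N f" if "(c, N) \<in> set ms" for c N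
  proof (rule integral_dominated_convergence[where w = "\<lambda>x. 2 * \<bar>f x\<bar>"])
    show "f \<in> borel_measurable N" "integrable N (\<lambda>x. 2 * \<bar>f x\<bar>)" using ms[OF that] by auto
    show "s i \<in> borel_measurable N" for i
      using integral_simple_function_finite_measure(2)[OF _ N(2)[OF that]] ms[OF that] by auto
    show "AE x in N. (\<lambda>i. s i x) \<longlonglongrightarrow> f x" using s(2) N(1)[OF that] by (intro AE_I2) simp
    show "AE x in N. norm (s i x) \<le> 2 * \<bar>f x\<bar>" for i using s(3) N(1)[OF that] by (intro AE_I2) (simp add: dist_real_def)
  qed
  have "(\<Sum>(c, N)\<leftarrow>ms. c * integral\<^sup>L N (s i)) = 0" for i
  proof -
    let ?Y = "s i ` space M" and ?A = "\<lambda>y. s i -` {y} \<inter> space M"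
    have "(\<Sum>(c, N)\<leftarrow>ms. c * integral\<^sup>L N (s i)) = (\<Sum>(c, N)\<leftarrow>ms. \<Sum>y\<in>?Y. y * (c * measure N (?A y)))"
    proof (intro arg_cong[of _ _ sum_list] map_cong refl, clarify)
      fix c N assume cN: "(c, N) \<in> set ms"
      show "c * integral\<^sup>L N (s i) = (\<Sum>y\<in>?Y. y * (c * measure N (?A y)))"
        using integral_simple_function_finite_measure(1)[OF _ N(2)[OF cN, of i]] ms[OF cN] N(1)[OF cN]
        by (simp add: sum_distrib_left mult_ac)
    qed
    also have "\<dots> = (\<Sum>y\<in>?Y. y * (\<Sum>(c, N)\<leftarrow>ms. c * measure N (?A y)))"
      by (induction ms) (auto simp: sum.distrib distrib_left)
    also have "\<dots> = 0"
      using s(1)[of i] by (intro sum.neutral ballI) (simp add: zero simple_functionD)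
    finally show ?thesis .
  qed
  moreover have "(\<lambda>i. \<Sum>(c, N)\<leftarrow>ms. c * integral\<^sup>L N (s i)) \<longlonglongrightarrow> (\<Sum>(c, N)\<leftarrow>ms. c * integral\<^sup>L N f)"
    by (intro tendsto_sum_list) (auto intro!: tendsto_intros lim)
  ultimately show ?thesis by (simp add: LIMSEQ_const_iff)
qed simp

text \<open>Domination on sets passes to simple functions below f, hence to the supremum of their
  integrals. This transfers integrability to Jordan parts.\<close>

lemma nn_integral_le_combination:
  fixes f :: "'a \<Rightarrow> ennreal"
  assumes A: "sets A = sets M" and ms: "\<And>c N. (c, N) \<in> set ms \<Longrightarrow> sets N = sets M"
    and le: "\<And>S. S \<in> sets M \<Longrightarrow> emeasure A S \<le> (\<Sum>(c, N)\<leftarrow>ms. ennreal \<bar>c\<bar> * emeasure N S)"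
  shows "(\<integral>\<^sup>+x. f x \<partial>A) \<le> (\<Sum>(c, N)\<leftarrow>ms. ennreal \<bar>c\<bar> * (\<integral>\<^sup>+x. f x \<partial>N))"
  unfolding nn_integral_def[of A]
proof (rule SUP_least)
  fix g assume "g \<in> {g. simple_function A g \<and> g \<le> f}"
  then have g: "simple_function A g" "g \<le> f" by auto
  have sp: "space A = space M" using A by (rule sets_eq_imp_space_eq)
  have gm: "simple_function M g" using g(1) A sp by (simp add: simple_function_def)
  let ?S = "\<lambda>y. g -` {y} \<inter> space M"
  have "integral\<^sup>S A g = (\<Sum>y\<in>g ` space M. y * emeasure A (?S y))"
    by (simp add: simple_integral_def sp)
  also have "\<dots> \<le> (\<Sum>y\<in>g ` space M. y * (\<Sum>(c, N)\<leftarrow>ms. ennreal \<bar>c\<bar> * emeasure N (?S y)))"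
    by (intro sum_mono mult_left_mono le simple_functionD[OF gm]) auto
  also have "\<dots> = (\<Sum>(c, N)\<leftarrow>ms. ennreal \<bar>c\<bar> * (\<Sum>y\<in>g ` space M. y * emeasure N (?S y)))"
    by (induction ms) (auto simp: sum.distrib distrib_left sum_distrib_left mult_ac)
  also have "\<dots> \<le> (\<Sum>(c, N)\<leftarrow>ms. ennreal \<bar>c\<bar> * (\<integral>\<^sup>+x. f x \<partial>N))"
  proof (intro sum_list_mono, clarify)
    fix c N assume "(c, N) \<in> set ms"
    then have N: "sets N = sets M" using ms by blast
    then have sp: "space N = space M" by (rule sets_eq_imp_space_eq)
    have "simple_function N g" using gm N sp by (simp add: simple_function_def)
    then have "(\<Sum>y\<in>g ` space M. y * emeasure N (?S y)) = (\<integral>\<^sup>+x. g x \<partial>N)"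
      by (simp add: nn_integral_eq_simple_integral simple_integral_def sp)
    also have "\<dots> \<le> (\<integral>\<^sup>+x. f x \<partial>N)" using g(2) by (intro nn_integral_mono) (simp add: le_fun_def)
    finally show "ennreal \<bar>c\<bar> * (\<Sum>y\<in>g ` space M. y * emeasure N (?S y)) \<le> ennreal \<bar>c\<bar> * (\<integral>\<^sup>+x. f x \<partial>N)"
      by (rule mult_left_mono) simp
  qed
  finally show "integral\<^sup>S A g \<le> (\<Sum>(c, N)\<leftarrow>ms. ennreal \<bar>c\<bar> * (\<integral>\<^sup>+x. f x \<partial>N))" .
qed

text \<open>For a subset B of S, \<nu>(B) is at most the combination at B, and this at most the
  combination at S, because the coefficients |c| make it monotone.\<close>

lemma jordan_pos_combination:
  assumes ms: "\<And>c N. (c, N) \<in> set ms \<Longrightarrow> finite_measure N \<and> sets N = sets M"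
    and \<nu>: "\<And>S. S \<in> sets M \<Longrightarrow> \<nu> S \<le> (\<Sum>(c, N)\<leftarrow>ms. \<bar>c\<bar> * measure N S)"
    and vm: "vector_measure M \<nu>" and S: "S \<in> sets M"
  shows "emeasure (jordan_pos M \<nu>) S \<le> (\<Sum>(c, N)\<leftarrow>ms. ennreal \<bar>c\<bar> * emeasure N S)"
  unfolding emeasure_jordan_pos[OF vm S]
proof (rule SUP_least)
  fix B assume "B \<in> {B \<in> sets M. B \<subseteq> S}"
  then have B: "B \<in> sets M" "B \<subseteq> S" by auto
  have "\<nu> B \<le> (\<Sum>(c, N)\<leftarrow>ms. \<bar>c\<bar> * measure N S)"
  proof (rule order_trans[OF \<nu>[OF B(1)] sum_list_mono], clarify)
    fix c N assume "(c, N) \<in> set ms"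
    then interpret N: finite_measure N using ms by auto
    have "sets N = sets M" using ms \<open>(c, N) \<in> set ms\<close> by auto
    then have "measure N B \<le> measure N S" using B S by (intro N.finite_measure_mono) auto
    then show "\<bar>c\<bar> * measure N B \<le> \<bar>c\<bar> * measure N S" by (intro mult_left_mono) auto
  qed
  then have "ennreal (\<nu> B) \<le> ennreal (\<Sum>(c, N)\<leftarrow>ms. \<bar>c\<bar> * measure N S)" by (rule ennreal_leI)
  also have "\<dots> = (\<Sum>(c, N)\<leftarrow>ms. ennreal \<bar>c\<bar> * emeasure N S)"
    using ms
  proof (induction ms)
    case (Cons p ms)
    obtain c N where p: "p = (c, N)" by (cases p)
    then interpret N: finite_measure N using Cons.prems by auto
    have "0 \<le> (\<Sum>(c, N)\<leftarrow>ms. \<bar>c\<bar> * measure N S)" by (rule sum_list_nonneg) auto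
    moreover have "ennreal (\<Sum>(c, N)\<leftarrow>ms. \<bar>c\<bar> * measure N S) = (\<Sum>(c, N)\<leftarrow>ms. ennreal \<bar>c\<bar> * emeasure N S)"
      using Cons by auto
    ultimately show ?case
      by (simp add: p ennreal_plus ennreal_mult N.emeasure_eq_measure)
  qed simp
  finally show "ennreal (\<nu> B) \<le> (\<Sum>(c, N)\<leftarrow>ms. ennreal \<bar>c\<bar> * emeasure N S)" .
qed

lemma vector_measure_combination:
  assumes ms: "\<And>c N. (c, N) \<in> set ms \<Longrightarrow> finite_measure N \<and> sets N = sets M"
  shows "vector_measure M (\<lambda>S. \<Sum>(c, N)\<leftarrow>ms. c * measure N S)"
  using ms
proof (induction ms)
  case Nil
  then show ?case by (simp add: vector_measure_def)
next
  case (Cons p ms)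
  obtain c N where p: "p = (c, N)" by (cases p)
  have N: "finite_measure N" "sets N = sets M" using Cons.prems p by auto
  have "vector_measure N (measure N)" by (rule vector_measure_measure[OF N(1)])
  then have v: "vector_measure M (measure N)" unfolding vector_measure_def N(2) .
  have "vector_measure M (\<lambda>S. \<Sum>(c, N)\<leftarrow>ms. c * measure N S)" using Cons by auto
  with v show ?case unfolding vector_measure_def p by (auto intro!: sums_add sums_mult)
qed

lemma integrable_le_combination:
  fixes f :: "'a \<Rightarrow> real"
  assumes A: "sets A = sets M" and ms: "\<And>c N. (c, N) \<in> set ms \<Longrightarrow> sets N = sets M \<and> integrable N f"
    and f: "f \<in> borel_measurable M"
    and le: "\<And>S. S \<in> sets M \<Longrightarrow> emeasure A S \<le> (\<Sum>(c, N)\<leftarrow>ms. ennreal \<bar>c\<bar> * emeasure N S)"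
  shows "integrable A f"
proof (rule integrableI_bounded)
  show "f \<in> borel_measurable A" using f A by (simp cong: measurable_cong_sets)
  have "(\<integral>\<^sup>+x. norm (f x) \<partial>A) \<le> (\<Sum>(c, N)\<leftarrow>ms. ennreal \<bar>c\<bar> * (\<integral>\<^sup>+x. norm (f x) \<partial>N))"
    using ms by (intro nn_integral_le_combination[OF A _ le]) auto
  also have "\<dots> < \<infinity>"
    using ms
  proof (induction ms)
    case (Cons p ms)
    obtain c N where p: "p = (c, N)" by (cases p)
    have "(\<integral>\<^sup>+x. norm (f x) \<partial>N) < \<infinity>" using Cons.prems p by (auto simp: integrable_iff_bounded)
    then have "ennreal \<bar>c\<bar> * (\<integral>\<^sup>+x. norm (f x) \<partial>N) < \<infinity>" by (simp add: ennreal_mult_less_top)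
    moreover have "(\<Sum>(c, N)\<leftarrow>ms. ennreal \<bar>c\<bar> * (\<integral>\<^sup>+x. norm (f x) \<partial>N)) < \<infinity>" using Cons by auto
    ultimately show ?case by (simp add: p)
  qed simp
  finally show "(\<integral>\<^sup>+x. ennreal (norm (f x)) \<partial>A) < \<infinity>" .
qed

text \<open>Both Jordan parts lie below the combination with coefficients |c|, so they are finite
  and integrate f. Prepending them with coefficients -1 and 1 to the list gives a combination that
  vanishes on all sets, and \<open>integral_combination_zero\<close> yields the integral.\<close>

theorem signed_integral_combination:
  fixes f :: "'a \<Rightarrow> real"
  assumes ms: "\<And>c N. (c, N) \<in> set ms \<Longrightarrow> finite_measure N \<and> sets N = sets M \<and> integrable N f"
    and \<nu>: "\<And>S. S \<in> sets M \<Longrightarrow> \<nu> S = (\<Sum>(c, N)\<leftarrow>ms. c * measure N S)"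
    and f: "f \<in> borel_measurable M"
  shows "signed_integrable M \<nu> f" "signed_integral M \<nu> f = (\<Sum>(c, N)\<leftarrow>ms. c * integral\<^sup>L N f)"
proof -
  have ms': "\<And>c N. (c, N) \<in> set ms \<Longrightarrow> finite_measure N \<and> sets N = sets M" using ms by blast
  have vm: "vector_measure M \<nu>"
    by (rule vector_measure_cong[THEN iffD2, OF \<nu> vector_measure_combination[OF ms']])
  have vm': "vector_measure M (\<lambda>S. - \<nu> S)" using vm by (simp add: vector_measure_def sums_minus)
  have abs: "\<bar>\<nu> S\<bar> \<le> (\<Sum>(c, N)\<leftarrow>ms. \<bar>c\<bar> * measure N S)" if "S \<in> sets M" for S
  proof -
    have "\<bar>\<Sum>(c, N)\<leftarrow>ms. c * measure N S\<bar> \<le> (\<Sum>(c, N)\<leftarrow>ms. \<bar>c\<bar> * measure N S)"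
      by (induction ms) (auto simp: abs_mult intro!: order_trans[OF abs_triangle_ineq] add_mono)
    then show ?thesis by (simp only: \<nu>[OF that])
  qed
  have le: "emeasure (jordan_pos M \<nu>) S \<le> (\<Sum>(c, N)\<leftarrow>ms. ennreal \<bar>c\<bar> * emeasure N S)"
    if "S \<in> sets M" for S using that abs by (intro jordan_pos_combination ms' vm) (auto simp: abs_le_iff)
  have le': "emeasure (jordan_neg M \<nu>) S \<le> (\<Sum>(c, N)\<leftarrow>ms. ennreal \<bar>c\<bar> * emeasure N S)"
    if "S \<in> sets M" for S
    unfolding jordan_neg_def using that abs by (intro jordan_pos_combination ms' vm') (auto simp: abs_le_iff)
  have int: "integrable (jordan_pos M \<nu>) g \<and> integrable (jordan_neg M \<nu>) g"
    if "\<And>c N. (c, N) \<in> set ms \<Longrightarrow> integrable N g" "g \<in> borel_measurable M" for g :: "'a \<Rightarrow> real"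
  proof
    have "sets N = sets M \<and> integrable N g" if "(c, N) \<in> set ms" for c N
      using ms'[OF that] \<open>\<And>c N. (c, N) \<in> set ms \<Longrightarrow> integrable N g\<close>[OF that] by blast
    then show "integrable (jordan_pos M \<nu>) g" "integrable (jordan_neg M \<nu>) g"
      using integrable_le_combination[OF sets_jordan_pos _ that(2) le]
        integrable_le_combination[OF sets_jordan_neg _ that(2) le'] by blast+
  qed
  show sint: "signed_integrable M \<nu> f"
    unfolding signed_integrable_def using ms f by (intro int) auto
  have "integrable (jordan_pos M \<nu>) (\<lambda>_. 1 :: real) \<and> integrable (jordan_neg M \<nu>) (\<lambda>_. 1 :: real)"
    using ms' finite_measure.integrable_const by (intro int borel_measurable_const) blast+
  then have fm: "finite_measure (jordan_pos M \<nu>)" "finite_measure (jordan_neg M \<nu>)"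
    by (blast intro: finite_measure_integrable_one)+
  have "(\<Sum>(c, N)\<leftarrow>(-1, jordan_pos M \<nu>) # (1, jordan_neg M \<nu>) # ms. c * integral\<^sup>L N f) = 0"
  proof (rule integral_combination_zero)
    fix c N assume "(c, N) \<in> set ((-1, jordan_pos M \<nu>) # (1, jordan_neg M \<nu>) # ms)"
    then show "finite_measure N \<and> sets N = sets M \<and> integrable N f"
      using ms fm sint by (auto simp: signed_integrable_def)
  next
    fix S assume S: "S \<in> sets M"
    have "emeasure (jordan_pos M \<nu>) S < \<infinity>"
      using finite_measure.emeasure_finite[OF fm(1), of S] by (simp add: less_top)
    from jordan_decomposition[OF vm S this] \<nu>[OF S]
    show "(\<Sum>(c, N)\<leftarrow>(-1, jordan_pos M \<nu>) # (1, jordan_neg M \<nu>) # ms. c * measure N S) = 0" by simp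
  qed
  then show "signed_integral M \<nu> f = (\<Sum>(c, N)\<leftarrow>ms. c * integral\<^sup>L N f)"
    by (simp add: signed_integral_def)
qed

text \<open>
  Integrability of the constant function makes the Jordan parts finite; countable additivity implies
  this, but all measures occurring below come with integrable polynomials.
\<close>

lemma finite_jordan:
  assumes "signed_integrable M \<nu> (\<lambda>_. 1)"
  shows "finite_measure (jordan_pos M \<nu>)" "finite_measure (jordan_neg M \<nu>)"
  using assms by (auto simp: signed_integrable_def intro: finite_measure_integrable_one)

text \<open>Each member of the family is replaced by its two Jordan parts with opposite
  coefficients. The resulting list represents \<rho>, although its entries need not add up to the
  Jordan parts of \<rho>.\<close>

lemma signed_integral_sum:
  fixes M :: "'a measure"
  assumes fin: "finite K" and vm: "\<And>k. k \<in> K \<Longrightarrow> vector_measure M (\<nu> k)"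
    and one: "\<And>k. k \<in> K \<Longrightarrow> signed_integrable M (\<nu> k) (\<lambda>_. 1)"
    and int: "\<And>k. k \<in> K \<Longrightarrow> signed_integrable M (\<nu> k) f"
    and f: "(f :: 'a \<Rightarrow> real) \<in> borel_measurable M"
    and \<rho>: "\<And>S. S \<in> sets M \<Longrightarrow> \<rho> S = (\<Sum>k\<in>K. c k * \<nu> k S)"
  shows "signed_integrable M \<rho> f" "signed_integral M \<rho> f = (\<Sum>k\<in>K. c k * signed_integral M (\<nu> k) f)"
proof -
  obtain ks where ks: "set ks = K" "distinct ks" using finite_distinct_list[OF fin] by blast
  define ms where "ms = concat (map (\<lambda>k. [(c k, jordan_pos M (\<nu> k)), (- c k, jordan_neg M (\<nu> k))]) ks)"
  have sm: "(\<Sum>(c, N)\<leftarrow>ms. c * h N) = (\<Sum>k\<in>K. c k * (h (jordan_pos M (\<nu> k)) - h (jordan_neg M (\<nu> k))))"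
    for h :: "'a measure \<Rightarrow> real"
  proof -
    have "(\<Sum>(c, N)\<leftarrow>ms. c * h N) = (\<Sum>k\<leftarrow>ks. c k * (h (jordan_pos M (\<nu> k)) - h (jordan_neg M (\<nu> k))))"
      unfolding ms_def by (induction ks) (auto simp: algebra_simps)
    then show ?thesis using ks by (simp add: sum_list_distinct_conv_sum_set)
  qed
  have 1: "finite_measure N \<and> sets N = sets M \<and> integrable N f" if "(c', N) \<in> set ms" for c' N
    using that ks(1) finite_jordan[OF one] int by (auto simp: ms_def signed_integrable_def)
  have 2: "\<rho> S = (\<Sum>(c, N)\<leftarrow>ms. c * measure N S)" if "S \<in> sets M" for S
  proof -
    have "\<nu> k S = measure (jordan_pos M (\<nu> k)) S - measure (jordan_neg M (\<nu> k)) S" if "k \<in> K" for k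
      using finite_measure.emeasure_finite[OF finite_jordan(1)[OF one[OF that]], of S]
      by (intro jordan_decomposition vm that \<open>S \<in> sets M\<close>) (simp add: less_top)
    then show ?thesis unfolding \<rho>[OF \<open>S \<in> sets M\<close>] sm by (intro sum.cong) auto
  qed
  show "signed_integrable M \<rho> f" by (rule signed_integral_combination(1)[OF 1 2 f])
  show "signed_integral M \<rho> f = (\<Sum>k\<in>K. c k * signed_integral M (\<nu> k) f)"
    using signed_integral_combination(2)[OF 1 2 f] by (simp only: sm signed_integral_def)
qed

text \<open>The positive and negative parts of D give two finite image measures with difference
  \<nu>. They need not be its Jordan parts, as X can send mass of opposite signs to the same
  place.\<close>

lemma signed_integral_image_density:
  fixes X :: "'b \<Rightarrow> 'a" and D :: "'b \<Rightarrow> real" and f :: "'a \<Rightarrow> real"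
  assumes X: "X \<in> measurable \<sigma> M" and D: "integrable \<sigma> D" and f: "f \<in> borel_measurable M"
    and fD: "integrable \<sigma> (\<lambda>s. f (X s) * D s)"
    and \<nu>: "\<And>S. S \<in> sets M \<Longrightarrow> \<nu> S = (\<integral>s. indicator S (X s) * D s \<partial>\<sigma>)"
  shows "signed_integrable M \<nu> f" "signed_integral M \<nu> f = (\<integral>s. f (X s) * D s \<partial>\<sigma>)"
proof -
  have [measurable]: "D \<in> borel_measurable \<sigma>" "X \<in> measurable \<sigma> M" "f \<in> borel_measurable M" using X D f by auto
  define P where "P h = distr (density \<sigma> (\<lambda>s. ennreal (h s))) M X" for h :: "'b \<Rightarrow> real"
  let ?p = "\<lambda>s. max 0 (D s)" and ?n = "\<lambda>s. max 0 (- D s)"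
  have int: "integrable (P h) g \<longleftrightarrow> integrable \<sigma> (\<lambda>s. g (X s) * h s)"
    "integral\<^sup>L (P h) g = (\<integral>s. g (X s) * h s \<partial>\<sigma>)"
    if [measurable]: "g \<in> borel_measurable M" "h \<in> borel_measurable \<sigma>" and h: "\<And>s. 0 \<le> h s"
    for g :: "'a \<Rightarrow> real" and h
  proof -
    show "integrable (P h) g \<longleftrightarrow> integrable \<sigma> (\<lambda>s. g (X s) * h s)"
      unfolding P_def by (subst integrable_distr_eq) (auto simp: integrable_density h mult.commute)
    show "integral\<^sup>L (P h) g = (\<integral>s. g (X s) * h s \<partial>\<sigma>)"
      unfolding P_def by (subst integral_distr) (auto simp: integral_density h mult.commute)
  qed
  have fin: "finite_measure (P h)" if "integrable \<sigma> h" "\<And>s. 0 \<le> h s" for h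
  proof (rule finite_measure_integrable_one)
    have [measurable]: "h \<in> borel_measurable \<sigma>" using that by auto
    show "integrable (P h) (\<lambda>_. 1 :: real)" using that by (subst int) auto
  qed
  have p: "integrable \<sigma> ?p" "integrable \<sigma> ?n" using D by auto
  have fp: "integrable \<sigma> (\<lambda>s. f (X s) * ?p s)" "integrable \<sigma> (\<lambda>s. f (X s) * ?n s)"
    by (rule Bochner_Integration.integrable_bound[OF fD];
        force simp: abs_mult intro!: AE_I2 mult_left_mono)+
  let ?ms = "[(1, P ?p), (-1, P ?n)]"
  have sP: "sets (P h) = sets M" for h by (simp add: P_def)
  have "integrable (P ?p) f" "integrable (P ?n) f"
    using fp by (subst int; simp)+
  then have 1: "finite_measure N \<and> sets N = sets M \<and> integrable N f" if "(c, N) \<in> set ?ms" for c N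
    using that fin[OF p(1)] fin[OF p(2)] sP by auto
  have diff: "g (X s) * ?p s - g (X s) * ?n s = g (X s) * D s" for g :: "'a \<Rightarrow> real" and s
    by (auto simp: max_def)
  have 2: "\<nu> S = (\<Sum>(c, N)\<leftarrow>?ms. c * measure N S)" if S: "S \<in> sets M" for S
  proof -
    have [measurable]: "S \<in> sets M" by (rule S)
    have m: "measure (P h) S = (\<integral>s. indicator S (X s) * h s \<partial>\<sigma>)"
      "integrable \<sigma> (\<lambda>s. indicator S (X s) * h s)" if "integrable \<sigma> h" "\<And>s. 0 \<le> h s" for h
    proof -
      interpret finite_measure "P h" by (rule fin[OF that])
      have S': "S \<in> sets (P h)" using S by (simp add: P_def)
      have "integrable (P h) (indicator S :: _ \<Rightarrow> real)" using S' by (simp add: less_top[symmetric])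
      then show "integrable \<sigma> (\<lambda>s. indicator S (X s) * h s)" using that by (subst (asm) int) auto
      have "S \<inter> space (P h) = S" using sets.sets_into_space[OF S'] by blast
      then have "measure (P h) S = integral\<^sup>L (P h) (indicator S)" by simp
      also have "\<dots> = (\<integral>s. indicator S (X s) * h s \<partial>\<sigma>)" using that by (intro int(2)) auto
      finally show "measure (P h) S = (\<integral>s. indicator S (X s) * h s \<partial>\<sigma>)" .
    qed
    have "(\<Sum>(c, N)\<leftarrow>?ms. c * measure N S) = (\<integral>s. indicator S (X s) * ?p s - indicator S (X s) * ?n s \<partial>\<sigma>)"
      using m[OF p(1)] m[OF p(2)] by simp
    then show ?thesis unfolding \<nu>[OF S] by (simp only: diff)
  qed
  show "signed_integrable M \<nu> f" by (rule signed_integral_combination(1)[OF 1 2 f])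
  have "signed_integral M \<nu> f = (\<Sum>(c, N)\<leftarrow>?ms. c * integral\<^sup>L N f)"
    by (rule signed_integral_combination(2)[OF 1 2 f])
  also have "\<dots> = (\<integral>s. f (X s) * ?p s - f (X s) * ?n s \<partial>\<sigma>)"
    using fp by (simp add: int)
  finally show "signed_integral M \<nu> f = (\<integral>s. f (X s) * D s \<partial>\<sigma>)" by (simp only: diff)
qed

section \<open>Limits of moments\<close>

lemma tight_second_moment:
  assumes \<mu>: "\<And>n. real_distribution (\<mu> n)"
    and int: "\<And>n. integrable (\<mu> n) (\<lambda>s. s\<^sup>2)" and B: "\<And>n. (\<integral>s. s\<^sup>2 \<partial>\<mu> n) \<le> B"
  shows "tight \<mu>"
  unfolding tight_def
proof (intro conjI allI impI)
  fix \<epsilon> :: real assume \<epsilon>: "0 < \<epsilon>"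
  interpret \<mu>: real_distribution "\<mu> n" for n by (rule \<mu>)
  have B0: "0 \<le> B" using B[of 0] by (rule order_trans[rotated]) simp
  \<comment> \<open>\<open>c\<close> exceeds 1, so c \<le> c^2, and B < c \<epsilon>; Chebyshev's
    bound B / c^2 is then below \<epsilon>.\<close>
  define c where "c = (B + 1) / \<epsilon> + 1"
  have c: "1 < c" using B0 \<epsilon> by (simp add: c_def)
  have "1 - \<epsilon> < measure (\<mu> n) {-c<..c}" for n
  proof -
    have "measure (\<mu> n) (- {-c<..c}) \<le> (\<integral>s. s\<^sup>2 / c\<^sup>2 \<partial>\<mu> n)"
    proof -
      have "measure (\<mu> n) (- {-c<..c}) = (\<integral>s. indicator (- {-c<..c}) s \<partial>\<mu> n)" by simp
      also have "\<dots> \<le> (\<integral>s. s\<^sup>2 / c\<^sup>2 \<partial>\<mu> n)"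
      proof (rule integral_mono)
        show "integrable (\<mu> n) (indicator (- {-c<..c}) :: real \<Rightarrow> real)"
          by (intro integrable_real_indicator) (auto simp: less_top[symmetric])
        show "integrable (\<mu> n) (\<lambda>s. s\<^sup>2 / c\<^sup>2)" using int by simp
        show "indicator (- {-c<..c}) s \<le> s\<^sup>2 / c\<^sup>2" for s
        proof (cases "s \<in> {-c<..c}")
          case False
          then have "\<bar>c\<bar> \<le> \<bar>s\<bar>" using c by auto
          then have "c\<^sup>2 \<le> s\<^sup>2" by (simp add: abs_le_square_iff)
          then show ?thesis using c False by simp
        qed simp
      qed
      finally show ?thesis .
    qed
    also have "\<dots> \<le> B / c\<^sup>2" using B[of n] by (simp add: divide_right_mono)
    also have "\<dots> < \<epsilon>"
    proof -
      have "B < c * \<epsilon>" using \<epsilon> by (simp add: c_def field_simps add_pos_pos)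
      also have "\<dots> \<le> c\<^sup>2 * \<epsilon>" using c \<epsilon> by (simp add: power2_eq_square)
      finally show ?thesis using c by (simp add: divide_less_eq mult.commute)
    qed
    finally have "measure (\<mu> n) (- {-c<..c}) < \<epsilon>" .
    moreover have "measure (\<mu> n) (- {-c<..c}) = 1 - measure (\<mu> n) {-c<..c}"
      using \<mu>.prob_compl[of "{-c<..c}" n] by (simp add: Compl_eq_Diff_UNIV)
    ultimately show ?thesis by simp
  qed
  moreover have "-c < c" using c by simp
  ultimately show "\<exists>a b. a < b \<and> (\<forall>n. 1 - \<epsilon> < measure (\<mu> n) {a<..b})" by blast
qed (rule \<mu>)

text \<open>A Fatou lemma for weak convergence: the truncations min(k, \<phi>) are bounded and
  continuous, so their integrals in the limit are at most B, and monotone convergence removes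
  k.\<close>

lemma weak_conv_nonneg_integrable:
  fixes \<phi> :: "real \<Rightarrow> real"
  assumes \<mu>: "\<And>n. real_distribution (\<mu> n)" and M: "real_distribution M" and conv: "weak_conv_m \<mu> M"
    and cont: "\<And>s. isCont \<phi> s" and nonneg: "\<And>s. 0 \<le> \<phi> s"
    and int: "\<And>n. integrable (\<mu> n) \<phi>" and B: "\<And>n. (\<integral>s. \<phi> s \<partial>\<mu> n) \<le> B"
  shows "integrable M \<phi>" "(\<integral>s. \<phi> s \<partial>M) \<le> B"
proof -
  interpret \<mu>: real_distribution "\<mu> n" for n by (rule \<mu>)
  interpret M: real_distribution M by (rule M)
  have [measurable]: "\<phi> \<in> borel_measurable borel"
    using cont by (intro borel_measurable_continuous_onI continuous_at_imp_continuous_on) auto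
  let ?f = "\<lambda>k s. min (real k) (\<phi> s)"
  have f: "\<bar>?f k s\<bar> \<le> k" for k s using nonneg[of s] by auto
  have fint: "integrable N (?f k)" if "real_distribution N" for k N
  proof -
    interpret N: real_distribution N by (rule that)
    show ?thesis using f[of k] by (intro N.integrable_const_bound[of _ "real k"]) auto
  qed
  have le: "(\<integral>s. ?f k s \<partial>M) \<le> B" for k
  proof (rule LIMSEQ_le_const2)
    show "(\<lambda>n. \<integral>s. ?f k s \<partial>\<mu> n) \<longlonglongrightarrow> (\<integral>s. ?f k s \<partial>M)"
      using f[of k] cont
      by (intro weak_conv_imp_integral_bdd_continuous_conv[OF \<mu> M conv, where B = "real k"]) (auto intro!: continuous_intros)
    have "(\<integral>s. ?f k s \<partial>\<mu> n) \<le> B" for n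
      by (rule order_trans[OF integral_mono[OF fint[OF \<mu>] int] B]) simp
    then show "\<exists>N. \<forall>n\<ge>N. (\<integral>s. ?f k s \<partial>\<mu> n) \<le> B" by blast
  qed
  have "incseq (\<lambda>k. \<integral>s. ?f k s \<partial>M)"
    by (intro incseq_SucI integral_mono fint M) auto
  then obtain l where l: "(\<lambda>k. \<integral>s. ?f k s \<partial>M) \<longlonglongrightarrow> l" "l \<le> B"
    using incseq_convergent[of _ B] le LIMSEQ_le_const2 by metis
  have lim: "(\<lambda>k. ?f k s) \<longlonglongrightarrow> \<phi> s" for s
  proof (rule tendsto_eventually)
    obtain k0 :: nat where "\<phi> s \<le> k0" using real_arch_simple by blast
    then show "\<forall>\<^sub>F k in sequentially. ?f k s = \<phi> s"
      by (auto simp: eventually_sequentially min_def intro!: exI[of _ k0])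
  qed
  have mono: "AE s in M. mono (\<lambda>k. ?f k s)" by (intro AE_I2 monoI) (auto simp: min_def)
  show "integrable M \<phi>"
    by (rule integrable_monotone_convergence[OF fint[OF M] mono _ l(1)]) (auto intro!: AE_I2 lim)
  show "(\<integral>s. \<phi> s \<partial>M) \<le> B"
    using integral_monotone_convergence[OF fint[OF M] mono _ l(1)] l(2) lim by auto
qed

text \<open>Bounded second moments of \<psi> give uniform integrability: cutting \<psi> off at R
  changes its integral by at most B / R, for all members of the sequence and for the limit, and the
  cut-off function is bounded and continuous.\<close>

lemma weak_conv_moment:
  fixes \<psi> :: "real \<Rightarrow> real"
  assumes \<mu>: "\<And>n. real_distribution (\<mu> n)" and M: "real_distribution M" and conv: "weak_conv_m \<mu> M"
    and cont: "\<And>s. isCont \<psi> s"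
    and int: "\<And>n. integrable (\<mu> n) (\<lambda>s. (\<psi> s)\<^sup>2)" and B: "\<And>n. (\<integral>s. (\<psi> s)\<^sup>2 \<partial>\<mu> n) \<le> B"
  shows "integrable M \<psi>" "(\<lambda>n. \<integral>s. \<psi> s \<partial>\<mu> n) \<longlonglongrightarrow> (\<integral>s. \<psi> s \<partial>M)"
proof -
  interpret \<mu>: real_distribution "\<mu> n" for n by (rule \<mu>)
  interpret M: real_distribution M by (rule M)
  have [measurable]: "\<psi> \<in> borel_measurable borel"
    using cont by (intro borel_measurable_continuous_onI continuous_at_imp_continuous_on) auto
  have M2: "integrable M (\<lambda>s. (\<psi> s)\<^sup>2)" "(\<integral>s. (\<psi> s)\<^sup>2 \<partial>M) \<le> B"
    using weak_conv_nonneg_integrable[OF \<mu> M conv, of "\<lambda>s. (\<psi> s)\<^sup>2" B] cont int B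
    by (auto intro!: continuous_intros)
  have I: "integrable N \<psi>" if "real_distribution N" "integrable N (\<lambda>s. (\<psi> s)\<^sup>2)" for N
  proof -
    interpret N: real_distribution N by (rule that)
    have "integrable N (\<lambda>s. 1 + (\<psi> s)\<^sup>2)" using that(2) by simp
    then show ?thesis
    proof (rule Bochner_Integration.integrable_bound)
      have "\<bar>t\<bar> \<le> 1 + t\<^sup>2" for t :: real
      proof -
        have "0 \<le> (\<bar>t\<bar> - 1/2)\<^sup>2" by simp
        then show ?thesis by (simp add: power2_diff power_divide)
      qed
      then show "AE s in N. norm (\<psi> s) \<le> norm (1 + (\<psi> s)\<^sup>2)" by (intro AE_I2) simp
    qed simp
  qed
  show IM: "integrable M \<psi>" by (rule I[OF M M2(1)])
  let ?t = "\<lambda>R s. max (- R) (min R (\<psi> s))"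
  have near: "\<bar>(\<integral>s. \<psi> s \<partial>N) - (\<integral>s. ?t R s \<partial>N)\<bar> \<le> B / R"
    if N: "real_distribution N" "integrable N (\<lambda>s. (\<psi> s)\<^sup>2)" "(\<integral>s. (\<psi> s)\<^sup>2 \<partial>N) \<le> B" and R: "R > 0" for N R
  proof -
    interpret N: real_distribution N by (rule N)
    have t: "integrable N (?t R)" using R by (intro N.integrable_const_bound[of _ R]) auto
    have "\<bar>(\<integral>s. \<psi> s \<partial>N) - (\<integral>s. ?t R s \<partial>N)\<bar> = \<bar>\<integral>s. \<psi> s - ?t R s \<partial>N\<bar>"
      using I[OF N(1,2)] t by simp
    also have "\<dots> \<le> (\<integral>s. \<bar>\<psi> s - ?t R s\<bar> \<partial>N)" by (rule integral_abs_bound)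
    also have "\<dots> \<le> (\<integral>s. (\<psi> s)\<^sup>2 / R \<partial>N)"
    proof (rule integral_mono)
      show "integrable N (\<lambda>s. \<bar>\<psi> s - ?t R s\<bar>)" using I[OF N(1,2)] t by simp
      show "integrable N (\<lambda>s. (\<psi> s)\<^sup>2 / R)" using N(2) by simp
      show "\<bar>\<psi> s - ?t R s\<bar> \<le> (\<psi> s)\<^sup>2 / R" for s
      proof (cases "\<bar>\<psi> s\<bar> \<le> R")
        case True
        then have "?t R s = \<psi> s" by auto
        then show ?thesis using R by simp
      next
        case False
        then have "\<bar>\<psi> s - ?t R s\<bar> \<le> \<bar>\<psi> s\<bar>" using R by (auto simp: min_def max_def)
        also have "\<bar>\<psi> s\<bar> * R \<le> \<bar>\<psi> s\<bar> * \<bar>\<psi> s\<bar>" using False by (intro mult_left_mono) auto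
        then have "\<bar>\<psi> s\<bar> \<le> (\<psi> s)\<^sup>2 / R" using R by (simp add: field_simps power2_eq_square)
        finally show ?thesis .
      qed
    qed
    also have "\<dots> \<le> B / R" using N(3) R by (simp add: divide_right_mono)
    finally show ?thesis .
  qed
  show "(\<lambda>n. \<integral>s. \<psi> s \<partial>\<mu> n) \<longlonglongrightarrow> (\<integral>s. \<psi> s \<partial>M)"
  proof (rule LIMSEQ_I)
    fix e :: real assume e: "0 < e"
    have B0: "0 \<le> B" using M2(2) by (rule order_trans[rotated]) simp
    \<comment> \<open>Two truncation errors below e / 3 and the convergence of the truncated
      integrals add up to e; B + 1 keeps R positive when B = 0.\<close>
    define R where "R = 3 * (B + 1) / e"
    have R: "R > 0" using e B0 by (simp add: R_def)
    have BR: "B / R < e / 3" using e B0 by (simp add: R_def field_simps)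
    have "(\<lambda>n. \<integral>s. ?t R s \<partial>\<mu> n) \<longlonglongrightarrow> (\<integral>s. ?t R s \<partial>M)"
      using R cont
      by (intro weak_conv_imp_integral_bdd_continuous_conv[OF \<mu> M conv, where B = R]) (auto intro!: continuous_intros)
    then obtain n0 where n0: "\<And>n. n \<ge> n0 \<Longrightarrow> norm ((\<integral>s. ?t R s \<partial>\<mu> n) - (\<integral>s. ?t R s \<partial>M)) < e / 3"
      using LIMSEQ_D[of _ _ "e/3"] e by fastforce
    have tri: "\<bar>a - b\<bar> < e" if "\<bar>a - a'\<bar> \<le> d" "\<bar>b - b'\<bar> \<le> d" "\<bar>a' - b'\<bar> < e / 3" "d < e / 3" for a b a' b' d :: real
      using that by linarith
    have "norm ((\<integral>s. \<psi> s \<partial>\<mu> n) - (\<integral>s. \<psi> s \<partial>M)) < e" if "n \<ge> n0" for n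
      using tri[OF near[OF \<mu>[of n] int B R] near[OF M M2 R] _ BR] n0[OF that] by simp
    then show "\<exists>n0. \<forall>n\<ge>n0. norm ((\<integral>s. \<psi> s \<partial>\<mu> n) - (\<integral>s. \<psi> s \<partial>M)) < e" by blast
  qed
qed

text \<open>The subsequence is extracted by tightness before p is fixed, so one limit distribution
  serves all p.\<close>

lemma moment_limit:
  fixes \<psi> :: "'p \<Rightarrow> real \<Rightarrow> real"
  assumes \<mu>: "\<And>n. real_distribution (\<mu> n)"
    and int: "\<And>n. integrable (\<mu> n) (\<lambda>s. s\<^sup>2)" and B: "\<And>n. (\<integral>s. s\<^sup>2 \<partial>\<mu> n) \<le> B"
    and cont: "\<And>p s. p \<in> P \<Longrightarrow> isCont (\<psi> p) s"
    and int\<psi>: "\<And>p n. p \<in> P \<Longrightarrow> integrable (\<mu> n) (\<lambda>s. (\<psi> p s)\<^sup>2)"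
    and B\<psi>: "\<And>p. p \<in> P \<Longrightarrow> \<exists>b. \<forall>n. (\<integral>s. (\<psi> p s)\<^sup>2 \<partial>\<mu> n) \<le> b"
    and lim: "\<And>p. p \<in> P \<Longrightarrow> (\<lambda>n. \<integral>s. \<psi> p s \<partial>\<mu> n) \<longlonglongrightarrow> l p"
  shows "\<exists>M. real_distribution M \<and> (\<forall>p\<in>P. integrable M (\<psi> p) \<and> (\<integral>s. \<psi> p s \<partial>M) = l p)"
proof -
  have "tight \<mu>" by (rule tight_second_moment[OF \<mu> int B])
  from tight_imp_convergent_subsubsequence[OF this, of id]
  obtain r M where r: "strict_mono r" and M: "real_distribution M" "weak_conv_m (\<mu> \<circ> id \<circ> r) M"
    by (auto simp: strict_mono_def)
  have conv: "weak_conv_m (\<lambda>n. \<mu> (r n)) M" using M(2) by (simp add: comp_def)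
  have "integrable M (\<psi> p) \<and> (\<integral>s. \<psi> p s \<partial>M) = l p" if p: "p \<in> P" for p
  proof -
    obtain b where b: "\<And>n. (\<integral>s. (\<psi> p s)\<^sup>2 \<partial>\<mu> n) \<le> b" using B\<psi>[OF p] by blast
    note w = weak_conv_moment[OF \<mu> M(1) conv cont[OF p] int\<psi>[OF p] b]
    have "(\<lambda>n. \<integral>s. \<psi> p s \<partial>\<mu> (r n)) \<longlonglongrightarrow> l p"
      using LIMSEQ_subseq_LIMSEQ[OF lim[OF p] r] by (simp add: comp_def)
    with w show ?thesis using LIMSEQ_unique by blast
  qed
  with M(1) show ?thesis by blast
qed

text \<open>The point measure lives on list positions and is pushed forward, so that repeated atoms
  add their weights.\<close>

lemma atomic_distribution:
  fixes cs :: "(real \<times> real) list"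
  assumes pos: "\<And>c s. (c, s) \<in> set cs \<Longrightarrow> 0 \<le> c" and one: "(\<Sum>(c, s)\<leftarrow>cs. c) = 1"
  shows "\<exists>\<mu>. real_distribution \<mu> \<and>
    (\<forall>f::real \<Rightarrow> real. f \<in> borel_measurable borel \<longrightarrow> integrable \<mu> f \<and> (\<integral>s. f s \<partial>\<mu>) = (\<Sum>(c, s)\<leftarrow>cs. c * f s))"
proof -
  let ?I = "{..<length cs}" and ?c = "\<lambda>i. fst (cs ! i)" and ?s = "\<lambda>i. snd (cs ! i)"
  have c: "0 \<le> ?c i" if "i \<in> ?I" for i using that pos[of "?c i" "?s i"] by auto
  have idx: "(\<Sum>(c, s)\<leftarrow>cs. h c s) = (\<Sum>i\<in>?I. h (?c i) (?s i))" for h :: "real \<Rightarrow> real \<Rightarrow> real"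
    by (simp add: sum_list_sum_nth atLeast0LessThan case_prod_beta)
  let ?P = "point_measure ?I ?c"
  define \<mu> where "\<mu> = distr ?P borel ?s"
  have s: "?s \<in> measurable ?P borel" by (simp add: point_measure_def)
  have "prob_space ?P"
  proof (rule prob_spaceI)
    have "emeasure ?P (space ?P) = (\<Sum>i\<in>?I. ennreal (?c i))"
      by (simp add: space_point_measure emeasure_point_measure_finite)
    also have "\<dots> = ennreal (\<Sum>i\<in>?I. ?c i)" using c by (intro sum_ennreal) auto
    also have "\<dots> = 1" using one idx[of "\<lambda>c s. c"] by simp
    finally show "emeasure ?P (space ?P) = 1" .
  qed
  then have "prob_space \<mu>" unfolding \<mu>_def by (rule prob_space.prob_space_distr) (rule s)
  then have "real_distribution \<mu>"
    by (simp add: real_distribution_def real_distribution_axioms_def \<mu>_def)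
  moreover have "integrable \<mu> f \<and> (\<integral>s. f s \<partial>\<mu>) = (\<Sum>(c, s)\<leftarrow>cs. c * f s)"
    if f: "f \<in> borel_measurable borel" for f :: "real \<Rightarrow> real"
  proof -
    have "integral\<^sup>L ?P (\<lambda>i. f (?s i)) = (\<Sum>i\<in>?I. ?c i *\<^sub>R f (?s i))"
      using c by (intro lebesgue_integral_point_measure_finite) auto
    moreover have "integrable ?P (\<lambda>i. f (?s i))" by (rule integrable_point_measure_finite) simp
    ultimately show ?thesis
      unfolding \<mu>_def idx[of "\<lambda>c s. c * f s"]
      by (simp add: integrable_distr_eq[OF s f] integral_distr[OF s f])
  qed
  ultimately show ?thesis by blast
qed

section \<open>The matrix moment problem\<close>

definition form_at :: "real^'n::finite \<Rightarrow> complex^'m::finite \<Rightarrow> ('n, 'm herm) mvpoly \<Rightarrow> real"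
  where "form_at x v p = herm_inner (mveval p x) (outer v)"

section \<open>Quadratic forms of matrix polynomials\<close>

lemma outer_scale: "outer (c *\<^sub>R v) = c\<^sup>2 *\<^sub>R outer v"
  by (simp add: herm_eq_iff outer.rep_eq scaleR_herm.rep_eq power2_eq_square)

lemma outer_zero [simp]: "outer 0 = 0"
  by (simp add: herm_eq_iff outer.rep_eq zero_herm.rep_eq)

lemma form_at_scale: "form_at x (c *\<^sub>R v) p = c\<^sup>2 * form_at x v p"
  by (simp add: form_at_def outer_scale herm_inner_scale_right)

lemma form_at_zero [simp]: "form_at x 0 p = 0"
  by (simp add: form_at_def linear_0[OF linear_herm_inner_right])

lemma linear_form_at: "linear (form_at x v)"
  unfolding form_at_def
  by (intro linearI) (simp_all add: mveval_add mveval_scale herm_inner_add_left herm_inner_scale_left)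

lemma form_at_single: "form_at x v (Poly_Mapping.single \<beta> A) = mpow x \<beta> * herm_inner A (outer v)"
  by (simp add: form_at_def mveval_single herm_inner_scale_left)

lemma form_at_expand:
  "form_at x v p = (\<Sum>\<beta>\<in>Poly_Mapping.keys p. mpow x \<beta> * herm_inner (Poly_Mapping.lookup p \<beta>) (outer v))"
  by (simp add: form_at_def mveval_def herm_inner_sum_left herm_inner_scale_left)

lemma pos_herm_polys_iff: "p \<in> pos_herm_polys \<longleftrightarrow> (\<forall>x v. 0 \<le> form_at x v p)"
  by (simp add: pos_herm_polys_def herm_psd_iff form_at_def)

lemma single_scale: "Poly_Mapping.single \<beta> (r *\<^sub>R A) = r *\<^sub>R Poly_Mapping.single \<beta> A"
  by (rule poly_mapping_eqI) (simp add: scaleR_poly_mapping.rep_eq lookup_single when_def)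

lemma linear_single: "linear (Poly_Mapping.single \<beta>)"
  by (intro linearI) (simp_all add: single_add single_scale)

text \<open>Basis monomials span the polynomials; convergence, integrability and equality of
  functionals can be settled on this countable family.\<close>

lemma linear_mvpoly_expand:
  fixes p :: "('n, 'm::{finite,linorder} herm) mvpoly" and T :: "('n, 'm herm) mvpoly \<Rightarrow> real"
  assumes T: "linear T"
  shows "T p = (\<Sum>\<beta>\<in>Poly_Mapping.keys p. \<Sum>i\<in>UNIV. \<Sum>j\<in>UNIV.
    herm_inner (Poly_Mapping.lookup p \<beta>) (herm_basis i j) * T (Poly_Mapping.single \<beta> (herm_basis i j)))"
proof -
  have "T p = (\<Sum>\<beta>\<in>Poly_Mapping.keys p. T (Poly_Mapping.single \<beta> (Poly_Mapping.lookup p \<beta>)))"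
    by (subst sum_monomials[of p, symmetric]) (rule linear_sum[OF T])
  also have "\<dots> = (\<Sum>\<beta>\<in>Poly_Mapping.keys p. \<Sum>i\<in>UNIV. \<Sum>j\<in>UNIV.
    herm_inner (Poly_Mapping.lookup p \<beta>) (herm_basis i j) * T (Poly_Mapping.single \<beta> (herm_basis i j)))"
  proof (intro sum.cong refl)
    fix \<beta> let ?A = "Poly_Mapping.lookup p \<beta>"
    have lin: "linear (\<lambda>A. T (Poly_Mapping.single \<beta> A))"
      using linear_compose[OF linear_single T] by (simp add: o_def)
    have "T (Poly_Mapping.single \<beta> ?A) = T (Poly_Mapping.single \<beta> (\<Sum>i\<in>UNIV. \<Sum>j\<in>UNIV. herm_inner ?A (herm_basis i j) *\<^sub>R herm_basis i j))"
      by (simp only: herm_basis_expansion[symmetric])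
    then show "T (Poly_Mapping.single \<beta> ?A) = (\<Sum>i\<in>UNIV. \<Sum>j\<in>UNIV. herm_inner ?A (herm_basis i j) * T (Poly_Mapping.single \<beta> (herm_basis i j)))"
      by (simp only: linear_sum[OF lin] linear_scale[OF lin] real_scaleR_def)
  qed
  finally show ?thesis .
qed

text \<open>Each monomial satisfies |x^\<beta>| \<le> 1 + x^(2\<beta>), and each coefficient is
  dominated by a multiple of the identity. This supplies the domination hypothesis of
  \<open>cone_approximation\<close>.\<close>

lemma form_at_dominated:
  fixes q :: "('n::finite, 'm::finite herm) mvpoly"
  shows "\<exists>h. \<forall>x v. \<bar>form_at x v q\<bar> \<le> form_at x v h"
proof -
  let ?b = "\<lambda>\<beta>. herm_bound (Poly_Mapping.lookup q \<beta>) *\<^sub>R (herm_id :: 'm herm)"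
  define h where "h = (\<Sum>\<beta>\<in>Poly_Mapping.keys q. Poly_Mapping.single 0 (?b \<beta>) + Poly_Mapping.single (\<beta> + \<beta>) (?b \<beta>))"
  have "\<bar>form_at x v q\<bar> \<le> form_at x v h" for x v
  proof -
    have "\<bar>form_at x v q\<bar> \<le> (\<Sum>\<beta>\<in>Poly_Mapping.keys q. \<bar>mpow x \<beta>\<bar> * \<bar>herm_inner (Poly_Mapping.lookup q \<beta>) (outer v)\<bar>)"
      unfolding form_at_expand by (rule order_trans[OF sum_abs]) (simp add: abs_mult)
    also have "\<dots> \<le> (\<Sum>\<beta>\<in>Poly_Mapping.keys q. (1 + mpow x \<beta> * mpow x \<beta>) * (herm_bound (Poly_Mapping.lookup q \<beta>) * (norm v)\<^sup>2))"
    proof (intro sum_mono mult_mono abs_herm_inner_outer_le)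
      show "\<bar>mpow x \<beta>\<bar> \<le> 1 + mpow x \<beta> * mpow x \<beta>" for \<beta>
      proof -
        have "0 \<le> (\<bar>mpow x \<beta>\<bar> - 1/2)\<^sup>2" by simp
        then show ?thesis by (simp add: power2_diff power_divide) (simp add: power2_eq_square)
      qed
    qed auto
    also have "\<dots> = form_at x v h"
      unfolding h_def linear_sum[OF linear_form_at]
      by (simp add: linear_add[OF linear_form_at] form_at_single mpow_add herm_inner_scale_left
          herm_inner_id_outer algebra_simps) (simp add: mpow_def)
    finally show ?thesis .
  qed
  then show ?thesis by blast
qed

text \<open>Stage n is accurate to 1 / (n + 1) on the basis monomials with all exponents at most n;
  each monomial belongs to all late stages. A nonnegative multiple of a form is again a form, with v
  rescaled, so plain sums suffice.\<close>

lemma atoms_limit: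
  fixes L :: "('n::finite, 'm::{finite,linorder} herm) mvpoly \<Rightarrow> real"
  assumes L: "linear L" and pos: "\<And>p. p \<in> pos_herm_polys \<Longrightarrow> 0 \<le> L p"
  shows "\<exists>ps :: nat \<Rightarrow> ((real^'n) \<times> ((complex, 'm) vec)) list. \<forall>p. (\<lambda>n. \<Sum>(x, v)\<leftarrow>ps n. form_at x v p) \<longlonglongrightarrow> L p"
proof -
  define E :: "(('n, 'm herm) mvpoly \<Rightarrow> real) set" where "E = range (\<lambda>(x, v). form_at x v)"
  define I :: "nat \<Rightarrow> (('n \<Rightarrow>\<^sub>0 nat) \<times> 'm \<times> 'm) set"
    where "I n = {\<beta>. \<forall>i. Poly_Mapping.lookup \<beta> i \<le> n} \<times> UNIV" for n
  let ?f = "\<lambda>(\<beta>, i, j). Poly_Mapping.single \<beta> (herm_basis i j) :: ('n, 'm herm) mvpoly"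
  have I: "finite (I n)" for n
    using finite_le_exponent[of "Abs_poly_mapping (\<lambda>_::'n. n)"] by (simp add: I_def)
  have "\<exists>es. set es \<subseteq> E \<and> (\<forall>k\<in>I n. \<bar>L (?f k) - (\<Sum>e\<leftarrow>es. e (?f k))\<bar> < 1 / Suc n)" for n
  proof (rule cone_approximation[OF L _ _ _ _ I])
    show "linear e" if "e \<in> E" for e using that by (auto simp: E_def linear_form_at)
    show "(\<lambda>p. c * e p) \<in> E" if "e \<in> E" "0 \<le> c" for e c
    proof -
      obtain x v where e: "e = form_at x v" using \<open>e \<in> E\<close> by (auto simp: E_def)
      have "(\<lambda>p. c * e p) = form_at x (sqrt c *\<^sub>R v)"
        using \<open>0 \<le> c\<close> by (simp add: e fun_eq_iff form_at_scale)
      then show ?thesis by (auto simp: E_def)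
    qed
    show "0 \<le> L p" if "\<And>e. e \<in> E \<Longrightarrow> 0 \<le> e p" for p
      using that by (intro pos) (auto simp: E_def pos_herm_polys_iff)
    show "\<exists>h. \<forall>e\<in>E. \<bar>e q\<bar> \<le> e h" for q
      using form_at_dominated[of q] by (auto simp: E_def)
  qed simp
  then obtain es where es: "\<And>n. set (es n) \<subseteq> E"
    "\<And>n k. k \<in> I n \<Longrightarrow> \<bar>L (?f k) - (\<Sum>e\<leftarrow>es n. e (?f k))\<bar> < 1 / Suc n" by metis
  have "\<exists>ps. es n = map (\<lambda>(x, v). form_at x v) ps" for n
    using es(1)[of n] unfolding E_def by (auto intro: ex_map_conv[THEN iffD2])
  then obtain ps where ps: "\<And>n. es n = map (\<lambda>(x, v). form_at x v) (ps n)" by metis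
  let ?T = "\<lambda>n p. \<Sum>(x, v)\<leftarrow>ps n. form_at x v p"
  have T: "linear (?T n)" for n
  proof (intro linearI)
    show "?T n (p + q) = ?T n p + ?T n q" for p q
      by (induction "ps n" rule: list.induct) (auto simp: linear_add[OF linear_form_at] case_prod_unfold sum_list_addf)
    show "?T n (r *\<^sub>R p) = r *\<^sub>R ?T n p" for r p
      by (simp add: linear_scale[OF linear_form_at] case_prod_unfold sum_list_const_mult)
  qed
  have lim: "(\<lambda>n. ?T n (?f (\<beta>, i, j))) \<longlonglongrightarrow> L (?f (\<beta>, i, j))" for \<beta> i j
  proof (rule LIMSEQ_I)
    fix r :: real assume r: "0 < r"
    obtain n0 where n0: "1 / Suc n0 < r" using r nat_approx_posE by blast
    let ?d = "Max (range (Poly_Mapping.lookup \<beta>))"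
    have "norm (?T n (?f (\<beta>, i, j)) - L (?f (\<beta>, i, j))) < r" if "n \<ge> max n0 ?d" for n
    proof -
      have "Poly_Mapping.lookup \<beta> k \<le> n" for k
        using that Max_ge[of "range (Poly_Mapping.lookup \<beta>)" "Poly_Mapping.lookup \<beta> k"] by auto
      then have "(\<beta>, i, j) \<in> I n" by (simp add: I_def)
      from es(2)[OF this] have "\<bar>L (?f (\<beta>, i, j)) - ?T n (?f (\<beta>, i, j))\<bar> < 1 / Suc n"
        by (simp add: ps o_def case_prod_unfold)
      also have "1 / Suc n \<le> 1 / Suc n0" using that by (simp add: frac_le)
      finally show ?thesis using n0 by (simp add: abs_minus_commute)
    qed
    then show "\<exists>n0. \<forall>n\<ge>n0. norm (?T n (?f (\<beta>, i, j)) - L (?f (\<beta>, i, j))) < r" by blast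
  qed
  have "(\<lambda>n. ?T n p) \<longlonglongrightarrow> L p" for p
    unfolding linear_mvpoly_expand[OF T, where p = p] linear_mvpoly_expand[OF L, where p = p]
    using lim by (intro tendsto_intros) auto
  then show ?thesis by blast
qed

lemma sum_list_divide_const: "(\<Sum>x\<leftarrow>xs. f x / c) = (\<Sum>x\<leftarrow>xs. f x) / (c :: real)"
  by (induction xs) (auto simp: add_divide_distrib)

text \<open>Atoms are normalised to \<open>\<parallel>v\<parallel> \<le> 1\<close>; the missing mass is put at \<open>v = 0\<close>, where all forms vanish.\<close>

lemma normalized_atoms_limit:
  fixes L :: "('n::finite, 'm::{finite,linorder} herm) mvpoly \<Rightarrow> real"
  assumes L: "linear L" and pos: "\<And>p. p \<in> pos_herm_polys \<Longrightarrow> 0 \<le> L p"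
  obtains C :: real and cs :: "nat \<Rightarrow> (real \<times> (real^'n) \<times> ((complex, 'm) vec)) list" and B :: real
  where "C > 0" "\<And>n c x v. (c, x, v) \<in> set (cs n) \<Longrightarrow> 0 \<le> c \<and> norm v \<le> 1"
    "\<And>n. (\<Sum>(c, x, v)\<leftarrow>cs n. c) = 1" "\<And>n. (\<Sum>(c, x, v)\<leftarrow>cs n. c * (norm x)\<^sup>2) \<le> B"
    "\<And>p. (\<lambda>n. \<Sum>(c, x, v)\<leftarrow>cs n. c * form_at x v p) \<longlonglongrightarrow> L p / C"
proof -
  obtain ps :: "nat \<Rightarrow> ((real^'n) \<times> ((complex, 'm) vec)) list"
    where ps: "\<And>p. (\<lambda>n. \<Sum>(x, v)\<leftarrow>ps n. form_at x v p) \<longlonglongrightarrow> L p"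
    using atoms_limit[OF L pos] by blast
  let ?T = "\<lambda>n p. \<Sum>(x, v)\<leftarrow>ps n. form_at x v p"
  have bdd: "\<exists>K. \<forall>n. ?T n p \<le> K" for p
  proof -
    have "Bseq (\<lambda>n. ?T n p)" using ps by (intro convergent_imp_Bseq) (auto simp: convergent_def)
    then show ?thesis by (auto simp: Bseq_def abs_le_iff)
  qed
  let ?one = "Poly_Mapping.single 0 herm_id :: ('n, 'm herm) mvpoly"
  have one: "form_at x v ?one = (norm v)\<^sup>2" for x v
    by (simp add: form_at_single herm_inner_id_outer mpow_def)
  \<comment> \<open>The form of \<open>q\<close> is |x|^2 |v|^2, so its bounded sums control the
    second moments in x.\<close>
  define q :: "('n, 'm herm) mvpoly" where "q = (\<Sum>i\<in>UNIV. Poly_Mapping.single (Poly_Mapping.single i 2) herm_id)"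
  have q: "form_at x v q = (norm x)\<^sup>2 * (norm v)\<^sup>2" for x v
  proof -
    have "mpow x (Poly_Mapping.single i 2) = (x $ i)\<^sup>2" for i
    proof -
      have "mpow x (Poly_Mapping.single i 2) = (\<Prod>j\<in>UNIV. if j = i then (x $ i)\<^sup>2 else 1)"
        unfolding mpow_def by (intro prod.cong) (auto simp: lookup_single when_def)
      then show ?thesis by simp
    qed
    then have "form_at x v q = (\<Sum>i\<in>UNIV. (x $ i)\<^sup>2) * (norm v)\<^sup>2"
      by (simp add: q_def linear_sum[OF linear_form_at] form_at_single herm_inner_id_outer sum_distrib_right)
    then show ?thesis by (simp add: norm_vec_def L2_set_def sum_nonneg)
  qed
  obtain K where K: "\<And>n. ?T n ?one \<le> K" using bdd by blast
  obtain K' where K': "\<And>n. ?T n q \<le> K'" using bdd by blast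
  \<comment> \<open>\<open>K\<close> bounds the total mass; the added 1 makes \<open>C\<close>
    positive.\<close>
  define C where "C = \<bar>K\<bar> + 1"
  have C: "C > 0" by (simp add: C_def)
  have TC: "?T n ?one \<le> C" for n using K[of n] by (simp add: C_def)
  \<comment> \<open>Passing to a unit vector moves the factor |v|^2 into the weight. For v = 0 the
    inverse norm is 0, and the atom becomes (x, 0) with weight 0.\<close>
  define cs where "cs n = (1 - ?T n ?one / C, 0, 0) # map (\<lambda>(x, v). ((norm v)\<^sup>2 / C, x, v /\<^sub>R norm v)) (ps n)" for n
  have unit: "norm (v /\<^sub>R norm v) \<le> 1" for v :: "(complex, 'm) vec" by (cases "v = 0") auto
  show ?thesis
  proof (rule that[OF C])
    show "0 \<le> c \<and> norm v \<le> 1" if "(c, x, v) \<in> set (cs n)" for n c x v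
      using that TC[of n] C unit by (auto simp: cs_def)
    show "(\<Sum>(c, x, v)\<leftarrow>cs n. c) = 1" for n
      by (simp add: cs_def one case_prod_unfold o_def sum_list_divide_const)
    have val: "(norm v)\<^sup>2 * form_at x (v /\<^sub>R norm v) p = form_at x v p" for x v p
      by (cases "v = 0") (auto simp: form_at_scale power_inverse)
    have sc: "(\<Sum>(c, x, v)\<leftarrow>cs n. c * form_at x v p) = ?T n p / C" for n p
      by (simp add: cs_def case_prod_unfold o_def sum_list_divide_const val)
    show "(\<lambda>n. \<Sum>(c, x, v)\<leftarrow>cs n. c * form_at x v p) \<longlonglongrightarrow> L p / C" for p
      unfolding sc using ps C by (intro tendsto_intros) auto
    have "(\<Sum>(c, x, v)\<leftarrow>cs n. c * (norm x)\<^sup>2) = ?T n q / C" for n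
      by (simp add: cs_def case_prod_unfold o_def q sum_list_divide_const mult.commute)
    then show "(\<Sum>(c, x, v)\<leftarrow>cs n. c * (norm x)\<^sup>2) \<le> K' / C" for n
      using K'[of n] C by (simp add: divide_right_mono)
  qed
qed

lemma continuous_on_mpow: "continuous_on S x \<Longrightarrow> continuous_on S (\<lambda>s. mpow (x s) \<beta>)"
  unfolding mpow_def by (intro continuous_intros)

lemma continuous_on_form_at:
  assumes "continuous_on S x" "continuous_on S v"
  shows "continuous_on S (\<lambda>s. form_at (x s) (v s) p)"
  unfolding form_at_expand herm_inner_outer
  by (intro continuous_intros continuous_on_mpow assms)

text \<open>The matrix version of Haviland's theorem, with the measure in parametrised form: a
  distribution on the line carrying a point x(s) and a vector v(s).\<close>

theorem matrix_haviland:
  fixes L :: "('n::finite, 'm::{finite,linorder} herm) mvpoly \<Rightarrow> real"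
  assumes L: "linear L" and pos: "\<And>p. p \<in> pos_herm_polys \<Longrightarrow> 0 \<le> L p"
  obtains \<sigma> and x :: "real \<Rightarrow> real^'n" and v :: "real \<Rightarrow> (complex, 'm) vec"
  where "real_distribution \<sigma>" "continuous_on UNIV x" "continuous_on UNIV v"
    "\<And>p. integrable \<sigma> (\<lambda>s. form_at (x s) (v s) p)" "\<And>p. L p = (\<integral>s. form_at (x s) (v s) p \<partial>\<sigma>)"
proof -
  obtain C cs B where C: "C > 0" and cs: "\<And>n c x v. (c, x, v) \<in> set (cs n) \<Longrightarrow> 0 \<le> c \<and> norm v \<le> 1"
    and one: "\<And>n. (\<Sum>(c, x, v)\<leftarrow>cs n. c) = 1" and B: "\<And>n. (\<Sum>(c, x, v)\<leftarrow>cs n. c * (norm x)\<^sup>2) \<le> B"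
    and lim: "\<And>p. (\<lambda>n. \<Sum>(c, x, v)\<leftarrow>cs n. c * form_at x v p) \<longlonglongrightarrow> L p / C"
  proof (rule normalized_atoms_limit[OF L pos])
    fix C cs B
    assume "C > 0" "\<And>n c x v. (c, x, v) \<in> set (cs n) \<Longrightarrow> 0 \<le> c \<and> norm v \<le> 1"
      "\<And>n. (\<Sum>(c, x, v)\<leftarrow>cs n. c) = 1" "\<And>n. (\<Sum>(c, x, v)\<leftarrow>cs n. c * (norm x)\<^sup>2) \<le> B"
      "\<And>p. (\<lambda>n. \<Sum>(c, x, v)\<leftarrow>cs n. c * form_at x v p) \<longlonglongrightarrow> L p / C"
    then show thesis by (rule that[of C cs B])
  qed auto
  obtain g :: "real \<Rightarrow> (real^'n) \<times> ((complex, 'm) vec)" where g: "continuous_on UNIV g"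
    "\<And>z. \<exists>s. \<bar>s\<bar> \<le> 2 * norm z + 5 \<and> g s = z"
    by (rule continuous_curve_onto) blast
  have "\<exists>l. \<forall>z. \<bar>l z\<bar> \<le> 2 * norm z + 5 \<and> g (l z) = z" by (intro choice allI g(2))
  then obtain l where l: "\<And>z. \<bar>l z\<bar> \<le> 2 * norm z + 5" "\<And>z. g (l z) = z" by blast
  define x where "x s = fst (g s)" for s
  define v where "v s = snd (g s)" for s
  have xv: "x (l (a, b)) = a" "v (l (a, b)) = b" for a b by (simp_all add: x_def v_def l)
  have cont: "continuous_on UNIV x" "continuous_on UNIV v"
    unfolding x_def v_def by (intro continuous_intros g(1))+
  let ?\<psi> = "\<lambda>p s. form_at (x s) (v s) p"
  have c\<psi>: "continuous_on UNIV (?\<psi> p)" for p by (intro continuous_on_form_at cont)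
  then have [measurable]: "?\<psi> p \<in> borel_measurable borel" for p
    by (rule borel_measurable_continuous_onI)
  have "\<exists>\<mu>. real_distribution \<mu> \<and> (\<forall>f::real \<Rightarrow> real. f \<in> borel_measurable borel \<longrightarrow> integrable \<mu> f \<and>
      (\<integral>s. f s \<partial>\<mu>) = (\<Sum>(c, s)\<leftarrow>map (\<lambda>(c, z). (c, l z)) (cs n). c * f s))" for n
    using cs one[of n] by (intro atomic_distribution) (auto simp: case_prod_unfold o_def)
  then have "\<exists>\<mu>. \<forall>n. real_distribution (\<mu> n) \<and> (\<forall>f::real \<Rightarrow> real. f \<in> borel_measurable borel \<longrightarrow> integrable (\<mu> n) f \<and>
      (\<integral>s. f s \<partial>\<mu> n) = (\<Sum>(c, s)\<leftarrow>map (\<lambda>(c, z). (c, l z)) (cs n). c * f s))"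
    by (intro choice allI)
  then obtain \<mu> where all: "\<forall>n. real_distribution (\<mu> n) \<and> (\<forall>f::real \<Rightarrow> real. f \<in> borel_measurable borel \<longrightarrow> integrable (\<mu> n) f \<and>
      (\<integral>s. f s \<partial>\<mu> n) = (\<Sum>(c, s)\<leftarrow>map (\<lambda>(c, z). (c, l z)) (cs n). c * f s))"
    by (rule exE)
  have \<mu>: "\<And>n. real_distribution (\<mu> n)"
    "\<And>n f. f \<in> borel_measurable borel \<Longrightarrow> integrable (\<mu> n) (f :: real \<Rightarrow> real)"
    "\<And>n f. f \<in> borel_measurable borel \<Longrightarrow> (\<integral>s. f s \<partial>\<mu> n) = (\<Sum>(c, s)\<leftarrow>map (\<lambda>(c, z). (c, l z)) (cs n). c * (f s :: real))"
    using all by simp_all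
  have \<mu>': "(\<integral>s. f s \<partial>\<mu> n) = (\<Sum>(c, z)\<leftarrow>cs n. c * f (l z))" if "f \<in> borel_measurable borel" for n and f :: "real \<Rightarrow> real"
    using \<mu>(3)[OF that] by (simp add: case_prod_unfold o_def)
  have mono: "(\<Sum>(c, z)\<leftarrow>cs n. c * f z) \<le> (\<Sum>(c, z)\<leftarrow>cs n. c * h z)"
    if "\<And>a b. norm b \<le> 1 \<Longrightarrow> f (a, b) \<le> h (a, b)" for n and f h :: "(real^'n) \<times> ((complex, 'm) vec) \<Rightarrow> real"
    using cs[of _ _ _ n] that by (intro sum_list_mono) (force intro: mult_left_mono)
  have "\<exists>M. real_distribution M \<and> (\<forall>k\<in>UNIV. integrable M ((\<lambda>(\<beta>, i, j). ?\<psi> (Poly_Mapping.single \<beta> (herm_basis i j))) k) \<and>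
     (\<integral>s. (\<lambda>(\<beta>, i, j). ?\<psi> (Poly_Mapping.single \<beta> (herm_basis i j))) k s \<partial>M)
       = (\<lambda>(\<beta>, i, j). L (Poly_Mapping.single \<beta> (herm_basis i j)) / C) k)"
  proof (rule moment_limit[OF \<mu>(1)])
    show "integrable (\<mu> n) (\<lambda>s. s\<^sup>2)" for n by (intro \<mu>(2)) auto
    \<comment> \<open>From |l z| \<le> 2 |z| + 5 and |z| \<le> |x| + 1 follows |l z| \<le> 2 |x| +
      7, and (2r + 7)^2 \<le> 8 r^2 + 98; the weights sum to 1.\<close>
    show "(\<integral>s. s\<^sup>2 \<partial>\<mu> n) \<le> 98 + 8 * B" for n
    proof -
      have "(l z)\<^sup>2 \<le> 98 + 8 * (norm (fst z))\<^sup>2" if "norm (snd z) \<le> 1" for z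
      proof -
        have "norm z \<le> norm (fst z) + norm (snd z)" using norm_Pair_le[of "fst z" "snd z"] by simp
        then have "\<bar>l z\<bar> \<le> 2 * norm (fst z) + 7" using l(1)[of z] that by linarith
        then have "(l z)\<^sup>2 \<le> (2 * norm (fst z) + 7)\<^sup>2" by (intro power2_le_iff_abs_le[THEN iffD2]) auto
        also have "\<dots> \<le> 98 + 8 * (norm (fst z))\<^sup>2"
        proof -
          have "0 \<le> (2 * norm (fst z) - 7)\<^sup>2" by simp
          then show ?thesis by (simp add: power2_eq_square algebra_simps)
        qed
        finally show ?thesis .
      qed
      then have "(\<integral>s. s\<^sup>2 \<partial>\<mu> n) \<le> (\<Sum>(c, z)\<leftarrow>cs n. c * (98 + 8 * (norm (fst z))\<^sup>2))"
        using \<mu>'[of "\<lambda>s. s\<^sup>2" n] by (subst \<mu>') (auto intro!: mono)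
      also have "\<dots> = 98 * (\<Sum>(c, x, v)\<leftarrow>cs n. c) + 8 * (\<Sum>(c, x, v)\<leftarrow>cs n. c * (norm x)\<^sup>2)"
        proof -
        have "(\<Sum>(c, z)\<leftarrow>zs. c * (98 + 8 * (norm (fst z))\<^sup>2))
            = 98 * (\<Sum>(c, x, v)\<leftarrow>zs. c) + 8 * (\<Sum>(c, x, v)\<leftarrow>zs. c * (norm x)\<^sup>2)"
          for zs :: "(real \<times> (real^'n) \<times> ((complex, 'm) vec)) list"
          by (induction zs) (auto simp: algebra_simps)
        then show ?thesis .
      qed
      also have "\<dots> \<le> 98 + 8 * B" using one[of n] B[of n] by simp
      finally show ?thesis .
    qed
  next
    fix k :: "('n \<Rightarrow>\<^sub>0 nat) \<times> 'm \<times> 'm"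
    obtain \<beta> i j where k: "k = (\<beta>, i, j)" by (cases k)
    let ?p = "Poly_Mapping.single \<beta> (herm_basis i j)"
    let ?b = "(herm_bound (herm_basis i j))\<^sup>2"
    let ?q = "Poly_Mapping.single (\<beta> + \<beta>) (?b *\<^sub>R herm_id)"
    show "isCont ((\<lambda>(\<beta>, i, j). ?\<psi> (Poly_Mapping.single \<beta> (herm_basis i j))) k) s" for s
      using c\<psi>[of ?p] by (simp add: k continuous_on_eq_continuous_at)
    show "integrable (\<mu> n) (\<lambda>s. ((\<lambda>(\<beta>, i, j). ?\<psi> (Poly_Mapping.single \<beta> (herm_basis i j))) k s)\<^sup>2)" for n
      unfolding k prod.case by (intro \<mu>(2)) measurable
    show "(\<lambda>n. \<integral>s. (\<lambda>(\<beta>, i, j). ?\<psi> (Poly_Mapping.single \<beta> (herm_basis i j))) k s \<partial>\<mu> n)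
        \<longlonglongrightarrow> (\<lambda>(\<beta>, i, j). L (Poly_Mapping.single \<beta> (herm_basis i j)) / C) k"
      using lim[of ?p] by (simp add: k \<mu>' case_prod_unfold) (simp add: x_def v_def l)
    have sq: "(form_at a b ?p)\<^sup>2 \<le> form_at a b ?q" if "norm b \<le> 1" for a b
    proof -
      have "(form_at a b ?p)\<^sup>2 = (mpow a \<beta>)\<^sup>2 * (herm_inner (herm_basis i j) (outer b))\<^sup>2"
        by (simp add: form_at_single power_mult_distrib)
      also have "(herm_inner (herm_basis i j) (outer b))\<^sup>2 \<le> (herm_bound (herm_basis i j) * (norm b)\<^sup>2)\<^sup>2"
        using abs_herm_inner_outer_le by (intro power2_le_iff_abs_le[THEN iffD2]) (auto simp: herm_bound_nonneg)
      also have "\<dots> = ?b * ((norm b)\<^sup>2 * (norm b)\<^sup>2)" by (simp add: power2_eq_square)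
      also have "\<dots> \<le> ?b * ((norm b)\<^sup>2 * 1)"
        using that by (intro mult_left_mono) (auto simp: power_le_one)
      finally have "(form_at a b ?p)\<^sup>2 \<le> (mpow a \<beta>)\<^sup>2 * (?b * (norm b)\<^sup>2)" by (simp add: mult_left_mono)
      also have "\<dots> = form_at a b ?q"
        by (simp add: form_at_single mpow_add herm_inner_scale_left herm_inner_id_outer power2_eq_square)
      finally show ?thesis .
    qed
    have "Bseq (\<lambda>n. \<Sum>(c, x, v)\<leftarrow>cs n. c * form_at x v ?q)"
      using lim by (intro convergent_imp_Bseq) (auto simp: convergent_def)
    then obtain K where K: "\<And>n. (\<Sum>(c, x, v)\<leftarrow>cs n. c * form_at x v ?q) \<le> K"
      by (auto simp: Bseq_def abs_le_iff)
    have "(\<integral>s. (?\<psi> ?p s)\<^sup>2 \<partial>\<mu> n) \<le> K" for n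
    proof -
      have "(\<integral>s. (?\<psi> ?p s)\<^sup>2 \<partial>\<mu> n) = (\<Sum>(c, z)\<leftarrow>cs n. c * (form_at (fst z) (snd z) ?p)\<^sup>2)"
      proof -
        have "(\<lambda>s. (?\<psi> ?p s)\<^sup>2) \<in> borel_measurable borel" by measurable
        then show ?thesis by (subst \<mu>') (auto simp: x_def v_def l)
      qed
      also have "\<dots> \<le> (\<Sum>(c, z)\<leftarrow>cs n. c * form_at (fst z) (snd z) ?q)"
        using sq by (intro mono) simp
      also have "\<dots> = (\<Sum>(c, x, v)\<leftarrow>cs n. c * form_at x v ?q)" by (simp add: case_prod_unfold)
      finally show ?thesis using K[of n] by simp
    qed
    then show "\<exists>b. \<forall>n. (\<integral>s. ((\<lambda>(\<beta>, i, j). ?\<psi> (Poly_Mapping.single \<beta> (herm_basis i j))) k s)\<^sup>2 \<partial>\<mu> n) \<le> b"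
      unfolding k prod.case by blast
  qed
  then obtain \<sigma> where \<sigma>: "real_distribution \<sigma>"
    and int: "\<And>\<beta> i j. integrable \<sigma> (?\<psi> (Poly_Mapping.single \<beta> (herm_basis i j)))"
    and val: "\<And>\<beta> i j. (\<integral>s. ?\<psi> (Poly_Mapping.single \<beta> (herm_basis i j)) s \<partial>\<sigma>) = L (Poly_Mapping.single \<beta> (herm_basis i j)) / C"
    by auto
  have int': "integrable \<sigma> (?\<psi> p)" for p
    by (subst linear_mvpoly_expand[OF linear_form_at]) (intro Bochner_Integration.integrable_sum integrable_mult_right int)
  have val': "L p = C * (\<integral>s. ?\<psi> p s \<partial>\<sigma>)" for p
  proof -
    have "(\<integral>s. ?\<psi> p s \<partial>\<sigma>) = L p / C"
      by (subst linear_mvpoly_expand[OF linear_form_at], subst linear_mvpoly_expand[OF L])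
         (simp add: Bochner_Integration.integral_sum Bochner_Integration.integrable_sum integrable_mult_right int val sum_divide_distrib)
    then show ?thesis using C by simp
  qed
  \<comment> \<open>The factor sqrt C in the vectors undoes the division of the weights by
    C.\<close>
  show ?thesis
  proof (rule that[of \<sigma> x "\<lambda>s. sqrt C *\<^sub>R v s"])
    show "integrable \<sigma> (\<lambda>s. form_at (x s) (sqrt C *\<^sub>R v s) p)" for p
      using int'[of p] C by (simp add: form_at_scale)
    show "L p = (\<integral>s. form_at (x s) (sqrt C *\<^sub>R v s) p \<partial>\<sigma>)" for p
      using val'[of p] C by (simp add: form_at_scale)
  qed (use \<sigma> cont in \<open>auto intro!: continuous_intros\<close>)
qed

section \<open>Representing matrix measures\<close>

definition represents :: "((real^'n::finite) set \<Rightarrow> 'm::{finite,linorder} herm) \<Rightarrow> (('n, 'm herm) mvpoly \<Rightarrow> real) \<Rightarrow> bool"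
  where "represents \<mu> L \<longleftrightarrow> matrix_measure \<mu> \<and>
    (\<forall>p. pairing_integrable \<mu> (mveval p) \<and> L p = pairing_integral \<mu> (mveval p))"

text \<open>The point x enters only through the translate p(x + _), again a polynomial, so condition
  (b) at x = 0 for all p contains the condition at every x.\<close>

lemma is_representing_measure_iff:
  fixes Q :: "('n::finite \<Rightarrow>\<^sub>0 nat) \<Rightarrow> 'm::{finite,linorder} herm \<Rightarrow> ('n, 'm herm) mvpoly"
  assumes Q: "\<And>\<alpha>. linear (Q \<alpha>)"
  shows "is_representing_measure Q y M \<mu> \<longleftrightarrow>
    (M \<in> herm_psd \<longrightarrow> positive_matrix_measure \<mu>) \<and> represents \<mu> (\<lambda>p. herm_inner (symbol_form Q y p) M)"
    (is "?A \<longleftrightarrow> ?B")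
proof -
  have tr: "(\<lambda>t. mveval p (x + t)) = mveval (mvtranslate x p)" for p :: "('n, 'm herm) mvpoly" and x
    by (simp add: mveval_mvtranslate fun_eq_iff)
  show ?thesis
  proof
    assume A: ?A
    have "pairing_integrable \<mu> (mveval p)" "herm_inner (symbol_form Q y p) M = pairing_integral \<mu> (mveval p)" for p
    proof -
      have "pairing_integrable \<mu> (\<lambda>t. mveval p (0 + t)) \<and>
          mveval (diff_op_at_inner Q y M p) 0 = pairing_integral \<mu> (\<lambda>t. mveval p (0 + t))"
        using A unfolding is_representing_measure_def by blast
      then show "pairing_integrable \<mu> (mveval p)" "herm_inner (symbol_form Q y p) M = pairing_integral \<mu> (mveval p)"
        by (simp_all add: mveval_diff_op_at_inner[OF Q] mvtranslate_0)
    qed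
    with A show ?B by (simp add: is_representing_measure_def represents_def)
  next
    assume ?B
    then show ?A
      by (simp add: is_representing_measure_def represents_def tr mveval_diff_op_at_inner[OF Q])
  qed
qed

lemma herm_inner_basis_self: "herm_inner (herm_basis i j) (herm_basis i j) = 1"
proof -
  have "i < j \<or> i = j \<or> j < i" by auto
  then show ?thesis
    by (auto simp: herm_inner_basis herm_basis.rep_eq matrix_unit_def dest: less_not_sym)
qed

lemma borel_measurable_herm_inner_mveval:
  "(\<lambda>t::real^'n::finite. herm_inner (mveval p t) A) \<in> borel_measurable borel"
proof (rule borel_measurable_continuous_onI)
  have "(\<lambda>t. herm_inner (mveval p t) A) = (\<lambda>t. \<Sum>\<beta>\<in>Poly_Mapping.keys p. mpow t \<beta> * herm_inner (Poly_Mapping.lookup p \<beta>) A)"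
    by (simp add: fun_eq_iff mveval_def herm_inner_sum_left herm_inner_scale_left)
  then show "continuous_on UNIV (\<lambda>t::real^'n. herm_inner (mveval p t) A)"
    by (simp only:) (intro continuous_intros continuous_on_mpow continuous_on_id)
qed

text \<open>The image under \<open>x\<close> of the Hermitian-valued measure with density \<open>v v\<^sup>*\<close> with respect to \<open>\<sigma>\<close>.\<close>

definition image_measure ::
  "real measure \<Rightarrow> (real \<Rightarrow> real^'n::finite) \<Rightarrow> (real \<Rightarrow> (complex, 'm) vec) \<Rightarrow> (real^'n) set \<Rightarrow> 'm::{finite,linorder} herm"
  where "image_measure \<sigma> x v S = (\<Sum>i\<in>UNIV. \<Sum>j\<in>UNIV.
    (\<integral>s. indicator S (x s) * herm_inner (herm_basis i j) (outer (v s)) \<partial>\<sigma>) *\<^sub>R herm_basis i j)"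

text \<open>By Parseval, pairing the measure of S with A integrates the form of A at v(s) over those
  s with x(s) in S. Positivity is then immediate, countable additivity is dominated convergence, and
  the integrals are those of an image with a signed density.\<close>

lemma image_measure_represents:
  fixes x :: "real \<Rightarrow> real^'n::finite" and v :: "real \<Rightarrow> (complex, 'm::{finite,linorder}) vec"
  assumes \<sigma>: "real_distribution \<sigma>" and cont: "continuous_on UNIV x" "continuous_on UNIV v"
    and int: "\<And>p. integrable \<sigma> (\<lambda>s. form_at (x s) (v s) p)"
  shows "positive_matrix_measure (image_measure \<sigma> x v)"
    and "represents (image_measure \<sigma> x v) (\<lambda>p. \<integral>s. form_at (x s) (v s) p \<partial>\<sigma>)"
proof -
  interpret real_distribution \<sigma> by (rule \<sigma>)
  let ?\<mu> = "image_measure \<sigma> x v"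
  let ?D = "\<lambda>A s. herm_inner A (outer (v s))"
  have x: "x \<in> measurable \<sigma> borel" using borel_measurable_continuous_onI[OF cont(1)] by simp
  have D: "integrable \<sigma> (?D A)" for A
    using int[of "Poly_Mapping.single 0 A"] by (simp add: form_at_single mpow_def)
  have DS: "integrable \<sigma> (\<lambda>s. indicator S (x s) * ?D A s)" if "S \<in> sets borel" for S A
  proof (rule Bochner_Integration.integrable_bound[OF D[of A]])
    have "(\<lambda>s. indicator S (x s) :: real) \<in> borel_measurable \<sigma>"
      using x that by (intro measurable_compose[OF x] borel_measurable_indicator)
    then show "(\<lambda>s. indicator S (x s) * ?D A s) \<in> borel_measurable \<sigma>" using D[of A] by simp
  qed (auto intro!: AE_I2 simp: indicator_def)
  have val: "herm_inner (?\<mu> S) A = (\<integral>s. indicator S (x s) * ?D A s \<partial>\<sigma>)" if S: "S \<in> sets borel" for S A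
  proof -
    have "(\<integral>s. indicator S (x s) * ?D A s \<partial>\<sigma>)
        = (\<integral>s. (\<Sum>i\<in>UNIV. \<Sum>j\<in>UNIV. herm_inner A (herm_basis i j) * (indicator S (x s) * ?D (herm_basis i j) s)) \<partial>\<sigma>)"
      by (intro Bochner_Integration.integral_cong refl)
         (subst herm_parseval, simp add: sum_distrib_left mult_ac herm_inner_commute[of "outer _"])
    also have "\<dots> = (\<Sum>i\<in>UNIV. \<Sum>j\<in>UNIV. herm_inner A (herm_basis i j) * (\<integral>s. indicator S (x s) * ?D (herm_basis i j) s \<partial>\<sigma>))"
      using DS[OF S]
      by (subst Bochner_Integration.integral_sum, simp)
         (intro sum.cong refl, subst Bochner_Integration.integral_sum, simp_all)
    also have "\<dots> = herm_inner (?\<mu> S) A"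
      by (simp add: image_measure_def herm_inner_sum_left herm_inner_scale_left herm_inner_commute[of A] mult.commute)
    finally show ?thesis ..
  qed
  have vm1: "vector_measure borel (\<lambda>S. \<integral>s. indicator S (x s) * ?D A s \<partial>\<sigma>)" for A
    unfolding vector_measure_def
  proof (intro allI impI)
    fix B :: "nat \<Rightarrow> (real^'n) set"
    assume B: "range B \<subseteq> sets borel" "disjoint_family B"
    have B': "B i \<in> sets borel" for i using B by auto
    have "(\<lambda>n. \<integral>s. (\<Sum>i<n. indicator (B i) (x s)) * ?D A s \<partial>\<sigma>) \<longlonglongrightarrow> (\<integral>s. indicator (\<Union>i. B i) (x s) * ?D A s \<partial>\<sigma>)"
    proof (rule integral_dominated_convergence[where w = "\<lambda>s. \<bar>?D A s\<bar>"])
      have sum_ind: "(\<Sum>i<n. indicator (B i) t) = (indicator (\<Union>i<n. B i) t :: real)" for n t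
        using B(2) by (intro indicator_UN_disjoint[symmetric]) (auto intro: disjoint_family_on_mono)
      show "AE s in \<sigma>. (\<lambda>n. (\<Sum>i<n. indicator (B i) (x s)) * ?D A s) \<longlonglongrightarrow> indicator (\<Union>i. B i) (x s) * ?D A s"
      proof (intro AE_I2 tendsto_mult_right)
        fix s
        have "(\<lambda>i. indicator (B i) (x s) :: real) sums indicator (\<Union>i. B i) (x s)"
          using B(2) by (intro indicator_sums) (auto simp: disjoint_family_on_def)
        then show "(\<lambda>n. \<Sum>i<n. indicator (B i) (x s) :: real) \<longlonglongrightarrow> indicator (\<Union>i. B i) (x s)"
          unfolding sums_def .
      qed
      show "AE s in \<sigma>. norm ((\<Sum>i<n. indicator (B i) (x s)) * ?D A s) \<le> \<bar>?D A s\<bar>" for n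
        unfolding sum_ind by (intro AE_I2) (simp split: split_indicator)
      show "integrable \<sigma> (\<lambda>s. \<bar>?D A s\<bar>)" using D by simp
      show "(\<lambda>s. (\<Sum>i<n. indicator (B i) (x s)) * ?D A s) \<in> borel_measurable \<sigma>" for n
        unfolding sum_distrib_right
        by (intro borel_measurable_sum borel_measurable_integrable DS B')
      show "(\<lambda>s. indicator (\<Union>i. B i) (x s) * ?D A s) \<in> borel_measurable \<sigma>"
        by (intro borel_measurable_integrable DS sets.countable_UN) (use B' in auto)
    qed
    then show "(\<lambda>i. \<integral>s. indicator (B i) (x s) * ?D A s \<partial>\<sigma>) sums (\<integral>s. indicator (\<Union>i. B i) (x s) * ?D A s \<partial>\<sigma>)"
      unfolding sums_def sum_distrib_right by (subst (asm) Bochner_Integration.integral_sum) (rule DS[OF B'])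
  qed
  have "vector_measure borel (\<lambda>S. hmat (?\<mu> S) $ k $ l)" for k l
  proof -
    have "vector_measure borel (\<lambda>S. \<Sum>i\<in>UNIV. \<Sum>j\<in>UNIV.
        (\<integral>s. indicator S (x s) * ?D (herm_basis i j) s \<partial>\<sigma>) *\<^sub>R hmat (herm_basis i j) $ k $ l)"
      by (intro vector_measure_sum vector_measure_bounded_linear[OF _ bounded_linear_scaleR_left] vm1)
    then show ?thesis by (simp add: image_measure_def hmat_sum scaleR_herm.rep_eq)
  qed
  then have mm: "matrix_measure ?\<mu>" by (simp add: matrix_measure_def)
  have "?\<mu> S \<in> herm_psd" if S: "S \<in> sets borel" for S
    unfolding herm_psd_iff val[OF S]
    by (intro allI integral_nonneg_AE AE_I2 mult_nonneg_nonneg) (simp_all add: herm_inner_outer_outer)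
  with mm show "positive_matrix_measure ?\<mu>" by (simp add: positive_matrix_measure_def)
  have si: "signed_integrable borel (\<lambda>S. herm_inner (?\<mu> S) A) (\<lambda>t. herm_inner (mveval p t) A)"
    "signed_integral borel (\<lambda>S. herm_inner (?\<mu> S) A) (\<lambda>t. herm_inner (mveval p t) A)
      = (\<integral>s. herm_inner (mveval p (x s)) A * ?D A s \<partial>\<sigma>)"
    "integrable \<sigma> (\<lambda>s. herm_inner (mveval p (x s)) A * ?D A s)" for p A
  proof -
    \<comment> \<open>The form of the polynomial <p, A> A is the product of <p(x), A> with the form
      of A, so integrability of all forms covers each coordinate product.\<close>
    let ?q = "Poly_Mapping.map (\<lambda>B. herm_inner B A *\<^sub>R A) p"
    have "linear (\<lambda>B. herm_inner B A *\<^sub>R A)"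
      by (intro linearI) (simp_all add: herm_inner_add_left herm_inner_scale_left scaleR_add_left)
    then have "form_at (x s) (v s) ?q = herm_inner (mveval p (x s)) A * ?D A s" for s
      by (simp add: form_at_def mveval_map herm_inner_scale_left)
    with int[of ?q] show i: "integrable \<sigma> (\<lambda>s. herm_inner (mveval p (x s)) A * ?D A s)" by simp
    show "signed_integrable borel (\<lambda>S. herm_inner (?\<mu> S) A) (\<lambda>t. herm_inner (mveval p t) A)"
      "signed_integral borel (\<lambda>S. herm_inner (?\<mu> S) A) (\<lambda>t. herm_inner (mveval p t) A)
        = (\<integral>s. herm_inner (mveval p (x s)) A * ?D A s \<partial>\<sigma>)"
      by (rule signed_integral_image_density[OF x D borel_measurable_herm_inner_mveval i val]; assumption)+
  qed
  have "(\<integral>s. form_at (x s) (v s) p \<partial>\<sigma>) = pairing_integral ?\<mu> (mveval p)" for p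
  proof -
    have "(\<integral>s. form_at (x s) (v s) p \<partial>\<sigma>)
        = (\<integral>s. (\<Sum>i\<in>UNIV. \<Sum>j\<in>UNIV. herm_inner (mveval p (x s)) (herm_basis i j) * ?D (herm_basis i j) s) \<partial>\<sigma>)"
      unfolding form_at_def
      by (intro Bochner_Integration.integral_cong refl) (subst herm_parseval, simp add: herm_inner_commute[of "outer _"])
    also have "\<dots> = (\<Sum>i\<in>UNIV. \<Sum>j\<in>UNIV. (\<integral>s. herm_inner (mveval p (x s)) (herm_basis i j) * ?D (herm_basis i j) s \<partial>\<sigma>))"
      using si(3)
      by (subst Bochner_Integration.integral_sum, simp)
         (intro sum.cong refl, subst Bochner_Integration.integral_sum, simp_all)
    finally show ?thesis by (simp add: pairing_integral_def si(2))
  qed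
  with mm si(1) show "represents ?\<mu> (\<lambda>p. \<integral>s. form_at (x s) (v s) p \<partial>\<sigma>)"
    by (simp add: represents_def pairing_integrable_def)
qed

text \<open>The basis matrix has norm 1, so its own coordinate of the test polynomial is x^\<beta>.
  The case \<beta> = 0 makes the Jordan parts finite.\<close>

lemma represents_integrable:
  assumes "represents \<mu> L"
  shows "signed_integrable borel (\<lambda>S. herm_inner (\<mu> S) (herm_basis i j)) (\<lambda>t. mpow t \<beta>)"
    and "signed_integrable borel (\<lambda>S. herm_inner (\<mu> S) (herm_basis i j)) (\<lambda>_. 1)"
proof -
  show m: "signed_integrable borel (\<lambda>S. herm_inner (\<mu> S) (herm_basis i j)) (\<lambda>t. mpow t \<beta>)" for \<beta>
  proof -
    have "pairing_integrable \<mu> (mveval (Poly_Mapping.single \<beta> (herm_basis i j)))"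
      using assms by (simp add: represents_def)
    then have "signed_integrable borel (\<lambda>S. herm_inner (\<mu> S) (herm_basis i j))
        (\<lambda>t. herm_inner (mveval (Poly_Mapping.single \<beta> (herm_basis i j)) t) (herm_basis i j))"
      unfolding pairing_integrable_def by blast
    then show ?thesis by (simp add: mveval_single herm_inner_scale_left herm_inner_basis_self)
  qed
  show "signed_integrable borel (\<lambda>S. herm_inner (\<mu> S) (herm_basis i j)) (\<lambda>_. 1)"
    using m[of 0] by (simp add: mpow_def)
qed

lemma represents_diff:
  assumes 1: "represents \<mu>\<^sub>1 L\<^sub>1" and 2: "represents \<mu>\<^sub>2 L\<^sub>2"
  shows "represents (\<lambda>S. \<mu>\<^sub>1 S - \<mu>\<^sub>2 S) (\<lambda>p. L\<^sub>1 p - L\<^sub>2 p)"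
proof -
  \<comment> \<open>Indexing the two measures by \<open>bool\<close> makes the difference an
    instance of \<open>signed_integral_sum\<close>.\<close>
  let ?\<nu> = "\<lambda>k S. if k then \<mu>\<^sub>1 S else \<mu>\<^sub>2 S" and ?c = "\<lambda>k. if k then 1 else -1 :: real"
  have si: "signed_integrable borel (\<lambda>S. herm_inner (\<mu>\<^sub>1 S - \<mu>\<^sub>2 S) (herm_basis i j)) (\<lambda>t. herm_inner (mveval p t) (herm_basis i j))"
    "signed_integral borel (\<lambda>S. herm_inner (\<mu>\<^sub>1 S - \<mu>\<^sub>2 S) (herm_basis i j)) (\<lambda>t. herm_inner (mveval p t) (herm_basis i j))
      = (\<Sum>k\<in>UNIV. ?c k * signed_integral borel (\<lambda>S. herm_inner (?\<nu> k S) (herm_basis i j)) (\<lambda>t. herm_inner (mveval p t) (herm_basis i j)))"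
    for p i j
  proof -
    have k: "vector_measure borel (\<lambda>S. herm_inner (?\<nu> k S) (herm_basis i j))"
      "signed_integrable borel (\<lambda>S. herm_inner (?\<nu> k S) (herm_basis i j)) (\<lambda>_. 1)"
      "signed_integrable borel (\<lambda>S. herm_inner (?\<nu> k S) (herm_basis i j)) (\<lambda>t. herm_inner (mveval p t) (herm_basis i j))" for k
      using 1 2 represents_integrable(2)[OF 1] represents_integrable(2)[OF 2]
      by (cases k; simp add: represents_def pairing_integrable_def vector_measure_herm_inner)+
    have \<rho>: "herm_inner (\<mu>\<^sub>1 S - \<mu>\<^sub>2 S) (herm_basis i j) = (\<Sum>k\<in>UNIV. ?c k * herm_inner (?\<nu> k S) (herm_basis i j))" for S
      by (simp add: UNIV_bool herm_inner_diff_left)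
    note s = signed_integral_sum[OF finite k borel_measurable_herm_inner_mveval \<rho>]
    show "signed_integrable borel (\<lambda>S. herm_inner (\<mu>\<^sub>1 S - \<mu>\<^sub>2 S) (herm_basis i j)) (\<lambda>t. herm_inner (mveval p t) (herm_basis i j))"
      by (rule s(1))
    show "signed_integral borel (\<lambda>S. herm_inner (\<mu>\<^sub>1 S - \<mu>\<^sub>2 S) (herm_basis i j)) (\<lambda>t. herm_inner (mveval p t) (herm_basis i j))
      = (\<Sum>k\<in>UNIV. ?c k * signed_integral borel (\<lambda>S. herm_inner (?\<nu> k S) (herm_basis i j)) (\<lambda>t. herm_inner (mveval p t) (herm_basis i j)))"
      by (rule s(2))
  qed
  have "matrix_measure (\<lambda>S. \<mu>\<^sub>1 S - \<mu>\<^sub>2 S)"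
    using 1 2 unfolding represents_def matrix_measure_def vector_measure_def minus_herm.rep_eq
    by (auto intro!: sums_diff)
  moreover have "pairing_integral (\<lambda>S. \<mu>\<^sub>1 S - \<mu>\<^sub>2 S) (mveval p) = pairing_integral \<mu>\<^sub>1 (mveval p) - pairing_integral \<mu>\<^sub>2 (mveval p)" for p
    unfolding pairing_integral_def si(2) by (simp add: UNIV_bool sum_subtractf)
  ultimately show ?thesis
    using 1 2 si(1) by (simp add: represents_def pairing_integrable_def)
qed

section \<open>Positive matrix measures give positive functionals\<close>

lemma signed_integral_dominated_convergence:
  assumes w: "signed_integrable M \<nu> w" and f: "\<And>k. f k \<in> borel_measurable M" "g \<in> borel_measurable M"
    and lim: "\<And>t. t \<in> space M \<Longrightarrow> (\<lambda>k. f k t) \<longlonglongrightarrow> g t" and bd: "\<And>k t. t \<in> space M \<Longrightarrow> \<bar>f k t\<bar> \<le> w t"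
  shows "(\<lambda>k. signed_integral M \<nu> (f k)) \<longlonglongrightarrow> signed_integral M \<nu> (g :: _ \<Rightarrow> real)"
proof -
  have "(\<lambda>k. integral\<^sup>L N (f k)) \<longlonglongrightarrow> integral\<^sup>L N g" if N: "sets N = sets M" "integrable N w" for N
  proof (rule integral_dominated_convergence[where w = w])
    have sp: "space N = space M" using N(1) by (rule sets_eq_imp_space_eq)
    show "g \<in> borel_measurable N" "\<And>k. f k \<in> borel_measurable N"
      using f N(1) by (simp_all cong: measurable_cong_sets)
    show "AE t in N. (\<lambda>k. f k t) \<longlonglongrightarrow> g t" using lim sp by (intro AE_I2) simp
    show "AE t in N. norm (f k t) \<le> w t" for k using bd sp by (intro AE_I2) simp
  qed (rule N(2))
  then show ?thesis using w unfolding signed_integral_def signed_integrable_def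
    by (intro tendsto_diff) auto
qed

lemma signed_integral_simple:
  assumes vm: "vector_measure M \<nu>" and one: "signed_integrable M \<nu> (\<lambda>_. 1)"
    and Y: "finite Y" and A: "\<And>c. c \<in> Y \<Longrightarrow> A c \<in> sets M"
  shows "signed_integral M \<nu> (\<lambda>t. \<Sum>c\<in>Y. a c * indicator (A c) t) = (\<Sum>c\<in>Y. a c * \<nu> (A c))"
proof -
  note fin = finite_jordan[OF one]
  have i: "integral\<^sup>L N (\<lambda>t. \<Sum>c\<in>Y. a c * indicator (A c) t) = (\<Sum>c\<in>Y. a c * measure N (A c))"
    if N: "finite_measure N" "sets N = sets M" for N
  proof -
    interpret finite_measure N by (rule N)
    have A': "A c \<in> sets N" "A c \<inter> space N = A c" if "c \<in> Y" for c
      using A[OF that] N(2) sets.sets_into_space[of "A c" N] by auto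
    have "integrable N (\<lambda>t. a c * indicator (A c) t)" if "c \<in> Y" for c
      using A'[OF that] by (intro integrable_mult_right integrable_real_indicator) (simp_all add: less_top[symmetric])
    then have "integral\<^sup>L N (\<lambda>t. \<Sum>c\<in>Y. a c * indicator (A c) t) = (\<Sum>c\<in>Y. integral\<^sup>L N (\<lambda>t. a c * indicator (A c) t))"
      by (rule Bochner_Integration.integral_sum)
    also have "\<dots> = (\<Sum>c\<in>Y. a c * measure N (A c))"
      using A' by (intro sum.cong refl) simp
    finally show ?thesis .
  qed
  have "\<nu> (A c) = measure (jordan_pos M \<nu>) (A c) - measure (jordan_neg M \<nu>) (A c)" if "c \<in> Y" for c
    using finite_measure.emeasure_finite[OF fin(1), of "A c"]
    by (intro jordan_decomposition vm A that) (simp add: less_top)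
  then show ?thesis
    unfolding signed_integral_def i[OF fin(1) sets_jordan_pos] i[OF fin(2) sets_jordan_neg]
    by (simp add: sum_subtractf[symmetric] right_diff_distrib)
qed

text \<open>The coordinate integrals need not be nonnegative one by one; only their sum is. For a
  step function Parseval reassembles them into a sum of pairings of p(c) with the measure of a set,
  each nonnegative by self-duality. Two limits lead to p: step functions on a ball, where all is
  bounded, then growing balls with |f| as majorant.\<close>

lemma represents_nonneg:
  fixes \<mu> :: "(real^'n::finite) set \<Rightarrow> 'm::{finite,linorder} herm"
  assumes \<mu>: "positive_matrix_measure \<mu>" and r: "represents \<mu> L" and p: "p \<in> pos_herm_polys"
  shows "0 \<le> L p"
proof -
  let ?\<nu> = "\<lambda>i j S. herm_inner (\<mu> S) (herm_basis i j)"
  let ?f = "\<lambda>i j t. herm_inner (mveval p t) (herm_basis i j)"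
  have vm: "vector_measure borel (?\<nu> i j)" for i j
    using r by (intro vector_measure_herm_inner) (simp add: represents_def)
  note one = represents_integrable(2)[OF r]
  have cont: "continuous_on UNIV (?f i j)" for i j
  proof -
    have "?f i j = (\<lambda>t. \<Sum>\<beta>\<in>Poly_Mapping.keys p. mpow t \<beta> * herm_inner (Poly_Mapping.lookup p \<beta>) (herm_basis i j))"
      by (simp add: fun_eq_iff mveval_def herm_inner_sum_left herm_inner_scale_left)
    then show ?thesis by (simp only:) (intro continuous_intros continuous_on_mpow continuous_on_id)
  qed
  have fm: "?f i j \<in> borel_measurable borel" for i j
    by (rule borel_measurable_herm_inner_mveval)
  \<comment> \<open>The argument t is approximated rather than the value p(t), so that the values
    p(s k t) remain psd.\<close>
  obtain s :: "nat \<Rightarrow> real^'n \<Rightarrow> real^'n" where s: "\<And>k. simple_function borel (s k)"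
    "\<And>t. (\<lambda>k. s k t) \<longlonglongrightarrow> t" "\<And>k t. dist (s k t) 0 \<le> 2 * dist t 0"
    using borel_measurable_implies_sequence_metric[of "\<lambda>t. t" borel "0 :: real^'n"] by auto
  let ?B = "\<lambda>R::nat. cball 0 (real R) :: (real^'n) set"
  have step: "0 \<le> (\<Sum>i\<in>UNIV. \<Sum>j\<in>UNIV. signed_integral borel (?\<nu> i j) (\<lambda>t. indicator (?B R) t * ?f i j (s k t)))" for R k
  proof -
    let ?Y = "range (s k)" and ?A = "\<lambda>c. ?B R \<inter> s k -` {c}"
    have Y: "finite ?Y" using simple_functionD(1)[OF s(1)[of k]] by simp
    have A: "?A c \<in> sets borel" for c using simple_functionD(2)[OF s(1)[of k], of "{c}"] by auto
    have "indicator (?B R) t * ?f i j (s k t) = (\<Sum>c\<in>?Y. ?f i j c * indicator (?A c) t)" for i j t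
    proof -
      have "(\<Sum>c\<in>?Y. ?f i j c * indicator (?A c) t) = (\<Sum>c\<in>?Y. if c = s k t then ?f i j c * indicator (?B R) t else 0)"
        by (intro sum.cong refl) (auto simp: indicator_def)
      then show ?thesis using Y by (simp add: mult.commute)
    qed
    then have "(\<Sum>i\<in>UNIV. \<Sum>j\<in>UNIV. signed_integral borel (?\<nu> i j) (\<lambda>t. indicator (?B R) t * ?f i j (s k t)))
        = (\<Sum>i\<in>UNIV. \<Sum>j\<in>UNIV. \<Sum>c\<in>?Y. ?f i j c * ?\<nu> i j (?A c))"
      using A by (simp add: signed_integral_simple[OF vm one Y])
    also have "\<dots> = (\<Sum>c\<in>?Y. \<Sum>i\<in>UNIV. \<Sum>j\<in>UNIV. ?f i j c * ?\<nu> i j (?A c))"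
      by (simp only: sum.swap[of _ ?Y])
    also have "\<dots> = (\<Sum>c\<in>?Y. herm_inner (mveval p c) (\<mu> (?A c)))"
      by (simp only: herm_parseval[symmetric])
    also have "0 \<le> \<dots>"
      using \<mu> p A by (intro sum_nonneg psd_inner_nonneg) (auto simp: positive_matrix_measure_def pos_herm_polys_def)
    finally show ?thesis .
  qed
  have ball: "0 \<le> (\<Sum>i\<in>UNIV. \<Sum>j\<in>UNIV. signed_integral borel (?\<nu> i j) (\<lambda>t. indicator (?B R) t * ?f i j t))" for R
  proof (rule LIMSEQ_le_const)
    show "(\<lambda>k. \<Sum>i\<in>UNIV. \<Sum>j\<in>UNIV. signed_integral borel (?\<nu> i j) (\<lambda>t. indicator (?B R) t * ?f i j (s k t)))
      \<longlonglongrightarrow> (\<Sum>i\<in>UNIV. \<Sum>j\<in>UNIV. signed_integral borel (?\<nu> i j) (\<lambda>t. indicator (?B R) t * ?f i j t))"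
    proof (intro tendsto_sum)
      fix i j :: 'm
      \<comment> \<open>For t in the ball of radius R the point s k t may leave that ball, but not
        the one of radius 2R; the bound is taken there.\<close>
      have "bounded (?f i j ` cball 0 (2 * real R))"
        by (intro compact_imp_bounded compact_continuous_image continuous_on_subset[OF cont]) auto
      then obtain K where K: "\<And>t. t \<in> cball 0 (2 * real R) \<Longrightarrow> \<bar>?f i j t\<bar> \<le> K" "0 \<le> K"
        unfolding bounded_pos by (fastforce simp: image_iff)
      show "(\<lambda>k. signed_integral borel (?\<nu> i j) (\<lambda>t. indicator (?B R) t * ?f i j (s k t)))
        \<longlonglongrightarrow> signed_integral borel (?\<nu> i j) (\<lambda>t. indicator (?B R) t * ?f i j t)"
      proof (rule signed_integral_dominated_convergence[where w = "\<lambda>_. K"])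
        show "signed_integrable borel (?\<nu> i j) (\<lambda>_. K)"
          using finite_measure.integrable_const[OF finite_jordan(1)[OF one]]
            finite_measure.integrable_const[OF finite_jordan(2)[OF one]]
          unfolding signed_integrable_def by blast
        show "(\<lambda>k. indicator (?B R) t * ?f i j (s k t)) \<longlonglongrightarrow> indicator (?B R) t * ?f i j t" for t
          by (intro tendsto_mult_left continuous_on_tendsto_compose[OF cont s(2)]) auto
        show "\<bar>indicator (?B R) t * ?f i j (s k t)\<bar> \<le> K" for k t
        proof (cases "t \<in> ?B R")
          case True
          then have "s k t \<in> cball 0 (2 * real R)" using s(3)[of k t] by (simp add: dist_commute)
          then show ?thesis using K(1) True by simp
        qed (use K(2) in simp)
        show "(\<lambda>t. indicator (?B R) t * ?f i j (s k t)) \<in> borel_measurable borel" for k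
          by (intro borel_measurable_times borel_measurable_indicator
              measurable_compose[OF borel_measurable_simple_function[OF s(1)] fm]) auto
        show "(\<lambda>t. indicator (?B R) t * ?f i j t) \<in> borel_measurable borel"
          by (intro borel_measurable_times fm borel_measurable_indicator) auto
      qed
    qed
  qed (use step in blast)
  have "(\<lambda>R. \<Sum>i\<in>UNIV. \<Sum>j\<in>UNIV. signed_integral borel (?\<nu> i j) (\<lambda>t. indicator (?B R) t * ?f i j t))
      \<longlonglongrightarrow> (\<Sum>i\<in>UNIV. \<Sum>j\<in>UNIV. signed_integral borel (?\<nu> i j) (?f i j))"
  proof (intro tendsto_sum)
    fix i j :: 'm
    show "(\<lambda>R. signed_integral borel (?\<nu> i j) (\<lambda>t. indicator (?B R) t * ?f i j t)) \<longlonglongrightarrow> signed_integral borel (?\<nu> i j) (?f i j)"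
    proof (rule signed_integral_dominated_convergence[where w = "\<lambda>t. \<bar>?f i j t\<bar>"])
      show "signed_integrable borel (?\<nu> i j) (\<lambda>t. \<bar>?f i j t\<bar>)"
        using r by (simp add: represents_def pairing_integrable_def signed_integrable_def)
      show "(\<lambda>R. indicator (?B R) t * ?f i j t) \<longlonglongrightarrow> ?f i j t" for t
      proof (rule tendsto_eventually)
        obtain R0 :: nat where "norm t \<le> R0" using real_arch_simple by blast
        then show "\<forall>\<^sub>F R in sequentially. indicator (?B R) t * ?f i j t = ?f i j t"
          by (auto simp: eventually_sequentially intro!: exI[of _ R0])
      qed
      show "\<bar>indicator (?B R) t * ?f i j t\<bar> \<le> \<bar>?f i j t\<bar>" for R t by (simp add: indicator_def)
      show "(\<lambda>t. indicator (?B R) t * ?f i j t) \<in> borel_measurable borel" for R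
        by (intro borel_measurable_times fm borel_measurable_indicator) auto
    qed (rule fm)
  qed
  then have "0 \<le> (\<Sum>i\<in>UNIV. \<Sum>j\<in>UNIV. signed_integral borel (?\<nu> i j) (?f i j))"
    by (rule LIMSEQ_le_const) (use ball in blast)
  then show ?thesis using r by (simp add: represents_def pairing_integral_def)
qed

text \<open>For psd M the functional is nonnegative on positive polynomials by self-duality, and
  \<open>matrix_haviland\<close> applies. For other M, where no positivity is demanded, the
  difference of two such measures serves.\<close>

lemma exists_representing_measure:
  fixes Q :: "('n::finite \<Rightarrow>\<^sub>0 nat) \<Rightarrow> 'm::{finite,linorder} herm \<Rightarrow> ('n, 'm herm) mvpoly"
  assumes Q: "\<And>\<alpha>. linear (Q \<alpha>)" and pos: "\<And>q. q \<in> pos_herm_polys \<Longrightarrow> symbol_form Q y q \<in> herm_psd"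
  shows "\<exists>\<mu>. is_representing_measure Q y M \<mu>"
proof -
  let ?L = "\<lambda>M p. herm_inner (symbol_form Q y p) M"
  have ex: "\<exists>\<mu>. positive_matrix_measure \<mu> \<and> represents \<mu> (?L M)" if M: "M \<in> herm_psd" for M
  proof -
    have L: "linear (?L M)"
      using linear_compose[OF linear_symbol_form[OF Q] linear_herm_inner_left] by (simp add: o_def)
    have "0 \<le> ?L M p" if "p \<in> pos_herm_polys" for p
      by (intro psd_inner_nonneg pos that M)
    from L this show ?thesis
    proof (rule matrix_haviland)
      fix \<sigma> and x :: "real \<Rightarrow> real^'n" and v :: "real \<Rightarrow> (complex, 'm) vec"
      assume \<sigma>: "real_distribution \<sigma>" "continuous_on UNIV x" "continuous_on UNIV v"
        "\<And>p. integrable \<sigma> (\<lambda>s. form_at (x s) (v s) p)" and val: "\<And>p. ?L M p = (\<integral>s. form_at (x s) (v s) p \<partial>\<sigma>)"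
      have "?L M = (\<lambda>p. \<integral>s. form_at (x s) (v s) p \<partial>\<sigma>)" by (rule ext) (rule val)
      with image_measure_represents[OF \<sigma>] show ?thesis by auto
    qed
  qed
  show ?thesis
  proof (cases "M \<in> herm_psd")
    case True
    then show ?thesis using ex[OF True] by (auto simp: is_representing_measure_iff[OF Q])
  next
    case False
    obtain A B where AB: "A \<in> herm_psd" "B \<in> herm_psd" "M = A - B" using herm_diff_psd[of M] by blast
    obtain \<mu>\<^sub>1 \<mu>\<^sub>2 where "represents \<mu>\<^sub>1 (?L A)" "represents \<mu>\<^sub>2 (?L B)" using ex AB by blast
    from represents_diff[OF this] have "represents (\<lambda>S. \<mu>\<^sub>1 S - \<mu>\<^sub>2 S) (?L M)"
      by (simp add: AB(3) herm_inner_diff_right)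
    with False show ?thesis by (auto simp: is_representing_measure_iff[OF Q])
  qed
qed

section \<open>The moments of the coefficients\<close>

text \<open>Coordinate (i, j) of Q_\<beta>(M)(y) is the functional belonging to
  \<open>herm_basis i j\<close>, evaluated at M x^\<beta>. Its representing measure makes this the
  integral of t^\<beta> against that measure paired with M, and the tilde measure reassembles these
  coordinates.\<close>

lemma tilde_measure_moment:
  fixes Q :: "('n::finite \<Rightarrow>\<^sub>0 nat) \<Rightarrow> 'm::{finite,linorder} herm \<Rightarrow> ('n, 'm herm) mvpoly"
  assumes Q: "\<And>\<alpha>. linear (Q \<alpha>)" and rep: "\<And>i j. is_representing_measure Q y (herm_basis i j) (\<mu> (herm_basis i j))"
  shows "herm_integrable (tilde_measure \<mu> M) (\<lambda>t. mpow t \<beta>)"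
    and "mveval (Q \<beta> M) y = herm_integral (tilde_measure \<mu> M) (\<lambda>t. mpow t \<beta>)"
proof -
  let ?\<mu> = "\<lambda>i j. \<mu> (herm_basis i j)" and ?A = "\<lambda>\<beta>. mveval (Q \<beta> M) y"
  have r: "represents (?\<mu> i j) (\<lambda>p. herm_inner (symbol_form Q y p) (herm_basis i j))" for i j
    using rep by (simp add: is_representing_measure_iff[OF Q])
  have mm: "matrix_measure (?\<mu> i j)" for i j using r[of i j] by (simp add: represents_def)
  have pm: "(\<lambda>t. mpow t \<beta>) \<in> borel_measurable (borel :: (real^'n) measure)" for \<beta>
    by (intro borel_measurable_continuous_onI continuous_on_mpow continuous_on_id)
  let ?\<nu> = "\<lambda>i j S. herm_inner (?\<mu> i j S) M"
  have \<nu>: "signed_integrable borel (?\<nu> i j) (\<lambda>t. mpow t \<beta>)"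
    "signed_integral borel (?\<nu> i j) (\<lambda>t. mpow t \<beta>) = herm_inner (?A \<beta>) (herm_basis i j)" for i j \<beta>
  proof -
    \<comment> \<open>M is expanded in the basis because \<open>represents_integrable\<close> speaks
      of the coordinate measures.\<close>
    let ?c = "\<lambda>(k, l). herm_inner M (herm_basis k l)"
    let ?n = "\<lambda>(k, l) S. herm_inner (?\<mu> i j S) (herm_basis k l)"
    have 1: "vector_measure borel (?n kl)" "signed_integrable borel (?n kl) (\<lambda>_. 1)"
      "signed_integrable borel (?n kl) (\<lambda>t. mpow t \<beta>)" for kl
      using represents_integrable[OF r] vector_measure_herm_inner[OF mm] by (cases kl; simp)+
    have 2: "?\<nu> i j S = (\<Sum>kl\<in>UNIV \<times> UNIV. ?c kl * ?n kl S)" for S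
      by (subst herm_parseval) (simp add: sum.cartesian_product case_prod_unfold mult.commute)
    note s = signed_integral_sum[where K = "UNIV \<times> UNIV", OF _ 1 pm 2]
    show "signed_integrable borel (?\<nu> i j) (\<lambda>t. mpow t \<beta>)" by (rule s(1)) simp
    have "signed_integral borel (?\<nu> i j) (\<lambda>t. mpow t \<beta>)
        = (\<Sum>kl\<in>UNIV \<times> UNIV. ?c kl * signed_integral borel (?n kl) (\<lambda>t. mpow t \<beta>))"
      by (rule s(2)) simp
    also have "\<dots> = (\<Sum>k\<in>UNIV. \<Sum>l\<in>UNIV. herm_inner M (herm_basis k l)
        * signed_integral borel (\<lambda>S. herm_inner (?\<mu> i j S) (herm_basis k l)) (\<lambda>t. mpow t \<beta>))"
      by (simp add: sum.cartesian_product case_prod_unfold)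
    also have "\<dots> = pairing_integral (?\<mu> i j) (mveval (Poly_Mapping.single \<beta> M))"
    proof -
      have "signed_integral borel \<rho> (\<lambda>t. mpow t \<beta> * c) = c * signed_integral borel \<rho> (\<lambda>t. mpow t \<beta>)"
        for \<rho> :: "(real^'n) set \<Rightarrow> real" and c
        by (simp add: signed_integral_def algebra_simps)
      then show ?thesis by (simp add: pairing_integral_def mveval_single herm_inner_scale_left)
    qed
    also have "\<dots> = herm_inner (?A \<beta>) (herm_basis i j)"
    proof -
      have "herm_inner (symbol_form Q y (Poly_Mapping.single \<beta> M)) (herm_basis i j)
          = pairing_integral (?\<mu> i j) (mveval (Poly_Mapping.single \<beta> M))"
        using r[of i j] unfolding represents_def by blast
      then show ?thesis by (simp add: symbol_form_single[OF Q])
    qed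
    finally show "signed_integral borel (?\<nu> i j) (\<lambda>t. mpow t \<beta>) = herm_inner (?A \<beta>) (herm_basis i j)" .
  qed
  \<comment> \<open>Entrywise integrals split into real and imaginary parts; both are linear
    functionals of an entry and are treated together.\<close>
  have comb: "signed_integrable borel (\<lambda>S. h (hmat (tilde_measure \<mu> M S) $ k $ l)) (\<lambda>t. mpow t \<beta>)"
    "signed_integral borel (\<lambda>S. h (hmat (tilde_measure \<mu> M S) $ k $ l)) (\<lambda>t. mpow t \<beta>) = h (hmat (?A \<beta>) $ k $ l)"
    if h: "linear h" for h :: "complex \<Rightarrow> real" and k l
  proof -
    let ?c = "\<lambda>(i, j). h (hmat (herm_basis i j) $ k $ l)"
    let ?n = "\<lambda>(i, j). ?\<nu> i j"
    have one: "signed_integrable borel (?\<nu> i j) (\<lambda>_. 1)" for i j using \<nu>(1)[of i j 0] by (simp add: mpow_def)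
    have 1: "vector_measure borel (?n ij)" "signed_integrable borel (?n ij) (\<lambda>_. 1)"
      "signed_integrable borel (?n ij) (\<lambda>t. mpow t \<beta>)" for ij
      using one \<nu>(1) vector_measure_herm_inner[OF mm] by (cases ij; simp)+
    have 2: "h (hmat (tilde_measure \<mu> M S) $ k $ l) = (\<Sum>ij\<in>UNIV \<times> UNIV. ?c ij * ?n ij S)" for S
      by (simp add: tilde_measure_def hmat_sum scaleR_herm.rep_eq linear_sum[OF h] linear_scale[OF h]
          sum.cartesian_product case_prod_unfold mult.commute)
    note s = signed_integral_sum[where K = "UNIV \<times> UNIV", OF _ 1 pm 2]
    show "signed_integrable borel (\<lambda>S. h (hmat (tilde_measure \<mu> M S) $ k $ l)) (\<lambda>t. mpow t \<beta>)"
      by (rule s(1)) simp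
    have "signed_integral borel (\<lambda>S. h (hmat (tilde_measure \<mu> M S) $ k $ l)) (\<lambda>t. mpow t \<beta>)
        = (\<Sum>ij\<in>UNIV \<times> UNIV. ?c ij * signed_integral borel (?n ij) (\<lambda>t. mpow t \<beta>))"
      by (rule s(2)) simp
    also have "\<dots> = (\<Sum>i\<in>UNIV. \<Sum>j\<in>UNIV. herm_inner (?A \<beta>) (herm_basis i j) * h (hmat (herm_basis i j) $ k $ l))"
      by (simp add: sum.cartesian_product case_prod_unfold \<nu>(2) mult.commute)
    also have "\<dots> = h (hmat (\<Sum>i\<in>UNIV. \<Sum>j\<in>UNIV. herm_inner (?A \<beta>) (herm_basis i j) *\<^sub>R herm_basis i j) $ k $ l)"
      by (simp add: hmat_sum scaleR_herm.rep_eq linear_sum[OF h] linear_scale[OF h])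
    also have "\<dots> = h (hmat (?A \<beta>) $ k $ l)" by (simp only: herm_basis_expansion[symmetric])
    finally show "signed_integral borel (\<lambda>S. h (hmat (tilde_measure \<mu> M S) $ k $ l)) (\<lambda>t. mpow t \<beta>) = h (hmat (?A \<beta>) $ k $ l)" .
  qed
  have lin: "linear Re" "linear Im" by (simp_all add: linearI)
  show "herm_integrable (tilde_measure \<mu> M) (\<lambda>t. mpow t \<beta>)"
    by (simp add: herm_integrable_def complex_integrable_def comb(1)[OF lin(1)] comb(1)[OF lin(2)])
  show "?A \<beta> = herm_integral (tilde_measure \<mu> M) (\<lambda>t. mpow t \<beta>)"
    by (simp add: herm_eq_iff herm_integral.rep_eq complex_integral_def comb(2)[OF lin(1)] comb(2)[OF lin(2)] complex_eq_iff)
qed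

theorem theorem4p2:
  fixes Q :: "('n::finite \<Rightarrow>\<^sub>0 nat) \<Rightarrow> 'm::{finite,linorder} herm \<Rightarrow> ('n, 'm herm) mvpoly"
    and T :: "('n, 'm herm) mvpoly \<Rightarrow> ('n, 'm herm) mvpoly"
  assumes "linear T"
    and "\<And>\<alpha>. linear (Q \<alpha>)"
    and "T = diff_op Q"
  shows
    "(T ` pos_herm_polys \<subseteq> pos_herm_polys
        \<longleftrightarrow> (\<forall>y. diff_op_at Q y ` pos_herm_polys \<subseteq> pos_herm_polys))
     \<and> (T ` pos_herm_polys \<subseteq> pos_herm_polys
        \<longleftrightarrow> (\<forall>y. \<forall>M\<in>herm_psd. diff_op_at_inner Q y M ` pos_herm_polys \<subseteq> nonneg_polys))
     \<and> (T ` pos_herm_polys \<subseteq> pos_herm_polys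
        \<longleftrightarrow> (\<forall>y M. \<exists>\<mu>. is_representing_measure Q y M \<mu>))
     \<and> (\<forall>\<mu>. (\<forall>y M. is_representing_measure Q y M (\<mu> y M)) \<longrightarrow>
          (\<forall>\<beta> y M.
             herm_integrable (tilde_measure (\<mu> y) M) (\<lambda>t. mpow t \<beta>) \<and>
             mveval (Q \<beta> M) y = herm_integral (tilde_measure (\<mu> y) M) (\<lambda>t. mpow t \<beta>)))"
proof -
  note Q = assms(2)
  define pos where "pos \<longleftrightarrow> (\<forall>y. \<forall>q\<in>pos_herm_polys. symbol_form Q y q \<in> herm_psd)"
  have i: "T ` pos_herm_polys \<subseteq> pos_herm_polys \<longleftrightarrow> pos"
  proof
    assume T: "T ` pos_herm_polys \<subseteq> pos_herm_polys"
    have "symbol_form Q y q \<in> herm_psd" if q: "q \<in> pos_herm_polys" for y and q :: "('n, 'm herm) mvpoly"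
    proof -
      \<comment> \<open>At y the operator sees the translate by y; testing it on q(_ - y) returns q
        itself.\<close>
      have "T (mvtranslate (- y) q) \<in> pos_herm_polys" using T mvtranslate_pos[OF q] by blast
      then have "mveval (T (mvtranslate (- y) q)) y \<in> herm_psd" by (simp add: pos_herm_polys_def)
      then show ?thesis by (simp add: assms(3) mveval_diff_op[OF Q] mvtranslate_minus)
    qed
    then show pos by (simp add: pos_def)
  next
    assume pos
    show "T ` pos_herm_polys \<subseteq> pos_herm_polys"
    proof clarify
      fix p :: "('n, 'm herm) mvpoly" assume p: "p \<in> pos_herm_polys"
      have "mveval (T p) y \<in> herm_psd" for y
        using \<open>pos\<close> mvtranslate_pos[OF p, of y] by (simp add: pos_def assms(3) mveval_diff_op[OF Q])
      then show "T p \<in> pos_herm_polys" by (simp add: pos_herm_polys_def)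
    qed
  qed
  have ii: "(\<forall>y. diff_op_at Q y ` pos_herm_polys \<subseteq> pos_herm_polys) \<longleftrightarrow> pos"
  proof
    assume T: "\<forall>y. diff_op_at Q y ` pos_herm_polys \<subseteq> pos_herm_polys"
    have "symbol_form Q y q \<in> herm_psd" if q: "q \<in> pos_herm_polys" for y and q :: "('n, 'm herm) mvpoly"
    proof -
      have "diff_op_at Q y q \<in> pos_herm_polys" using T q by blast
      then have "mveval (diff_op_at Q y q) 0 \<in> herm_psd" by (simp add: pos_herm_polys_def)
      then show ?thesis by (simp add: mveval_diff_op_at[OF Q] mvtranslate_0)
    qed
    then show pos by (simp add: pos_def)
  next
    assume pos
    show "\<forall>y. diff_op_at Q y ` pos_herm_polys \<subseteq> pos_herm_polys"
    proof clarify
      fix y and p :: "('n, 'm herm) mvpoly" assume p: "p \<in> pos_herm_polys"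
      have "mveval (diff_op_at Q y p) x \<in> herm_psd" for x
        using \<open>pos\<close> mvtranslate_pos[OF p, of x] by (simp add: pos_def mveval_diff_op_at[OF Q])
      then show "diff_op_at Q y p \<in> pos_herm_polys" by (simp add: pos_herm_polys_def)
    qed
  qed
  have iii: "(\<forall>y. \<forall>M\<in>herm_psd. diff_op_at_inner Q y M ` pos_herm_polys \<subseteq> nonneg_polys) \<longleftrightarrow> pos"
  proof
    assume T: "\<forall>y. \<forall>M\<in>herm_psd. diff_op_at_inner Q y M ` pos_herm_polys \<subseteq> nonneg_polys"
    have "0 \<le> herm_inner (symbol_form Q y q) M"
      if q: "q \<in> pos_herm_polys" and M: "M \<in> herm_psd" for y M and q :: "('n, 'm herm) mvpoly"
    proof -
      have "diff_op_at_inner Q y M q \<in> nonneg_polys" using T q M by blast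
      then have "0 \<le> mveval (diff_op_at_inner Q y M q) 0" by (simp add: nonneg_polys_def)
      then show ?thesis by (simp add: mveval_diff_op_at_inner[OF Q] mvtranslate_0)
    qed
    then show pos unfolding pos_def by (subst psd_iff_inner) blast
  next
    assume pos
    have "diff_op_at_inner Q y M q \<in> nonneg_polys"
      if q: "q \<in> pos_herm_polys" and M: "M \<in> herm_psd" for y M and q :: "('n, 'm herm) mvpoly"
      using \<open>pos\<close> mvtranslate_pos[OF q] M
      by (simp add: nonneg_polys_def mveval_diff_op_at_inner[OF Q] psd_inner_nonneg pos_def)
    then show "\<forall>y. \<forall>M\<in>herm_psd. diff_op_at_inner Q y M ` pos_herm_polys \<subseteq> nonneg_polys" by blast
  qed
  have iv: "(\<forall>y M. \<exists>\<mu>. is_representing_measure Q y M \<mu>) \<longleftrightarrow> pos"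
  proof
    assume ex: "\<forall>y M. \<exists>\<mu>. is_representing_measure Q y M \<mu>"
    have "0 \<le> herm_inner (symbol_form Q y q) M"
      if q: "q \<in> pos_herm_polys" and M: "M \<in> herm_psd" for y M and q :: "('n, 'm herm) mvpoly"
    proof -
      obtain \<mu> where "is_representing_measure Q y M \<mu>" using ex by blast
      then have "positive_matrix_measure \<mu>" "represents \<mu> (\<lambda>p. herm_inner (symbol_form Q y p) M)"
        using M by (simp_all add: is_representing_measure_iff[OF Q])
      from represents_nonneg[OF this q] show ?thesis .
    qed
    then show pos unfolding pos_def by (subst psd_iff_inner) blast
  next
    assume pos
    then show "\<forall>y M. \<exists>\<mu>. is_representing_measure Q y M \<mu>"
      by (intro allI exists_representing_measure Q) (simp add: pos_def)
  qed
  show ?thesis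
    unfolding i ii iii iv
  proof (intro conjI refl allI impI)
    fix \<mu> \<beta> y M assume "\<forall>y M. is_representing_measure Q y M (\<mu> y M)"
    then have rep: "is_representing_measure Q y (herm_basis i j) (\<mu> y (herm_basis i j))" for i j by blast
    show "herm_integrable (tilde_measure (\<mu> y) M) (\<lambda>t. mpow t \<beta>)"
      by (rule tilde_measure_moment(1)[where Q = Q, OF Q rep])
    show "mveval (Q \<beta> M) y = herm_integral (tilde_measure (\<mu> y) M) (\<lambda>t. mpow t \<beta>)"
      by (rule tilde_measure_moment(2)[where Q = Q, OF Q rep])
  qed
qed

end
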